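(* Let $N$ be a finitely generated free nilpotent group, let $p$ be a prime, and let $\mathbf{N}$ denote the pro-$p$ completion of $N$. The natural map $$\mathrm{Out}(N)\to\mathrm{Out}(\mathbf{N})$$ is injective.
   Context: A finitely generated free nilpotent group is a group of the form $F/\gamma_{c+1}(F)$ with $F$ a finitely generated free group and $c\geqslant 1$, where $\gamma_1(F)=F$ and $\gamma_{n}(F)=[F,\gamma_{n-1}(F)]$. For a finitely generated pro-$p$ group $\mathbf{N}$, $\mathrm{Out}(\mathbf{N})$ is the group of continuous automorphisms modulo inner automorphisms. The natural map sends the class of an automorphism of $N$ to the class of the automorphism it induces on $\mathbf{N}$. *)

theory Defs
  imports "HOL-Analysis.Analysis" "HOL-Algebra.Bij" "HOL-Algebra.Product_Groups"
begin

section \<open>Free groups of finite rank\<close>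

text \<open>The letter \<open>(True, i)\<close> stands for the \<open>i\<close>-th generator and \<open>(False, i)\<close> for its inverse.\<close>

type_synonym letter = "bool \<times> nat"

definition inv_letter :: "letter \<Rightarrow> letter"
  where "inv_letter a = (\<not> fst a, snd a)"

definition reduced_word :: "letter list \<Rightarrow> bool"
  where "reduced_word w = successively (\<lambda>a b. b \<noteq> inv_letter a) w"

definition cancel_cons :: "letter \<Rightarrow> letter list \<Rightarrow> letter list"
  where "cancel_cons a w = (case w of [] \<Rightarrow> [a] | b # v \<Rightarrow> if b = inv_letter a then v else a # w)"

text \<open>Multiplying the letters of \<open>u\<close> onto a reduced word \<open>v\<close> one at a time, from the right,
  yields the reduced form of the concatenation \<open>u @ v\<close>.\<close>

definition free_group :: "nat \<Rightarrow> letter list monoid"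
  where "free_group n =
    \<lparr>carrier = {w. reduced_word w \<and> snd ` set w \<subseteq> {..<n}},
     mult = (\<lambda>u v. foldr cancel_cons u v),
     one = []\<rparr>"

lemma inv_letter_inv_letter [simp]: "inv_letter (inv_letter a) = a"
  by (simp add: inv_letter_def)

lemma snd_inv_letter [simp]: "snd (inv_letter a) = snd a"
  by (simp add: inv_letter_def)

lemma inv_letter_neq [simp]: "inv_letter a \<noteq> a" "a \<noteq> inv_letter a"
  by (auto simp: inv_letter_def prod_eq_iff)

lemma reduced_simps [simp]:
  "reduced_word []" "reduced_word [a]" "reduced_word (a # b # w) \<longleftrightarrow> b \<noteq> inv_letter a \<and> reduced_word (b # w)"
  by (auto simp: reduced_word_def)

lemma reduced_ConsD: "reduced_word (a # w) \<Longrightarrow> reduced_word w"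
  by (cases w) auto

lemma cancel_cons_Cons: "cancel_cons a (b # v) = (if b = inv_letter a then v else a # b # v)"
  by (simp add: cancel_cons_def)

lemma reduced_cancel_cons: "reduced_word w \<Longrightarrow> reduced_word (cancel_cons a w)"
  by (cases w) (auto simp: cancel_cons_def dest: reduced_ConsD)

lemma cancel_cons_reduced: "reduced_word (a # w) \<Longrightarrow> cancel_cons a w = a # w"
  by (cases w) (auto simp: cancel_cons_def)

lemma cancel_cons_cancel: "reduced_word w \<Longrightarrow> cancel_cons a (cancel_cons (inv_letter a) w) = w"
  by (cases w; cases "tl w") (auto simp: cancel_cons_def)

lemma reduced_foldr: "reduced_word w \<Longrightarrow> reduced_word (foldr cancel_cons u w)"
  by (induction u) (auto intro: reduced_cancel_cons)

lemma set_cancel_cons: "set (cancel_cons a w) \<subseteq> insert a (set w)"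
  by (auto simp: cancel_cons_def split: list.splits if_splits)

lemma set_foldr_cancel: "set (foldr cancel_cons u w) \<subseteq> set u \<union> set w"
proof (induction u)
  case (Cons a u)
  then show ?case using set_cancel_cons[of a "foldr cancel_cons u w"] by auto
qed auto

lemma foldr_cancel_Nil: "reduced_word u \<Longrightarrow> foldr cancel_cons u [] = u"
proof (induction u)
  case (Cons a u)
  then show ?case using reduced_ConsD[OF Cons.prems] by (simp add: cancel_cons_reduced)
qed simp

lemma foldr_cancel_cons:
  assumes "reduced_word w"
  shows "foldr cancel_cons (cancel_cons a u) w = cancel_cons a (foldr cancel_cons u w)"
proof (cases u)
  case (Cons b v)
  then show ?thesis
    using cancel_cons_cancel[OF reduced_foldr[OF assms], of a v]
    by (cases "b = inv_letter a") (simp_all add: cancel_cons_Cons)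
qed (auto simp: cancel_cons_def)

lemma foldr_cancel_assoc:
  "reduced_word w \<Longrightarrow>
    foldr cancel_cons (foldr cancel_cons u v) w = foldr cancel_cons u (foldr cancel_cons v w)"
  by (induction u) (auto simp: foldr_cancel_cons)

lemma foldr_cancel_inv:
  "reduced_word w \<Longrightarrow> foldr cancel_cons (rev (map inv_letter u)) (foldr cancel_cons u w) = w"
proof (induction u)
  case (Cons a u)
  then show ?case
    using cancel_cons_cancel[OF reduced_foldr[OF Cons.prems], of "inv_letter a" u] by simp
qed simp

lemma group_free_group: "group (free_group n)"
proof (rule groupI)
  fix x assume x: "x \<in> carrier (free_group n)"
  define y where "y = foldr cancel_cons (rev (map inv_letter x)) []"
  have "foldr cancel_cons y x = foldr cancel_cons (rev (map inv_letter x)) (foldr cancel_cons x [])"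
    using x by (simp add: y_def free_group_def foldr_cancel_assoc foldr_cancel_Nil)
  also have "\<dots> = []" by (simp add: foldr_cancel_inv)
  finally have "foldr cancel_cons y x = []" .
  moreover have "y \<in> carrier (free_group n)"
    using x set_foldr_cancel[of "rev (map inv_letter x)" "[]"]
    by (fastforce simp: y_def free_group_def intro: reduced_foldr)
  ultimately show "\<exists>y\<in>carrier (free_group n). y \<otimes>\<^bsub>free_group n\<^esub> x = \<one>\<^bsub>free_group n\<^esub>"
    by (auto simp: free_group_def)
next
  fix x y assume "x \<in> carrier (free_group n)" "y \<in> carrier (free_group n)"
  then show "x \<otimes>\<^bsub>free_group n\<^esub> y \<in> carrier (free_group n)"
    using set_foldr_cancel[of x y] by (fastforce simp: free_group_def intro: reduced_foldr)
qed (auto simp: free_group_def foldr_cancel_assoc)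

lemma free_group_universal:
  assumes "group G" and x: "\<And>i. i < n \<Longrightarrow> x i \<in> carrier G"
  shows "\<exists>!h. h \<in> hom (free_group n) G \<inter> extensional (carrier (free_group n)) \<and>
              (\<forall>i<n. h [(True, i)] = x i)"
proof -
  interpret G: group G by fact
  let ?F = "free_group n"
  interpret F: group ?F by (rule group_free_group)
  define l where "l = (\<lambda>a. if fst a then x (snd a) else inv\<^bsub>G\<^esub> x (snd a))"
  have l: "l a \<in> carrier G" "l (inv_letter a) = inv\<^bsub>G\<^esub> l a" if "snd a < n" for a
    using x[OF that] by (auto simp: l_def inv_letter_def)
  define e where "e = (\<lambda>w. foldr (\<lambda>a y. l a \<otimes>\<^bsub>G\<^esub> y) w \<one>\<^bsub>G\<^esub>)"
  have e: "e w \<in> carrier G" if "snd ` set w \<subseteq> {..<n}" for w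
    using that unfolding e_def by (induction w) (auto intro!: l)
  have ec: "e (cancel_cons a w) = l a \<otimes>\<^bsub>G\<^esub> e w" if "snd ` set w \<subseteq> {..<n}" "snd a < n" for a w
  proof (cases w)
    case (Cons b v)
    have "e v \<in> carrier G" by (rule e) (use that Cons in auto)
    moreover have "e (b # v) = l b \<otimes>\<^bsub>G\<^esub> e v" by (simp add: e_def)
    ultimately show ?thesis
      using that Cons l(1)[of a] l(2)[of a]
      by (auto simp: cancel_cons_def e_def simp flip: G.m_assoc)
  qed (use l that in \<open>auto simp: cancel_cons_def e_def\<close>)
  have em: "e (foldr cancel_cons u w) = e u \<otimes>\<^bsub>G\<^esub> e w"
    if "snd ` set u \<subseteq> {..<n}" "snd ` set w \<subseteq> {..<n}" for u w
    using that
  proof (induction u)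
    case Nil
    then show ?case using e[of w] by (simp add: e_def)
  next
    case (Cons a u)
    have "snd ` set (foldr cancel_cons u w) \<subseteq> {..<n}"
      using Cons.prems set_foldr_cancel[of u w] by fastforce
    then have "e (foldr cancel_cons (a # u) w) = l a \<otimes>\<^bsub>G\<^esub> (e u \<otimes>\<^bsub>G\<^esub> e w)"
      using Cons by (simp add: ec)
    also have "\<dots> = e (a # u) \<otimes>\<^bsub>G\<^esub> e w"
      using Cons.prems l[of a] e[of u] e[of w] by (simp add: e_def G.m_assoc)
    finally show ?case .
  qed
  have Fc: "carrier ?F = {w. reduced_word w \<and> snd ` set w \<subseteq> {..<n}}"
    and Fm: "u \<otimes>\<^bsub>?F\<^esub> v = foldr cancel_cons u v" for u v
    by (auto simp: free_group_def)
  show ?thesis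
  proof (rule ex1I[of _ "restrict e (carrier ?F)"])
    have "restrict e (carrier ?F) \<in> hom ?F G"
    proof (rule homI)
      fix u v assume uv: "u \<in> carrier ?F" "v \<in> carrier ?F"
      then show "restrict e (carrier ?F) (u \<otimes>\<^bsub>?F\<^esub> v) =
          restrict e (carrier ?F) u \<otimes>\<^bsub>G\<^esub> restrict e (carrier ?F) v"
        using em[of u v] F.m_closed[OF uv] by (simp add: Fc Fm)
    qed (use e in \<open>auto simp: Fc\<close>)
    then show "restrict e (carrier ?F) \<in> hom ?F G \<inter> extensional (carrier ?F) \<and>
        (\<forall>i<n. restrict e (carrier ?F) [(True, i)] = x i)"
      using x by (auto simp: Fc e_def l_def)
  next
    fix h assume h: "h \<in> hom ?F G \<inter> extensional (carrier ?F) \<and> (\<forall>i<n. h [(True, i)] = x i)"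
    then interpret h: group_hom ?F G h by unfold_locales auto
    have letter: "h [a] = l a" if "snd a < n" for a
    proof (cases "fst a")
      case True
      then show ?thesis using h that by (cases a) (auto simp: l_def)
    next
      case False
      define i where "i = snd a"
      have a: "a = (False, i)" using False by (cases a) (auto simp: i_def)
      have c: "[(True, i)] \<in> carrier ?F" "[a] \<in> carrier ?F" using that by (auto simp: Fc a)
      have "[a] \<otimes>\<^bsub>?F\<^esub> [(True, i)] = \<one>\<^bsub>?F\<^esub>"
        by (simp add: a free_group_def cancel_cons_def inv_letter_def)
      then have "[a] = inv\<^bsub>?F\<^esub> [(True, i)]" using c by (simp add: F.inv_equality)
      then have "h [a] = inv\<^bsub>G\<^esub> h [(True, i)]" using c by simp
      then show ?thesis using h that by (simp add: a l_def)
    qed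
    have "h w = e w" if "w \<in> carrier ?F" for w
      using that
    proof (induction w)
      case Nil
      have "h [] = \<one>\<^bsub>G\<^esub>" using h.hom_one by (simp add: free_group_def)
      then show ?case by (simp add: e_def)
    next
      case (Cons a w)
      then have c: "[a] \<in> carrier ?F" "w \<in> carrier ?F" "snd a < n"
        by (auto simp: Fc dest: reduced_ConsD)
      have "a # w = [a] \<otimes>\<^bsub>?F\<^esub> w"
        using Cons.prems by (simp add: Fm Fc cancel_cons_reduced)
      then have "h (a # w) = h [a] \<otimes>\<^bsub>G\<^esub> h w" using c by simp
      then show ?case using Cons.IH c letter by (simp add: e_def)
    qed
    then show "h = restrict e (carrier ?F)"
      using h by (auto simp: extensional_def)
  qed
qed


section \<open>Free nilpotent groups\<close>

definition commutator_subgroup :: "('a, 'm) monoid_scheme \<Rightarrow> 'a set \<Rightarrow> 'a set \<Rightarrow> 'a set"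
  where "commutator_subgroup G H K =
    generate G (\<Union>x\<in>H. \<Union>y\<in>K. {x \<otimes>\<^bsub>G\<^esub> y \<otimes>\<^bsub>G\<^esub> inv\<^bsub>G\<^esub> x \<otimes>\<^bsub>G\<^esub> inv\<^bsub>G\<^esub> y})"

text \<open>Indexing starts at \<open>1\<close>; the value at \<open>0\<close> is irrelevant.\<close>

fun lower_central :: "('a, 'm) monoid_scheme \<Rightarrow> nat \<Rightarrow> 'a set"
  where
    "lower_central G 0 = carrier G"
  | "lower_central G (Suc 0) = carrier G"
  | "lower_central G (Suc (Suc n)) =
      commutator_subgroup G (carrier G) (lower_central G (Suc n))"

definition fg_free_nilpotent :: "('a, 'm) monoid_scheme \<Rightarrow> bool"
  where "fg_free_nilpotent N \<longleftrightarrow>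
    group N \<and> (\<exists>n c. c \<ge> 1 \<and> N \<cong> free_group n Mod lower_central (free_group n) (c + 1))"


section \<open>Outer automorphism groups\<close>

definition conj_by :: "('a, 'm) monoid_scheme \<Rightarrow> 'a \<Rightarrow> 'a \<Rightarrow> 'a"
  where "conj_by G g = (\<lambda>x\<in>carrier G. g \<otimes>\<^bsub>G\<^esub> x \<otimes>\<^bsub>G\<^esub> inv\<^bsub>G\<^esub> g)"

definition inner_auts :: "('a, 'm) monoid_scheme \<Rightarrow> ('a \<Rightarrow> 'a) set"
  where "inner_auts G = conj_by G ` carrier G"

definition Out :: "('a, 'm) monoid_scheme \<Rightarrow> ('a \<Rightarrow> 'a) set monoid"
  where "Out G = AutoGroup G Mod inner_auts G"

text \<open>In the next two definitions \<open>T\<close> is a compact Hausdorff group topology on \<open>G\<close>, so that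
  the inverse of a continuous automorphism is continuous as well.\<close>

definition ContAutoGroup :: "('a, 'm) monoid_scheme \<Rightarrow> 'a topology \<Rightarrow> ('a \<Rightarrow> 'a) monoid"
  where "ContAutoGroup G T =
    BijGroup (carrier G) \<lparr>carrier := {\<phi> \<in> auto G. continuous_map T T \<phi>}\<rparr>"

definition ContOut :: "('a, 'm) monoid_scheme \<Rightarrow> 'a topology \<Rightarrow> ('a \<Rightarrow> 'a) set monoid"
  where "ContOut G T = ContAutoGroup G T Mod inner_auts G"


section \<open>Pro-p completion\<close>

text \<open>As \<open>card\<close> of an infinite set is \<open>0\<close>, the cardinality condition forces the index to be
  finite for prime \<open>p\<close>.\<close>

definition p_power_normal :: "nat \<Rightarrow> ('a, 'm) monoid_scheme \<Rightarrow> 'a set set"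
  where "p_power_normal p N = {K. K \<lhd> N \<and> (\<exists>k. card (rcosets\<^bsub>N\<^esub> K) = p ^ k)}"

text \<open>The inverse limit of the quotients \<open>N Mod K\<close>. For \<open>K \<subseteq> L\<close> the projection
  \<open>N Mod K \<rightarrow> N Mod L\<close> sends a coset of \<open>K\<close> to the coset of \<open>L\<close> containing it.\<close>

definition pro_p_completion :: "nat \<Rightarrow> ('a, 'm) monoid_scheme \<Rightarrow> ('a set \<Rightarrow> 'a set) monoid"
  where "pro_p_completion p N =
    (let P = product_group (p_power_normal p N) (\<lambda>K. N Mod K) in
      P \<lparr>carrier := {f \<in> carrier P.
        \<forall>K\<in>p_power_normal p N. \<forall>L\<in>p_power_normal p N. K \<subseteq> L \<longrightarrow> f K \<subseteq> f L}\<rparr>)"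

definition pro_p_topology :: "nat \<Rightarrow> ('a, 'm) monoid_scheme \<Rightarrow> ('a set \<Rightarrow> 'a set) topology"
  where "pro_p_topology p N =
    subtopology
      (product_topology (\<lambda>K. discrete_topology (carrier (N Mod K))) (p_power_normal p N))
      (carrier (pro_p_completion p N))"

definition to_completion :: "nat \<Rightarrow> ('a, 'm) monoid_scheme \<Rightarrow> 'a \<Rightarrow> 'a set \<Rightarrow> 'a set"
  where "to_completion p N x = (\<lambda>K\<in>p_power_normal p N. K #>\<^bsub>N\<^esub> x)"

text \<open>An automorphism \<open>\<phi>\<close> of \<open>N\<close> induces isomorphisms from \<open>N Mod \<phi>\<inverse>(K)\<close> to \<open>N Mod K\<close>,
  which assemble to an automorphism of the inverse limit.\<close>

definition completion_aut ::
    "nat \<Rightarrow> ('a, 'm) monoid_scheme \<Rightarrow> ('a \<Rightarrow> 'a) \<Rightarrow> ('a set \<Rightarrow> 'a set) \<Rightarrow> 'a set \<Rightarrow> 'a set"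
  where "completion_aut p N \<phi> =
    (\<lambda>f\<in>carrier (pro_p_completion p N). \<lambda>K\<in>p_power_normal p N. \<phi> ` f (\<phi> -` K \<inter> carrier N))"

text \<open>The class of \<open>\<phi>\<close> is sent to the class of \<open>completion_aut p N \<phi>\<close>; this class is the same
  for all representatives \<open>\<phi>\<close>, so that the union is over equal sets (see
  \<open>out_completion_map_class\<close> below).\<close>

definition out_completion_map ::
    "nat \<Rightarrow> ('a, 'm) monoid_scheme \<Rightarrow> ('a \<Rightarrow> 'a) set \<Rightarrow> (('a set \<Rightarrow> 'a set) \<Rightarrow> 'a set \<Rightarrow> 'a set) set"
  where "out_completion_map p N A =
    (\<Union>\<phi>\<in>A. inner_auts (pro_p_completion p N)
        #>\<^bsub>ContAutoGroup (pro_p_completion p N) (pro_p_topology p N)\<^esub> completion_aut p N \<phi>)"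


section \<open>Well-definedness of the natural map\<close>

context group
begin

lemma conj_by_auto:
  assumes g: "g \<in> carrier G"
  shows "conj_by G g \<in> auto G"
proof -
  have 1: "inv g \<otimes> (g \<otimes> z) = z" "g \<otimes> (inv g \<otimes> z) = z" if "z \<in> carrier G" for z
    using g that by (simp_all flip: m_assoc)
  have "conj_by G g \<in> hom G G"
    by (rule homI) (use g 1 in \<open>auto simp: conj_by_def m_assoc\<close>)
  moreover have "bij_betw (conj_by G g) (carrier G) (carrier G)"
    by (rule bij_betwI[of _ _ _ "\<lambda>x\<in>carrier G. inv g \<otimes> x \<otimes> g"])
      (use g 1 in \<open>auto simp: conj_by_def m_assoc\<close>)
  ultimately show ?thesis by (simp add: auto_def Bij_def conj_by_def)
qed

lemma conj_by_mult:
  assumes "g \<in> carrier G" "h \<in> carrier G"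
  shows "compose (carrier G) (conj_by G g) (conj_by G h) = conj_by G (g \<otimes> h)"
  by (rule ext) (use assms in \<open>auto simp: conj_by_def compose_def m_assoc inv_mult_group\<close>)

lemma conj_by_conj:
  assumes "g \<in> carrier G" "\<phi> \<in> auto G"
  shows "compose (carrier G) \<phi> (conj_by G g) = compose (carrier G) (conj_by G (\<phi> g)) \<phi>"
proof -
  interpret h: group_hom G G \<phi> by unfold_locales (use assms in \<open>auto simp: auto_def\<close>)
  show ?thesis
    by (rule ext) (use assms in \<open>auto simp: conj_by_def compose_def\<close>)
qed

lemma conj_by_one: "conj_by G \<one> = (\<lambda>x\<in>carrier G. x)"
  unfolding conj_by_def by (rule restrict_ext) simp

lemma normal_inner_auts:
  assumes H: "subgroup H (BijGroup (carrier G))" "H \<subseteq> auto G" "inner_auts G \<subseteq> H"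
  shows "inner_auts G \<lhd> (BijGroup (carrier G) \<lparr>carrier := H\<rparr>)"
proof -
  let ?B = "BijGroup (carrier G)"
  let ?A = "?B \<lparr>carrier := H\<rparr>"
  interpret B: group ?B by (rule group_BijGroup)
  interpret A: group ?A by (rule B.subgroup_imp_group[OF H(1)])
  have aut: "auto G \<subseteq> Bij (carrier G)" by (auto simp: auto_def)
  have m: "f \<otimes>\<^bsub>?A\<^esub> h = compose (carrier G) f h" if "f \<in> H" "h \<in> H" for f h
    using that H aut by (auto simp: BijGroup_def)
  have inH: "conj_by G g \<in> H" if "g \<in> carrier G" for g
    using that H by (auto simp: inner_auts_def)
  have one: "\<one>\<^bsub>?A\<^esub> = conj_by G \<one>" unfolding conj_by_one by (simp add: BijGroup_def)
  have sub: "subgroup (inner_auts G) ?A"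
  proof (rule A.subgroupI)
    show "inner_auts G \<subseteq> carrier ?A" "inner_auts G \<noteq> {}"
      using H by (auto simp: inner_auts_def)
  next
    fix a assume "a \<in> inner_auts G"
    then obtain g where g: "a = conj_by G g" "g \<in> carrier G" by (auto simp: inner_auts_def)
    have "conj_by G (inv g) \<otimes>\<^bsub>?A\<^esub> conj_by G g = \<one>\<^bsub>?A\<^esub>"
      using g by (simp only: m inH conj_by_mult inv_closed l_inv one)
    then have "inv\<^bsub>?A\<^esub> a = conj_by G (inv g)"
      using g inH by (intro A.inv_equality) auto
    then show "inv\<^bsub>?A\<^esub> a \<in> inner_auts G" using g by (auto simp: inner_auts_def)
  next
    fix a b assume "a \<in> inner_auts G" "b \<in> inner_auts G"
    then obtain g h where gh: "a = conj_by G g" "g \<in> carrier G" "b = conj_by G h" "h \<in> carrier G"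
      by (auto simp: inner_auts_def)
    then have "a \<otimes>\<^bsub>?A\<^esub> b = conj_by G (g \<otimes> h)" by (simp only: m inH conj_by_mult)
    then show "a \<otimes>\<^bsub>?A\<^esub> b \<in> inner_auts G" using gh by (auto simp: inner_auts_def)
  qed
  show ?thesis
  proof (rule A.normal_invI[OF sub])
    fix f a assume f: "f \<in> carrier ?A" and "a \<in> inner_auts G"
    then obtain g where g: "a = conj_by G g" "g \<in> carrier G" by (auto simp: inner_auts_def)
    have fH: "f \<in> H" and fa: "f \<in> auto G" using f H by auto
    have fg: "f g \<in> carrier G" using fa g by (auto simp: auto_def hom_def)
    have "f \<otimes>\<^bsub>?A\<^esub> a = conj_by G (f g) \<otimes>\<^bsub>?A\<^esub> f"
      using fH g by (simp only: m[OF fH inH[OF g(2)]] m[OF inH[OF fg] fH] conj_by_conj[OF g(2) fa])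
    then have "f \<otimes>\<^bsub>?A\<^esub> a \<otimes>\<^bsub>?A\<^esub> inv\<^bsub>?A\<^esub> f = conj_by G (f g)"
      using f inH[OF fg] A.inv_solve_right'[of "conj_by G (f g)" "f \<otimes>\<^bsub>?A\<^esub> a" f]
        A.m_closed[of "conj_by G (f g)" f] by auto
    then show "f \<otimes>\<^bsub>?A\<^esub> a \<otimes>\<^bsub>?A\<^esub> inv\<^bsub>?A\<^esub> f \<in> inner_auts G"
      using fg by (auto simp: inner_auts_def)
  qed
qed

lemma normal_inner_AutoGroup: "inner_auts G \<lhd> AutoGroup G"
  unfolding AutoGroup_def
  by (rule normal_inner_auts[OF subgroup_auto]) (auto simp: inner_auts_def conj_by_auto)

lemma group_Out: "group (Out G)"
  unfolding Out_def by (rule normal.factorgroup_is_group[OF normal_inner_AutoGroup])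

lemma subgroup_cont_auto:
  assumes T: "compact_space T" "Hausdorff_space T" "topspace T = carrier G"
  shows "subgroup {\<phi> \<in> auto G. continuous_map T T \<phi>} (BijGroup (carrier G))"
proof -
  let ?B = "BijGroup (carrier G)"
  interpret B: group ?B by (rule group_BijGroup)
  interpret A: subgroup "auto G" ?B by (rule subgroup_auto)
  have aut: "auto G \<subseteq> Bij (carrier G)" by (auto simp: auto_def)
  show ?thesis
  proof (rule B.subgroupI)
    show "{\<phi> \<in> auto G. continuous_map T T \<phi>} \<subseteq> carrier ?B" using A.subset by auto
    have "continuous_map T T (\<lambda>x\<in>carrier G. x)"
      using T by (intro continuous_map_eq[OF continuous_map_id]) auto
    then show "{\<phi> \<in> auto G. continuous_map T T \<phi>} \<noteq> {}"
      using id_in_auto by blast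
  next
    fix f assume f: "f \<in> {\<phi> \<in> auto G. continuous_map T T \<phi>}"
    then have b: "bij_betw f (carrier G) (carrier G)" and fB: "f \<in> Bij (carrier G)"
      by (auto simp: auto_def Bij_def)
    have "homeomorphic_map T T f"
      by (rule continuous_imp_homeomorphic_map) (use f T b in \<open>auto simp: bij_betw_def\<close>)
    then obtain g where "homeomorphic_maps T T f g"
      by (auto simp: homeomorphic_map_maps)
    then have g: "continuous_map T T g" "\<And>x. x \<in> carrier G \<Longrightarrow> f (g x) = x"
      using T by (auto simp: homeomorphic_maps_def)
    have "inv_into (carrier G) f x = g x" if "x \<in> carrier G" for x
      using that g b T
      by (intro inv_into_f_eq) (auto simp: bij_betw_def dest: continuous_map_funspace)
    then have "continuous_map T T (inv\<^bsub>?B\<^esub> f)"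
      using T fB by (intro continuous_map_eq[OF g(1)]) (simp add: inv_BijGroup)
    then show "inv\<^bsub>?B\<^esub> f \<in> {\<phi> \<in> auto G. continuous_map T T \<phi>}"
      using f A.m_inv_closed by auto
  next
    fix f h assume fh: "f \<in> {\<phi> \<in> auto G. continuous_map T T \<phi>}" "h \<in> {\<phi> \<in> auto G. continuous_map T T \<phi>}"
    then have "f \<otimes>\<^bsub>?B\<^esub> h = compose (carrier G) f h" using aut by (auto simp: BijGroup_def)
    moreover have "continuous_map T T (compose (carrier G) f h)"
    proof (rule continuous_map_eq)
      show "continuous_map T T (f \<circ> h)"
        using fh by (auto intro: continuous_map_compose)
    qed (use T in \<open>auto simp: compose_def\<close>)
    ultimately show "f \<otimes>\<^bsub>?B\<^esub> h \<in> {\<phi> \<in> auto G. continuous_map T T \<phi>}"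
      using fh A.m_closed[of f h] by auto
  qed
qed

lemma normal_inner_ContAutoGroup:
  assumes "compact_space T" "Hausdorff_space T" "topspace T = carrier G"
    and "\<And>g. g \<in> carrier G \<Longrightarrow> continuous_map T T (conj_by G g)"
  shows "inner_auts G \<lhd> ContAutoGroup G T"
  unfolding ContAutoGroup_def
  by (rule normal_inner_auts[OF subgroup_cont_auto])
    (use assms in \<open>auto simp: inner_auts_def conj_by_auto\<close>)


lemma p_power_normalD:
  assumes "K \<in> p_power_normal p G"
  shows "K \<lhd> G"
  using assms by (simp add: p_power_normal_def)

lemma carrier_pro_p_completion:
  "carrier (pro_p_completion p G) =
    {f \<in> (\<Pi>\<^sub>E K\<in>p_power_normal p G. carrier (G Mod K)).
      \<forall>K\<in>p_power_normal p G. \<forall>L\<in>p_power_normal p G. K \<subseteq> L \<longrightarrow> f K \<subseteq> f L}"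
  by (simp add: pro_p_completion_def Let_def)

lemma pro_p_completionD:
  assumes "f \<in> carrier (pro_p_completion p G)"
  shows "f \<in> extensional (p_power_normal p G)"
    and "K \<in> p_power_normal p G \<Longrightarrow> f K \<in> carrier (G Mod K)"
  using assms by (simp_all add: carrier_pro_p_completion PiE_iff)

lemma mult_pro_p_completion:
  "f \<otimes>\<^bsub>pro_p_completion p G\<^esub> g = (\<lambda>K\<in>p_power_normal p G. f K <#> g K)"
  by (simp add: pro_p_completion_def Let_def)

lemma subgroup_pro_p_completion:
  "subgroup (carrier (pro_p_completion p G))
    (product_group (p_power_normal p G) (\<lambda>K. G Mod K))"
proof -
  let ?I = "p_power_normal p G"
  let ?P = "product_group ?I (\<lambda>K. G Mod K)"
  have gr: "group (G Mod K)" if "K \<in> ?I" for K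
    using p_power_normalD[OF that] by (rule normal.factorgroup_is_group)
  interpret P: group ?P using gr by simp
  show ?thesis
  proof (rule P.subgroupI)
    show "carrier (pro_p_completion p G) \<subseteq> carrier ?P"
      by (auto simp: carrier_pro_p_completion)
    have "\<one>\<^bsub>?P\<^esub> \<in> carrier (pro_p_completion p G)"
      using P.one_closed by (auto simp: carrier_pro_p_completion)
    then show "carrier (pro_p_completion p G) \<noteq> {}" by blast
  next
    fix f assume f: "f \<in> carrier (pro_p_completion p G)"
    then have fP: "f \<in> carrier ?P" by (auto simp: carrier_pro_p_completion)
    then have inv: "inv\<^bsub>?P\<^esub> f = (\<lambda>K\<in>?I. inv\<^bsub>G Mod K\<^esub> f K)"
      using gr by simp
    have "inv\<^bsub>G Mod K\<^esub> f K = set_inv f K" if "K \<in> ?I" for K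
      using p_power_normalD[OF that] fP that by (intro normal.inv_FactGroup) (auto simp: PiE_iff)
    then have "inv\<^bsub>?P\<^esub> f = (\<lambda>K\<in>?I. set_inv f K)" unfolding inv by (intro restrict_ext) simp
    moreover have "inv\<^bsub>?P\<^esub> f \<in> carrier ?P" using fP by (rule P.inv_closed)
    moreover have "set_inv f K \<subseteq> set_inv f L" if "K \<in> ?I" "L \<in> ?I" "K \<subseteq> L" for K L
    proof -
      have "f K \<subseteq> f L" using f that by (simp add: carrier_pro_p_completion)
      then show ?thesis by (auto simp: SET_INV_def)
    qed
    ultimately show "inv\<^bsub>?P\<^esub> f \<in> carrier (pro_p_completion p G)"
      by (simp add: carrier_pro_p_completion)
  next
    fix f g assume fg: "f \<in> carrier (pro_p_completion p G)" "g \<in> carrier (pro_p_completion p G)"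
    then have "f \<otimes>\<^bsub>?P\<^esub> g \<in> carrier ?P"
      by (intro P.m_closed) (auto simp: carrier_pro_p_completion)
    moreover have "f K <#> g K \<subseteq> f L <#> g L" if "K \<in> ?I" "L \<in> ?I" "K \<subseteq> L" for K L
    proof -
      have "f K \<subseteq> f L" "g K \<subseteq> g L" using fg that by (simp_all add: carrier_pro_p_completion)
      then show ?thesis by (auto simp: set_mult_def)
    qed
    ultimately show "f \<otimes>\<^bsub>?P\<^esub> g \<in> carrier (pro_p_completion p G)"
      by (simp add: carrier_pro_p_completion)
  qed
qed

lemma group_pro_p_completion: "group (pro_p_completion p G)"
proof -
  have "group (product_group (p_power_normal p G) (\<lambda>K. G Mod K))"
    using normal.factorgroup_is_group[OF p_power_normalD] by simp
  from group.subgroup_imp_group[OF this subgroup_pro_p_completion]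
  show ?thesis by (simp add: pro_p_completion_def Let_def)
qed

lemma to_completion_hom: "to_completion p G \<in> hom G (pro_p_completion p G)"
proof (rule homI)
  fix x assume "x \<in> carrier G"
  then show "to_completion p G x \<in> carrier (pro_p_completion p G)"
    by (auto simp: carrier_pro_p_completion to_completion_def carrier_FactGroup r_coset_def)
next
  fix x y assume "x \<in> carrier G" "y \<in> carrier G"
  then show "to_completion p G (x \<otimes> y) =
      to_completion p G x \<otimes>\<^bsub>pro_p_completion p G\<^esub> to_completion p G y"
    unfolding mult_pro_p_completion to_completion_def
    by (intro restrict_ext) (simp add: normal.rcos_sum[OF p_power_normalD])
qed

lemma topspace_pro_p_topology [simp]:
  "topspace (pro_p_topology p G) = carrier (pro_p_completion p G)"
proof -
  have "carrier (pro_p_completion p G) \<subseteq> (\<Pi>\<^sub>E K\<in>p_power_normal p G. carrier (G Mod K))"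
    unfolding carrier_pro_p_completion by blast
  then show ?thesis by (simp add: pro_p_topology_def Int_absorb1)
qed

lemma Hausdorff_pro_p_topology: "Hausdorff_space (pro_p_topology p G)"
  unfolding pro_p_topology_def
  by (intro Hausdorff_space_subtopology)
    (simp add: Hausdorff_space_product_topology Hausdorff_space_discrete_topology)

lemma continuous_map_component:
  assumes "K \<in> p_power_normal p G" "h \<in> carrier (G Mod K) \<rightarrow> topspace Y"
  shows "continuous_map (pro_p_topology p G) Y (\<lambda>f. h (f K))"
proof -
  let ?T = "product_topology (\<lambda>K. discrete_topology (carrier (G Mod K))) (p_power_normal p G)"
  have "continuous_map ?T (discrete_topology (carrier (G Mod K))) (\<lambda>f. f K)"
    using assms(1) by (rule continuous_map_product_projection)
  moreover have "continuous_map (discrete_topology (carrier (G Mod K))) Y h"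
    using assms(2) by simp
  ultimately have "continuous_map ?T Y (h \<circ> (\<lambda>f. f K))" by (rule continuous_map_compose)
  then show ?thesis
    unfolding pro_p_topology_def by (auto simp: o_def intro: continuous_map_from_subtopology)
qed

lemma compact_pro_p_topology:
  assumes "p > 0"
  shows "compact_space (pro_p_topology p G)"
proof -
  let ?I = "p_power_normal p G"
  let ?T = "product_topology (\<lambda>K. discrete_topology (carrier (G Mod K))) ?I"
  have fin: "finite (carrier (G Mod K))" if K: "K \<in> ?I" for K
  proof -
    from K obtain k where "card (rcosets K) = p ^ k" by (auto simp: p_power_normal_def)
    then show ?thesis using assms by (intro card_ge_0_finite) (simp add: FactGroup_def)
  qed
  have "compact_space ?T"
    using fin by (simp add: compact_space_product_topology compact_space_discrete_topology)
  moreover have "closedin ?T (carrier (pro_p_completion p G))"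
  proof (cases "?I = {}")
    case True
    have "carrier (pro_p_completion p G) = topspace ?T"
      using True by (simp add: carrier_pro_p_completion)
    then show ?thesis by (metis closedin_topspace)
  next
    case False
    have cl: "closedin ?T {f \<in> topspace ?T. f M = A}"
      if "M \<in> ?I" "A \<in> carrier (G Mod M)" for M A
    proof -
      have "closedin ?T {f \<in> topspace ?T. f M \<in> {A}}"
        by (rule closedin_continuous_map_preimage[OF continuous_map_product_projection])
          (use that in auto)
      then show ?thesis by simp
    qed
    have "closedin ?T {f \<in> topspace ?T. K \<subseteq> L \<longrightarrow> f K \<subseteq> f L}" if KL: "K \<in> ?I" "L \<in> ?I" for K L
    proof -
      define S where "S = (\<lambda>A. \<Union>B\<in>{B \<in> carrier (G Mod L). K \<subseteq> L \<longrightarrow> A \<subseteq> B}.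
        {f \<in> topspace ?T. f K = A} \<inter> {f \<in> topspace ?T. f L = B})"
      have "closedin ?T (S A)" if "A \<in> carrier (G Mod K)" for A
        unfolding S_def using fin[OF KL(2)] cl[OF KL(1) that] cl[OF KL(2)]
        by (intro closedin_Union) (auto simp del: topspace_product_topology)
      then have "closedin ?T (\<Union>A\<in>carrier (G Mod K). S A)"
        using fin[OF KL(1)] by (intro closedin_Union) auto
      moreover have "(\<Union>A\<in>carrier (G Mod K). S A) = {f \<in> topspace ?T. K \<subseteq> L \<longrightarrow> f K \<subseteq> f L}"
        using KL by (auto simp: S_def PiE_iff)
      ultimately show ?thesis by simp
    qed
    then have "closedin ?T (\<Inter>K\<in>?I. \<Inter>L\<in>?I. {f \<in> topspace ?T. K \<subseteq> L \<longrightarrow> f K \<subseteq> f L})"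
      using False by (intro closedin_INT) auto
    moreover have "carrier (pro_p_completion p G) =
        (\<Inter>K\<in>?I. \<Inter>L\<in>?I. {f \<in> topspace ?T. K \<subseteq> L \<longrightarrow> f K \<subseteq> f L})"
    proof -
      have "(\<Inter>K\<in>?I. \<Inter>L\<in>?I. {f \<in> X. Q f K L}) = {f \<in> X. \<forall>K\<in>?I. \<forall>L\<in>?I. Q f K L}"
        for X :: "('a set \<Rightarrow> 'a set) set" and Q
        using False by auto
      then show ?thesis by (simp add: carrier_pro_p_completion)
    qed
    ultimately show ?thesis by simp
  qed
  ultimately show ?thesis
    unfolding pro_p_topology_def by (simp add: closedin_compact_space compact_space_subtopology)
qed

lemma continuous_map_pro_p:
  assumes "F \<in> carrier (pro_p_completion p G) \<rightarrow> carrier (pro_p_completion p G)"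
    and "\<And>K. K \<in> p_power_normal p G \<Longrightarrow> \<exists>L\<in>p_power_normal p G. \<exists>h.
      \<forall>f\<in>carrier (pro_p_completion p G). F f K = h (f L)"
  shows "continuous_map (pro_p_topology p G) (pro_p_topology p G) F"
proof -
  let ?I = "p_power_normal p G" and ?C = "carrier (pro_p_completion p G)"
  let ?T = "product_topology (\<lambda>K. discrete_topology (carrier (G Mod K))) ?I"
  have C: "f \<in> ?C \<Longrightarrow> f \<in> extensional ?I" "f \<in> ?C \<Longrightarrow> K \<in> ?I \<Longrightarrow> f K \<in> carrier (G Mod K)" for f K
    using pro_p_completionD by blast+
  have "continuous_map (pro_p_topology p G) (discrete_topology (carrier (G Mod K))) (\<lambda>f. F f K)"
    if K: "K \<in> ?I" for K
  proof -
    obtain L h where L: "L \<in> ?I" and h: "\<And>f. f \<in> ?C \<Longrightarrow> F f K = h (f L)"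
      using assms(2)[OF K] by blast
    define h' where "h' = (\<lambda>A. if h A \<in> carrier (G Mod K) then h A else K)"
    have "K \<in> carrier (G Mod K)"
      using group.is_monoid[OF normal.factorgroup_is_group[OF p_power_normalD[OF K]]]
      by (metis monoid.one_closed one_FactGroup)
    then have "continuous_map (pro_p_topology p G) (discrete_topology (carrier (G Mod K)))
        (\<lambda>f. h' (f L))"
      using L by (intro continuous_map_component) (auto simp: h'_def)
    moreover have "h' (f L) = F f K" if "f \<in> ?C" for f
      using C(2)[OF _ K, of "F f"] assms(1) that h[OF that] by (auto simp: h'_def)
    ultimately show ?thesis by (rule continuous_map_eq) simp
  qed
  then have "continuous_map (pro_p_topology p G) ?T F"
    using assms(1) C(1) by (auto simp: continuous_map_componentwise)
  then show ?thesis
    using assms(1) by (subst (2) pro_p_topology_def) (auto simp: continuous_map_in_subtopology)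
qed

lemma normal_inner_pro_p:
  assumes "p > 0"
  shows "inner_auts (pro_p_completion p G) \<lhd>
    ContAutoGroup (pro_p_completion p G) (pro_p_topology p G)"
proof -
  let ?N = "pro_p_completion p G"
  interpret N: group ?N by (rule group_pro_p_completion)
  have "continuous_map (pro_p_topology p G) (pro_p_topology p G) (conj_by ?N g)"
    if g: "g \<in> carrier ?N" for g
  proof (rule continuous_map_pro_p)
    show "conj_by ?N g \<in> carrier ?N \<rightarrow> carrier ?N"
      using g by (auto simp: conj_by_def)
  next
    fix K assume K: "K \<in> p_power_normal p G"
    then have "\<forall>f\<in>carrier ?N. conj_by ?N g f K = g K <#> f K <#> (inv\<^bsub>?N\<^esub> g) K"
      by (simp add: conj_by_def mult_pro_p_completion)
    then show "\<exists>L\<in>p_power_normal p G. \<exists>h. \<forall>f\<in>carrier ?N. conj_by ?N g f K = h (f L)"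
      using K by (intro bexI[of _ K] exI[of _ "\<lambda>A. g K <#> A <#> (inv\<^bsub>?N\<^esub> g) K"]) auto
  qed
  then show ?thesis
    using compact_pro_p_topology[OF assms] Hausdorff_pro_p_topology
    by (intro N.normal_inner_ContAutoGroup) auto
qed

lemma group_ContOut_pro_p:
  "p > 0 \<Longrightarrow> group (ContOut (pro_p_completion p G) (pro_p_topology p G))"
  unfolding ContOut_def by (rule normal.factorgroup_is_group[OF normal_inner_pro_p])


lemma image_rcos_vimage:
  assumes \<phi>: "\<phi> \<in> auto G" and K: "K \<subseteq> carrier G" and x: "x \<in> carrier G"
  shows "\<phi> ` ((\<phi> -` K \<inter> carrier G) #> x) = K #> \<phi> x"
proof -
  let ?L = "\<phi> -` K \<inter> carrier G"
  interpret h: group_hom G G \<phi> by unfold_locales (use \<phi> in \<open>auto simp: auto_def\<close>)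
  have "\<phi> ` carrier G = carrier G"
    using \<phi> by (auto simp: auto_def Bij_def bij_betw_def)
  moreover have "\<phi> ` ?L = K \<inter> \<phi> ` carrier G" by auto
  ultimately have "\<phi> ` ?L = K" using K by (simp add: Int_absorb2)
  then have "K #> \<phi> x = \<phi> ` ?L #> \<phi> x" by simp
  also have "\<dots> = (\<Union>k\<in>?L. {\<phi> k \<otimes> \<phi> x})" by (auto simp: r_coset_def)
  also have "\<dots> = (\<Union>k\<in>?L. {\<phi> (k \<otimes> x)})" using x by simp
  also have "\<dots> = \<phi> ` (?L #> x)" by (auto simp: r_coset_def)
  finally show ?thesis by simp
qed

lemma vimage_p_power_normal:
  assumes \<phi>: "\<phi> \<in> auto G" and K: "K \<in> p_power_normal p G"
  shows "\<phi> -` K \<inter> carrier G \<in> p_power_normal p G"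
    and "A \<in> carrier (G Mod (\<phi> -` K \<inter> carrier G)) \<Longrightarrow> \<phi> ` A \<in> carrier (G Mod K)"
proof -
  let ?L = "\<phi> -` K \<inter> carrier G"
  interpret h: group_hom G G \<phi> by unfold_locales (use \<phi> in \<open>auto simp: auto_def\<close>)
  interpret K: normal K G by (rule p_power_normalD[OF K])
  have inj: "inj_on \<phi> (carrier G)" and surj: "\<phi> ` carrier G = carrier G"
    using \<phi> by (auto simp: auto_def Bij_def bij_betw_def)
  have sub: "subgroup ?L G"
  proof (rule subgroupI)
    have "\<one> \<in> ?L" by simp
    then show "?L \<noteq> {}" by blast
  qed auto
  have "?L \<lhd> G"
    by (rule normal_invI[OF sub]) (use K.inv_op_closed2 in auto)
  have "(`) \<phi> ` (rcosets ?L) = (\<lambda>x. \<phi> ` (?L #> x)) ` carrier G"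
    by (auto simp: RCOSETS_def)
  also have "\<dots> = (\<lambda>y. K #> y) ` \<phi> ` carrier G"
    using image_rcos_vimage[OF \<phi> K.subset] by (simp add: image_image)
  also have "\<dots> = rcosets K" unfolding surj by (auto simp: RCOSETS_def)
  finally have im: "(`) \<phi> ` (rcosets ?L) = rcosets K" .
  then show "A \<in> carrier (G Mod ?L) \<Longrightarrow> \<phi> ` A \<in> carrier (G Mod K)"
    by (auto simp: FactGroup_def)
  have "rcosets ?L \<subseteq> Pow (carrier G)" using subgroup.rcosets_carrier[OF sub is_group] by blast
  then have "inj_on ((`) \<phi>) (rcosets ?L)"
    using inj_on_image_Pow[OF inj] inj_on_subset by blast
  then have "card (rcosets ?L) = card (rcosets K)" using im card_image by metis
  then show "?L \<in> p_power_normal p G"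
    using K \<open>?L \<lhd> G\<close> by (simp add: p_power_normal_def)
qed

lemma completion_aut_apply:
  "f \<in> carrier (pro_p_completion p G) \<Longrightarrow> K \<in> p_power_normal p G \<Longrightarrow>
    completion_aut p G \<phi> f K = \<phi> ` f (\<phi> -` K \<inter> carrier G)"
  by (simp add: completion_aut_def)

lemma completion_aut_closed:
  assumes \<phi>: "\<phi> \<in> auto G" and f: "f \<in> carrier (pro_p_completion p G)"
  shows "completion_aut p G \<phi> f \<in> carrier (pro_p_completion p G)"
proof -
  have "\<phi> ` f (\<phi> -` K \<inter> carrier G) \<subseteq> \<phi> ` f (\<phi> -` L \<inter> carrier G)"
    if "K \<in> p_power_normal p G" "L \<in> p_power_normal p G" "K \<subseteq> L" for K L
  proof -
    have "\<phi> -` K \<inter> carrier G \<subseteq> \<phi> -` L \<inter> carrier G" using that by blast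
    then show ?thesis
      using f that vimage_p_power_normal(1)[OF \<phi>]
      by (intro image_mono) (simp add: carrier_pro_p_completion)
  qed
  moreover have "\<phi> ` f (\<phi> -` K \<inter> carrier G) \<in> carrier (G Mod K)"
    if "K \<in> p_power_normal p G" for K
    using f vimage_p_power_normal[OF \<phi> that] by (simp add: carrier_pro_p_completion PiE_iff)
  ultimately show ?thesis
    using f unfolding completion_aut_def by (simp add: carrier_pro_p_completion)
qed

lemma pro_p_subset_carrier:
  assumes "f \<in> carrier (pro_p_completion p G)" "K \<in> p_power_normal p G"
  shows "f K \<subseteq> carrier G"
proof -
  interpret K: normal K G by (rule p_power_normalD[OF assms(2)])
  show ?thesis
    using pro_p_completionD(2)[OF assms] K.rcosets_carrier[OF is_group, of "f K"]
    by (simp add: FactGroup_def)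
qed

lemma completion_aut_compose:
  assumes "\<phi> \<in> auto G" "\<psi> \<in> auto G"
  shows "completion_aut p G (compose (carrier G) \<psi> \<phi>) =
    compose (carrier (pro_p_completion p G)) (completion_aut p G \<psi>) (completion_aut p G \<phi>)"
proof (rule ext)
  fix f
  show "completion_aut p G (compose (carrier G) \<psi> \<phi>) f =
    compose (carrier (pro_p_completion p G)) (completion_aut p G \<psi>) (completion_aut p G \<phi>) f"
  proof (cases "f \<in> carrier (pro_p_completion p G)")
    case f: True
    have \<phi>: "\<phi> x \<in> carrier G" if "x \<in> carrier G" for x
      using that assms(1) by (auto simp: auto_def hom_def)
    have "completion_aut p G (compose (carrier G) \<psi> \<phi>) f K =
        completion_aut p G \<psi> (completion_aut p G \<phi> f) K" if K: "K \<in> p_power_normal p G" for K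
    proof -
      let ?L = "\<psi> -` K \<inter> carrier G"
      have L: "?L \<in> p_power_normal p G" and M: "\<phi> -` ?L \<inter> carrier G \<in> p_power_normal p G"
        using vimage_p_power_normal(1) assms K by blast+
      have eq: "compose (carrier G) \<psi> \<phi> -` K \<inter> carrier G = \<phi> -` ?L \<inter> carrier G"
        using \<phi> by (auto simp: compose_def)
      have "completion_aut p G \<psi> (completion_aut p G \<phi> f) K = \<psi> ` \<phi> ` f (\<phi> -` ?L \<inter> carrier G)"
        using f K L completion_aut_closed[OF assms(1) f] by (simp add: completion_aut_apply)
      also have "\<dots> = compose (carrier G) \<psi> \<phi> ` f (\<phi> -` ?L \<inter> carrier G)"
        unfolding image_image using pro_p_subset_carrier[OF f M]
        by (intro image_cong) (auto simp: compose_def)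
      finally show ?thesis using f K by (simp add: completion_aut_apply eq)
    qed
    moreover have "completion_aut p G \<theta> h \<in> extensional (p_power_normal p G)"
      if "h \<in> carrier (pro_p_completion p G)" for \<theta> h
      using that by (simp add: completion_aut_def)
    ultimately show ?thesis
      using f completion_aut_closed[OF assms(1) f]
      by (intro extensionalityI[of _ "p_power_normal p G"]) (simp_all add: compose_eq)
  qed (simp add: completion_aut_def compose_def)
qed

lemma completion_aut_id:
  "completion_aut p G (\<lambda>x\<in>carrier G. x) = (\<lambda>f\<in>carrier (pro_p_completion p G). f)"
  unfolding completion_aut_def
proof (rule restrict_ext)
  fix f assume f: "f \<in> carrier (pro_p_completion p G)"
  have "restrict (\<lambda>x. x) (carrier G) ` f (restrict (\<lambda>x. x) (carrier G) -` K \<inter> carrier G) = f K"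
    if K: "K \<in> p_power_normal p G" for K
  proof -
    interpret K: normal K G by (rule p_power_normalD[OF K])
    have "restrict (\<lambda>x. x) (carrier G) -` K \<inter> carrier G = K" using K.subset by auto
    moreover have "restrict (\<lambda>x. x) (carrier G) ` f K = (\<lambda>x. x) ` f K"
      using pro_p_subset_carrier[OF f K] by (intro image_cong) auto
    ultimately show ?thesis by simp
  qed
  then show "(\<lambda>K\<in>p_power_normal p G.
      (\<lambda>x\<in>carrier G. x) ` f ((\<lambda>x\<in>carrier G. x) -` K \<inter> carrier G)) = f"
    using pro_p_completionD(1)[OF f] by (intro extensionalityI[of _ "p_power_normal p G"]) auto
qed

lemma completion_aut_in_ContAutoGroup:
  assumes \<phi>: "\<phi> \<in> auto G"
  shows "completion_aut p G \<phi> \<in> carrier (ContAutoGroup (pro_p_completion p G) (pro_p_topology p G))"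
proof -
  let ?N = "pro_p_completion p G" and ?F = "completion_aut p G \<phi>"
  interpret h: group_hom G G \<phi> by unfold_locales (use \<phi> in \<open>auto simp: auto_def\<close>)
  have "?F \<in> hom ?N ?N"
  proof (rule homI)
    fix f g assume fg: "f \<in> carrier ?N" "g \<in> carrier ?N"
    interpret N: group ?N by (rule group_pro_p_completion)
    have "\<phi> ` (f L <#> g L) = \<phi> ` f L <#> \<phi> ` g L" if "L \<in> p_power_normal p G" for L
    proof -
      have "\<phi> (a \<otimes> b) = \<phi> a \<otimes> \<phi> b" if "a \<in> f L" "b \<in> g L" for a b
        using that pro_p_subset_carrier[OF fg(1) \<open>L \<in> _\<close>] pro_p_subset_carrier[OF fg(2) \<open>L \<in> _\<close>]
        by (intro h.hom_mult) blast+
      then show ?thesis by (auto simp: set_mult_def image_UN)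
    qed
    then have "?F (f \<otimes>\<^bsub>?N\<^esub> g) K = (?F f \<otimes>\<^bsub>?N\<^esub> ?F g) K" if "K \<in> p_power_normal p G" for K
      using that fg N.m_closed[OF fg] vimage_p_power_normal(1)[OF \<phi> that]
      by (simp add: completion_aut_apply mult_pro_p_completion)
    then show "?F (f \<otimes>\<^bsub>?N\<^esub> g) = ?F f \<otimes>\<^bsub>?N\<^esub> ?F g"
      using N.m_closed[OF fg] by (intro extensionalityI[of _ "p_power_normal p G"])
        (auto simp: completion_aut_def mult_pro_p_completion)
  qed (rule completion_aut_closed[OF \<phi>])
  moreover have "bij_betw ?F (carrier ?N) (carrier ?N)"
  proof -
    interpret A: group "AutoGroup G" by (rule AutoGroup)
    define \<psi> where "\<psi> = inv\<^bsub>AutoGroup G\<^esub> \<phi>"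
    have \<phi>A: "\<phi> \<in> carrier (AutoGroup G)" using \<phi> by (simp add: AutoGroup_def)
    then have "\<psi> \<in> carrier (AutoGroup G)" unfolding \<psi>_def by (rule A.inv_closed)
    then have \<psi>: "\<psi> \<in> auto G" by (simp add: AutoGroup_def)
    have B: "\<phi> \<in> Bij (carrier G)" "\<psi> \<in> Bij (carrier G)" using \<phi> \<psi> by (auto simp: auto_def)
    have inv: "compose (carrier G) \<psi> \<phi> = (\<lambda>x\<in>carrier G. x)"
      "compose (carrier G) \<phi> \<psi> = (\<lambda>x\<in>carrier G. x)"
      using A.l_inv[OF \<phi>A, folded \<psi>_def] A.r_inv[OF \<phi>A, folded \<psi>_def] B
      by (simp_all add: AutoGroup_def BijGroup_def)
    have "completion_aut p G \<psi> (?F f) = f" "?F (completion_aut p G \<psi> f) = f"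
      if "f \<in> carrier ?N" for f
      using that fun_cong[OF completion_aut_compose[OF \<phi> \<psi>, of p], of f]
        fun_cong[OF completion_aut_compose[OF \<psi> \<phi>, of p], of f]
      by (simp_all add: inv completion_aut_id compose_eq)
    then show ?thesis
      using completion_aut_closed[OF \<phi>] completion_aut_closed[OF \<psi>]
      by (intro bij_betwI[of _ _ _ "completion_aut p G \<psi>"]) auto
  qed
  moreover have "?F \<in> extensional (carrier ?N)" by (simp add: completion_aut_def)
  moreover have "continuous_map (pro_p_topology p G) (pro_p_topology p G) ?F"
  proof (rule continuous_map_pro_p)
    fix K assume K: "K \<in> p_power_normal p G"
    show "\<exists>L\<in>p_power_normal p G. \<exists>h. \<forall>f\<in>carrier ?N. ?F f K = h (f L)"
      using vimage_p_power_normal(1)[OF \<phi> K] completion_aut_apply[OF _ K] by blast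
  qed (use completion_aut_closed[OF \<phi>] in auto)
  ultimately show ?thesis by (simp add: ContAutoGroup_def auto_def Bij_def)
qed

lemma completion_aut_to_completion:
  assumes \<phi>: "\<phi> \<in> auto G" and x: "x \<in> carrier G"
  shows "completion_aut p G \<phi> (to_completion p G x) = to_completion p G (\<phi> x)"
proof -
  interpret h: group_hom G G \<phi> by unfold_locales (use \<phi> in \<open>auto simp: auto_def\<close>)
  have t: "to_completion p G x \<in> carrier (pro_p_completion p G)"
    using to_completion_hom x by (auto simp: hom_def)
  have "completion_aut p G \<phi> (to_completion p G x) K = K #> \<phi> x" if K: "K \<in> p_power_normal p G" for K
  proof -
    let ?L = "\<phi> -` K \<inter> carrier G"
    interpret K: normal K G by (rule p_power_normalD[OF K])
    have "to_completion p G x ?L = ?L #> x"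
      using vimage_p_power_normal(1)[OF \<phi> K] by (simp add: to_completion_def)
    then show ?thesis
      using t K image_rcos_vimage[OF \<phi> K.subset x] by (simp add: completion_aut_apply)
  qed
  then show ?thesis
    using t by (intro extensionalityI[of _ "p_power_normal p G"])
      (auto simp: completion_aut_def to_completion_def)
qed

lemma completion_aut_conj_by:
  assumes g: "g \<in> carrier G"
  shows "completion_aut p G (conj_by G g) = conj_by (pro_p_completion p G) (to_completion p G g)"
proof -
  let ?N = "pro_p_completion p G" and ?t = "to_completion p G g"
  interpret N: group ?N by (rule group_pro_p_completion)
  interpret t: group_hom G ?N "to_completion p G"
    by unfold_locales (rule to_completion_hom)
  have c: "conj_by G g ` A = (K #> g) <#> A <#> (K #> inv g)"
    if K: "K \<in> p_power_normal p G" and A: "A \<in> carrier (G Mod K)" for A K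
  proof -
    interpret K: normal K G by (rule p_power_normalD[OF K])
    obtain x where x: "x \<in> carrier G" "A = K #> x" using A by (auto simp: carrier_FactGroup)
    have "(K #> g) <#> A <#> (K #> inv g) = K #> (g \<otimes> x \<otimes> inv g)"
      using x g by (simp add: K.rcos_sum)
    also have "\<dots> = conj_by G g ` (K #> x)"
    proof -
      have 1: "inv g \<otimes> (g \<otimes> z) = z" "g \<otimes> (inv g \<otimes> z) = z" if "z \<in> carrier G" for z
        using g that by (simp_all flip: m_assoc)
      have "conj_by G g (k \<otimes> x) = (g \<otimes> k \<otimes> inv g) \<otimes> (g \<otimes> x \<otimes> inv g)" if "k \<in> K" for k
        using that x g K.subset 1 by (auto simp: conj_by_def m_assoc subset_iff)
      moreover have "\<exists>k'\<in>K. k = g \<otimes> k' \<otimes> inv g" if "k \<in> K" for k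
        by (rule bexI[of _ "inv g \<otimes> k \<otimes> g"])
          (use that g K.subset K.inv_op_closed1[OF g] 1 in \<open>auto simp: m_assoc subset_iff\<close>)
      ultimately show ?thesis
        using K.inv_op_closed2[OF g] by (force simp: r_coset_def)
    qed
    finally show ?thesis using x by simp
  qed
  have "completion_aut p G (conj_by G g) f K = conj_by ?N ?t f K"
    if f: "f \<in> carrier ?N" and K: "K \<in> p_power_normal p G" for f K
  proof -
    interpret K: normal K G by (rule p_power_normalD[OF K])
    have "conj_by G g -` K \<inter> carrier G = K"
    proof -
      have *: "x \<in> K" if "g \<otimes> x \<otimes> inv g \<in> K" "x \<in> carrier G" for x
        using K.inv_op_closed1[OF g that(1)] that g
        by (metis inv_closed inv_solve_left inv_solve_right' m_assoc m_closed)
      have "x \<in> conj_by G g -` K \<inter> carrier G \<longleftrightarrow> x \<in> K" for x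
        using *[of x] K.inv_op_closed2[OF g, of x] K.mem_carrier[of x]
        by (cases "x \<in> carrier G") (auto simp: conj_by_def)
      then show ?thesis by blast
    qed
    moreover have "f K \<in> carrier (G Mod K)"
      using pro_p_completionD(2)[OF f K] .
    moreover have "inv\<^bsub>?N\<^esub> ?t = to_completion p G (inv g)" using g by simp
    moreover have "to_completion p G x K = K #> x" for x
      using K by (simp add: to_completion_def)
    ultimately show ?thesis
      using f K c[OF K] by (simp add: completion_aut_apply conj_by_def mult_pro_p_completion)
  qed
  moreover have "conj_by ?N ?t f \<in> extensional (p_power_normal p G)" if "f \<in> carrier ?N" for f
    using that by (simp add: conj_by_def mult_pro_p_completion)
  ultimately have "completion_aut p G (conj_by G g) f = conj_by ?N ?t f" if "f \<in> carrier ?N" for f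
    using that by (intro extensionalityI[of _ "p_power_normal p G"])
      (auto simp: completion_aut_def)
  then show ?thesis
    by (intro extensionalityI[of _ "carrier ?N"]) (auto simp: completion_aut_def conj_by_def)
qed

theorem out_completion_map_class:
  assumes p: "p > 0" and \<phi>: "\<phi> \<in> carrier (AutoGroup G)"
  shows "out_completion_map p G (inner_auts G #>\<^bsub>AutoGroup G\<^esub> \<phi>) =
    inner_auts (pro_p_completion p G)
      #>\<^bsub>ContAutoGroup (pro_p_completion p G) (pro_p_topology p G)\<^esub> completion_aut p G \<phi>"
proof -
  let ?N = "pro_p_completion p G"
  let ?C = "ContAutoGroup ?N (pro_p_topology p G)"
  interpret N: group ?N by (rule group_pro_p_completion)
  interpret I: normal "inner_auts ?N" ?C by (rule normal_inner_pro_p[OF p])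
  interpret J: normal "inner_auts G" "AutoGroup G" by (rule normal_inner_AutoGroup)
  have \<phi>': "\<phi> \<in> auto G" using \<phi> by (simp add: AutoGroup_def)
  have F: "completion_aut p G \<phi> \<in> carrier ?C" by (rule completion_aut_in_ContAutoGroup[OF \<phi>'])
  have t: "to_completion p G g \<in> carrier ?N" if "g \<in> carrier G" for g
    using to_completion_hom that by (auto simp: hom_def)
  have step: "inner_auts ?N #>\<^bsub>?C\<^esub> completion_aut p G \<psi> = inner_auts ?N #>\<^bsub>?C\<^esub> completion_aut p G \<phi>"
    if \<psi>: "\<psi> \<in> inner_auts G #>\<^bsub>AutoGroup G\<^esub> \<phi>" for \<psi>
  proof -
    obtain g where g: "g \<in> carrier G" and "\<psi> = conj_by G g \<otimes>\<^bsub>AutoGroup G\<^esub> \<phi>"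
      using \<psi> by (auto simp: r_coset_def inner_auts_def)
    then have "\<psi> = compose (carrier G) (conj_by G g) \<phi>"
      using \<phi>' conj_by_auto[OF g] by (auto simp: AutoGroup_def BijGroup_def auto_def)
    then have "completion_aut p G \<psi> =
        compose (carrier ?N) (conj_by ?N (to_completion p G g)) (completion_aut p G \<phi>)"
      using completion_aut_compose[OF \<phi>' conj_by_auto[OF g]] completion_aut_conj_by[OF g] by simp
    also have "\<dots> = conj_by ?N (to_completion p G g) \<otimes>\<^bsub>?C\<^esub> completion_aut p G \<phi>"
      using F N.conj_by_auto[OF t[OF g]] by (auto simp: ContAutoGroup_def BijGroup_def auto_def)
    finally have "completion_aut p G \<psi> \<in> inner_auts ?N #>\<^bsub>?C\<^esub> completion_aut p G \<phi>"
      using t[OF g] by (auto simp: r_coset_def inner_auts_def)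
    then show ?thesis
      using I.repr_independence F I.subgroup_axioms by metis
  qed
  have "\<phi> \<in> inner_auts G #>\<^bsub>AutoGroup G\<^esub> \<phi>"
    using J.rcos_self[OF \<phi>] J.subgroup_axioms by blast
  then show ?thesis
    unfolding out_completion_map_def by (intro SUP_eq_const step) auto
qed

theorem out_completion_map_hom:
  assumes p: "p > 0"
  shows "out_completion_map p G \<in>
    hom (Out G) (ContOut (pro_p_completion p G) (pro_p_topology p G))"
proof -
  let ?N = "pro_p_completion p G"
  let ?C = "ContAutoGroup ?N (pro_p_topology p G)"
  interpret I: normal "inner_auts ?N" ?C by (rule normal_inner_pro_p[OF p])
  interpret J: normal "inner_auts G" "AutoGroup G" by (rule normal_inner_AutoGroup)
  have C: "completion_aut p G \<phi> \<in> carrier ?C" if "\<phi> \<in> carrier (AutoGroup G)" for \<phi>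
    using that completion_aut_in_ContAutoGroup by (simp add: AutoGroup_def)
  have m: "completion_aut p G (\<phi> \<otimes>\<^bsub>AutoGroup G\<^esub> \<psi>) = completion_aut p G \<phi> \<otimes>\<^bsub>?C\<^esub> completion_aut p G \<psi>"
    if "\<phi> \<in> carrier (AutoGroup G)" "\<psi> \<in> carrier (AutoGroup G)" for \<phi> \<psi>
  proof -
    have a: "\<phi> \<in> auto G" "\<psi> \<in> auto G" using that by (auto simp: AutoGroup_def)
    then have "\<phi> \<otimes>\<^bsub>AutoGroup G\<^esub> \<psi> = compose (carrier G) \<phi> \<psi>"
      by (auto simp: AutoGroup_def BijGroup_def auto_def)
    moreover have "completion_aut p G \<phi> \<otimes>\<^bsub>?C\<^esub> completion_aut p G \<psi> =
        compose (carrier ?N) (completion_aut p G \<phi>) (completion_aut p G \<psi>)"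
      using C[OF that(1)] C[OF that(2)] by (auto simp: ContAutoGroup_def BijGroup_def auto_def)
    ultimately show ?thesis using completion_aut_compose[OF a(2) a(1)] by simp
  qed
  show ?thesis
  proof (rule homI)
    fix X assume "X \<in> carrier (Out G)"
    then obtain \<phi> where "\<phi> \<in> carrier (AutoGroup G)" "X = inner_auts G #>\<^bsub>AutoGroup G\<^esub> \<phi>"
      by (auto simp: Out_def carrier_FactGroup)
    then show "out_completion_map p G X \<in> carrier (ContOut ?N (pro_p_topology p G))"
      using C by (auto simp: out_completion_map_class[OF p] ContOut_def carrier_FactGroup)
  next
    fix X Y assume "X \<in> carrier (Out G)" "Y \<in> carrier (Out G)"
    then obtain \<phi> \<psi> where *: "\<phi> \<in> carrier (AutoGroup G)" "X = inner_auts G #>\<^bsub>AutoGroup G\<^esub> \<phi>"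
      "\<psi> \<in> carrier (AutoGroup G)" "Y = inner_auts G #>\<^bsub>AutoGroup G\<^esub> \<psi>"
      by (auto simp: Out_def carrier_FactGroup)
    then show "out_completion_map p G (X \<otimes>\<^bsub>Out G\<^esub> Y) = out_completion_map p G X
        \<otimes>\<^bsub>ContOut ?N (pro_p_topology p G)\<^esub> out_completion_map p G Y"
      using C by (simp add: Out_def ContOut_def J.rcos_sum I.rcos_sum out_completion_map_class[OF p] m)
  qed
qed

end

end

theory Submission
  imports Defs "HOL-Algebra.Sylow" "HOL-Algebra.Multiplicative_Group"
begin

text \<open>
  Let \<open>F\<close> be free on \<open>X\<^sub>1, \<dots>, X\<^sub>n\<close> with lower central series \<open>\<gamma>\<^sub>k\<close>, and \<open>N = F / \<gamma>\<^sub>c\<^sub>+\<^sub>1\<close>. If an automorphism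
  \<open>\<phi>\<close> of \<open>N\<close> becomes inner on the completion, then modulo every normal subgroup \<open>K\<close> of \<open>p\<close>-power index
  it is conjugation by some element \<open>g\<^sub>K\<close>. One has to find a single conjugating element, and it
  suffices that it works on the generators (\<open>conjugate_lower_central\<close>).

  This is done along the lower central series. Suppose that \<open>\<phi>(X\<^sub>i) = d\<^sub>i X\<^sub>i\<close> with \<open>d\<^sub>i \<in> \<gamma>\<^sub>k\<^sub>+\<^sub>1\<close>. The
  Magnus homomorphism \<open>\<mu>\<close> from \<open>F\<close> to the integral power series in noncommuting variables sends
  \<open>X\<^sub>i\<close> to \<open>1 + X\<^sub>i\<close>, and congruences between power series define the subgroups \<open>K\<close> that are used.
  Modulo a high power of \<open>p\<close>, comparison of coefficients shows that \<open>g\<^sub>K\<close> commutes with the variables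
  in the degrees below \<open>k\<close>, so that it is trivial there when \<open>n \<ge> 2\<close>, and that the leading terms
  of the \<open>d\<^sub>i\<close> are commutators of \<open>X\<^sub>i\<close> with the part of \<open>g\<^sub>K\<close> in degree \<open>k\<close>
  (\<open>conjugate_bracket\<close>). After a correction this part comes from an element of \<open>\<gamma>\<^sub>k\<close>
  (\<open>lower_central_approximation\<close>). So the family of leading terms lies in the \<open>p\<close>-adic closure of the
  lattice of all families \<open>([X\<^sub>i, h])\<^sub>i\<close> with \<open>h \<in> \<gamma>\<^sub>k\<close>. A multiple of it then lies in the lattice
  (\<open>padic_closure_multiple\<close>), and the lattice is pure: if all \<open>[X\<^sub>i, h]\<close> are divisible by \<open>m\<close>, then so
  is the leading term of \<open>h\<close> as a polynomial, and then \<open>h\<close> is an \<open>m\<close>-th power modulo \<open>\<gamma>\<^sub>k\<^sub>+\<^sub>1\<close>.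
  Conjugation by the element found in this way improves \<open>d\<^sub>i \<in> \<gamma>\<^sub>k\<^sub>+\<^sub>1\<close> to \<open>d\<^sub>i \<in> \<gamma>\<^sub>k\<^sub>+\<^sub>2\<close>
  (\<open>conjugate_step\<close>).

  The last claim about \<open>h\<close> is the main point (\<open>lower_central_divisible\<close>): \<open>\<gamma>\<^sub>k / \<gamma>\<^sub>k\<^sub>+\<^sub>1\<close> embeds as a
  pure subgroup in the homogeneous polynomials of degree \<open>k\<close>. This strengthens the theorem of Magnus
  and Witt that \<open>\<gamma>\<^sub>k\<close> consists of the elements with \<open>\<mu> g - 1\<close> of order at least \<open>k\<close>. It is proved by
  Lazard elimination. A set of generators of the graded Lie ring of the lower central series is
  replaced by an element \<open>x\<close> and the elements \<open>ad(x)\<^sup>i(y)\<close> for the other generators \<open>y\<close>. Each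
  generator carries the leading word of its polynomial. These words form a code, and if \<open>x\<close> is
  chosen such that its word \<open>v\<close> has the largest ratio, that is, \<open>vu > uv\<close> for the words \<open>u\<close> of the
  other generators, then no leading terms cancel, and \<open>v\<close> does not occur in what is left. Hence the
  elements removed in degree \<open>k\<close> form a basis of \<open>\<gamma>\<^sub>k / \<gamma>\<^sub>k\<^sub>+\<^sub>1\<close> whose polynomials are unitriangular.
\<close>

section \<open>Commutators and the lower central series\<close>

context group
begin

definition comm :: "'a \<Rightarrow> 'a \<Rightarrow> 'a"
  where "comm x y = x \<otimes> y \<otimes> inv x \<otimes> inv y"

lemma inv_m_cancel:
  "x \<in> carrier G \<Longrightarrow> y \<in> carrier G \<Longrightarrow> inv x \<otimes> (x \<otimes> y) = y"
  "x \<in> carrier G \<Longrightarrow> y \<in> carrier G \<Longrightarrow> x \<otimes> (inv x \<otimes> y) = y"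
  by (simp_all flip: m_assoc)

lemmas word_simps = m_assoc inv_mult_group inv_m_cancel

lemma comm_closed [simp]: "x \<in> carrier G \<Longrightarrow> y \<in> carrier G \<Longrightarrow> comm x y \<in> carrier G"
  by (simp add: comm_def)

lemma comm_eq_one: "x \<in> carrier G \<Longrightarrow> y \<in> carrier G \<Longrightarrow> x \<otimes> y = y \<otimes> x \<Longrightarrow> comm x y = \<one>"
  by (simp add: comm_def word_simps)

lemma inv_commutator: "x \<in> carrier G \<Longrightarrow> y \<in> carrier G \<Longrightarrow> inv (comm x y) = comm y x"
  by (simp add: comm_def word_simps)

lemma conj_eq_comm: "x \<in> carrier G \<Longrightarrow> y \<in> carrier G \<Longrightarrow> x \<otimes> y \<otimes> inv x = comm x y \<otimes> y"
  by (simp add: comm_def word_simps)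

lemma comm_mult_left:
  "\<lbrakk>x \<in> carrier G; y \<in> carrier G; z \<in> carrier G\<rbrakk> \<Longrightarrow>
    comm (x \<otimes> y) z = x \<otimes> comm y z \<otimes> inv x \<otimes> comm x z"
  by (simp add: comm_def word_simps)

lemma comm_mult_right:
  "\<lbrakk>x \<in> carrier G; y \<in> carrier G; z \<in> carrier G\<rbrakk> \<Longrightarrow>
    comm x (y \<otimes> z) = comm x y \<otimes> (y \<otimes> comm x z \<otimes> inv y)"
  by (simp add: comm_def word_simps)

lemma comm_inv_left:
  "\<lbrakk>x \<in> carrier G; z \<in> carrier G\<rbrakk> \<Longrightarrow> comm (inv x) z = inv x \<otimes> inv (comm x z) \<otimes> x"
  by (simp add: comm_def word_simps)

lemma comm_inv_right:
  "\<lbrakk>x \<in> carrier G; z \<in> carrier G\<rbrakk> \<Longrightarrow> comm x (inv z) = inv z \<otimes> inv (comm x z) \<otimes> z"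
  by (simp add: comm_def word_simps)

text \<open>The Hall--Witt identity, solved for one of its three factors. Modulo higher commutators it
  becomes the Jacobi identity, in the form that \<open>ad(x)\<close> is a derivation.\<close>

lemma Hall_Witt:
  assumes "a \<in> carrier G" "b \<in> carrier G" "x \<in> carrier G"
  defines "z \<equiv> inv b \<otimes> x \<otimes> b"
  shows "comm x (comm a b) = comm (comm b z) (z \<otimes> a \<otimes> inv z) \<otimes> comm (comm z a) (a \<otimes> b \<otimes> inv a)"
  using assms(1-3) unfolding z_def by (simp add: comm_def word_simps)

lemma commutator_subgroup_comm:
  "commutator_subgroup G H K = generate G (\<Union>x\<in>H. \<Union>y\<in>K. {comm x y})"
  by (simp add: commutator_subgroup_def comm_def)

lemma commutator_subgroup_subset:
  assumes "H \<subseteq> carrier G" "K \<subseteq> carrier G" "subgroup L G"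
    and "\<And>x y. x \<in> H \<Longrightarrow> y \<in> K \<Longrightarrow> comm x y \<in> L"
  shows "commutator_subgroup G H K \<subseteq> L"
  unfolding commutator_subgroup_comm by (rule generate_subgroup_incl) (use assms in auto)

lemma normal_lower_central: "lower_central G n \<lhd> G"
  and lower_central_Suc_subset: "lower_central G (Suc n) \<subseteq> lower_central G n"
proof -
  have "carrier G \<lhd> G"
    by (intro normal_invI subgroup_self) auto
  moreover have *: "lower_central G (Suc (Suc n)) \<lhd> G \<and>
    lower_central G (Suc (Suc n)) \<subseteq> lower_central G (Suc n)"
    if N: "lower_central G (Suc n) \<lhd> G" for n
  proof -
    interpret N: normal "lower_central G (Suc n)" G by (rule N)
    let ?L = "lower_central G (Suc (Suc n))"
    have sub: "?L \<subseteq> lower_central G (Suc n)"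
      unfolding lower_central.simps
    proof (rule commutator_subgroup_subset)
      fix x y assume "x \<in> carrier G" "y \<in> lower_central G (Suc n)"
      then have "(x \<otimes> y \<otimes> inv x) \<otimes> inv y \<in> lower_central G (Suc n)"
        by (intro N.m_closed N.m_inv_closed N.inv_op_closed2)
      then show "comm x y \<in> lower_central G (Suc n)" by (simp add: comm_def)
    qed (use N.subset N.subgroup_axioms in auto)
    have sg: "subgroup ?L G"
      unfolding lower_central.simps commutator_subgroup_comm
      by (rule generate_is_subgroup) (use N.subset in auto)
    have "?L \<lhd> G"
    proof (rule normal_invI[OF sg])
      fix h x assume h: "h \<in> ?L" and x: "x \<in> carrier G"
      have "comm x h \<in> ?L"
        unfolding lower_central.simps commutator_subgroup_comm
        by (rule generate.incl) (use sub h x in auto)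
      then show "x \<otimes> h \<otimes> inv x \<in> ?L"
        using x h sub N.subset subgroup.m_closed[OF sg] by (subst conj_eq_comm) auto
    qed
    then show ?thesis using sub by simp
  qed
  ultimately have all: "lower_central G (Suc n) \<lhd> G" for n
    by (induction n) simp_all
  then show "lower_central G n \<lhd> G" using \<open>carrier G \<lhd> G\<close> by (cases n) simp_all
  show "lower_central G (Suc n) \<subseteq> lower_central G n"
    using * all by (cases n) auto
qed

lemma lower_central_subgroup: "subgroup (lower_central G n) G"
  using normal_lower_central normal_imp_subgroup by blast

lemma lower_central_carrier: "x \<in> lower_central G n \<Longrightarrow> x \<in> carrier G"
  using subgroup.subset[OF lower_central_subgroup] by blast

lemma lower_central_antimono: "m \<le> n \<Longrightarrow> lower_central G n \<subseteq> lower_central G m"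
  by (induction rule: dec_induct) (use lower_central_Suc_subset in blast)+

lemma lower_central_conj:
  "x \<in> lower_central G n \<Longrightarrow> g \<in> carrier G \<Longrightarrow> g \<otimes> x \<otimes> inv g \<in> lower_central G n"
  "x \<in> lower_central G n \<Longrightarrow> g \<in> carrier G \<Longrightarrow> inv g \<otimes> x \<otimes> g \<in> lower_central G n"
  using normal_lower_central by (simp_all add: normal.inv_op_closed1 normal.inv_op_closed2)

lemma comm_lower_central_Suc:
  assumes "x \<in> carrier G" "y \<in> lower_central G n"
  shows "comm x y \<in> lower_central G (Suc n)" "comm y x \<in> lower_central G (Suc n)"
proof -
  show *: "comm x y \<in> lower_central G (Suc n)"
  proof (cases n)
    case (Suc m)
    then show ?thesis
      using assms by (auto simp: commutator_subgroup_comm intro!: generate.incl)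
  qed (use assms in auto)
  then have "inv (comm x y) \<in> lower_central G (Suc n)"
    by (rule subgroup.m_inv_closed[OF lower_central_subgroup])
  then show "comm y x \<in> lower_central G (Suc n)"
    using assms by (simp add: inv_commutator lower_central_carrier)
qed

lemma comm_normal_subgroup:
  assumes M: "M \<lhd> G" and B: "B \<subseteq> carrier G"
  shows "subgroup {x \<in> carrier G. \<forall>b\<in>B. comm x b \<in> M} G"
proof (rule subgroupI)
  interpret M: normal M G by fact
  have "comm \<one> b \<in> M" if "b \<in> B" for b
    using that B by (subst comm_eq_one) auto
  then show "{x \<in> carrier G. \<forall>b\<in>B. comm x b \<in> M} \<noteq> {}"
    using one_closed by blast
next
  interpret M: normal M G by fact
  fix x assume "x \<in> {x \<in> carrier G. \<forall>b\<in>B. comm x b \<in> M}"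
  then show "inv x \<in> {x \<in> carrier G. \<forall>b\<in>B. comm x b \<in> M}"
    using B by (auto simp: comm_inv_left subset_iff intro!: M.inv_op_closed1)
next
  interpret M: normal M G by fact
  fix x y assume "x \<in> {x \<in> carrier G. \<forall>b\<in>B. comm x b \<in> M}" "y \<in> {x \<in> carrier G. \<forall>b\<in>B. comm x b \<in> M}"
  then show "x \<otimes> y \<in> {x \<in> carrier G. \<forall>b\<in>B. comm x b \<in> M}"
    using B by (auto simp: comm_mult_left subset_iff intro!: M.m_closed M.inv_op_closed2)
qed auto

text \<open>For a generator \<open>comm g a\<close> of \<open>\<gamma>\<^sub>i\<^sub>+\<^sub>1\<close> the Hall--Witt identity trades \<open>comm (comm g a) b\<close> for
  commutators that are covered by the induction hypothesis for \<open>(i, j)\<close> and \<open>(i, j + 1)\<close>.\<close>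

lemma comm_lower_central:
  "x \<in> lower_central G i \<Longrightarrow> y \<in> lower_central G j \<Longrightarrow> comm x y \<in> lower_central G (i + j)"
proof (induction i arbitrary: j x y)
  case 0
  then show ?case
    using comm_lower_central_Suc[of x y j] lower_central_Suc_subset[of j] by auto
next
  case (Suc i)
  show ?case
  proof (cases i)
    case 0
    then show ?thesis using Suc.prems comm_lower_central_Suc[of x y j] by simp
  next
    case i: (Suc i')
    let ?S = "{x \<in> carrier G. \<forall>b\<in>lower_central G j. comm x b \<in> lower_central G (Suc i + j)}"
    have "lower_central G (Suc i) \<subseteq> ?S"
      unfolding i lower_central.simps
    proof (rule commutator_subgroup_subset)
      show "subgroup {x \<in> carrier G. \<forall>b\<in>lower_central G j.
          comm x b \<in> lower_central G (Suc (Suc i') + j)} G"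
        by (rule comm_normal_subgroup[OF normal_lower_central]) (auto simp: lower_central_carrier)
    next
      fix g a assume g: "g \<in> carrier G" and a: "a \<in> lower_central G (Suc i')"
      have ac: "a \<in> carrier G" using a lower_central_carrier by blast
      have "comm (comm g a) b \<in> lower_central G (Suc (i + j))" if b: "b \<in> lower_central G j" for b
      proof -
        interpret L: subgroup "lower_central G (Suc (i + j))" G by (rule lower_central_subgroup)
        define z where "z = inv a \<otimes> b \<otimes> a"
        have z: "z \<in> lower_central G j" unfolding z_def by (rule lower_central_conj[OF b ac])
        have c: "b \<in> carrier G" "z \<in> carrier G" using b z lower_central_carrier by blast+
        have "comm a z \<in> lower_central G (i + j)"
          using Suc.IH a z i by blast
        then have "comm (comm a z) (z \<otimes> g \<otimes> inv z) \<in> lower_central G (Suc (i + j))"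
          using c g by (intro comm_lower_central_Suc) auto
        moreover have "comm (g \<otimes> a \<otimes> inv g) (comm z g) \<in> lower_central G (i + Suc j)"
          by (rule Suc.IH) (use lower_central_conj a i g z comm_lower_central_Suc in auto)
        then have "inv (comm (g \<otimes> a \<otimes> inv g) (comm z g)) \<in> lower_central G (Suc (i + j))"
          by (intro L.m_inv_closed) simp
        then have "comm (comm z g) (g \<otimes> a \<otimes> inv g) \<in> lower_central G (Suc (i + j))"
          using c g ac by (simp add: inv_commutator)
        ultimately have "comm b (comm g a) \<in> lower_central G (Suc (i + j))"
          using Hall_Witt[OF g ac c(1)] by (auto simp: z_def)
        then have "inv (comm b (comm g a)) \<in> lower_central G (Suc (i + j))"
          by (rule L.m_inv_closed)
        then show ?thesis using g ac c by (simp add: inv_commutator)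
      qed
      then show "comm g a \<in> {x \<in> carrier G. \<forall>b\<in>lower_central G j.
          comm x b \<in> lower_central G (Suc (Suc i') + j)}"
        using g ac i by auto
    qed (auto simp: lower_central_carrier)
    then show ?thesis using Suc.prems by blast
  qed
qed

end

section \<open>Noncommutative power series with constant term one\<close>

text \<open>A series is its coefficient function on words. Splitting the first letter off a word gives the
  product a recursive form in which associativity is a structural induction.\<close>

primrec conv :: "(nat list \<Rightarrow> int) \<Rightarrow> (nat list \<Rightarrow> int) \<Rightarrow> nat list \<Rightarrow> int" where
  "conv f g [] = f [] * g []"
| "conv f g (a # w) = f [] * g (a # w) + conv (\<lambda>v. f (a # v)) g w"

lemma conv_eq_sum: "conv f g w = (\<Sum>i\<le>length w. f (take i w) * g (drop i w))"
proof (induction w arbitrary: f)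
  case (Cons a w)
  show ?case
    by (simp add: Cons sum.atMost_Suc_shift del: sum.atMost_Suc)
qed simp

lemma conv_add_left: "conv (\<lambda>v. f v + f' v) g w = conv f g w + conv f' g w"
  by (simp add: conv_eq_sum sum.distrib algebra_simps)

lemma conv_scale_left: "conv (\<lambda>v. k * f v) g w = k * conv f g w"
  by (simp add: conv_eq_sum sum_distrib_left algebra_simps)

lemma conv_assoc: "conv (conv f g) h w = conv f (conv g h) w"
proof (induction w arbitrary: f)
  case (Cons a w)
  have "conv (conv f g) h (a # w) = f [] * (g [] * h (a # w)) +
      conv (\<lambda>v. f [] * g (a # v) + conv (\<lambda>v. f (a # v)) g v) h w"
    by simp
  also have "\<dots> = conv f (conv g h) (a # w)"
    unfolding conv_add_left conv_scale_left Cons by (simp add: algebra_simps)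
  finally show ?case .
qed simp

definition series_one :: "nat list \<Rightarrow> int"
  where "series_one w = (if w = [] then 1 else 0)"

lemma conv_one_left [simp]: "conv series_one f = f"
proof
  fix w
  have "conv (\<lambda>_. 0) f v = 0" for v by (simp add: conv_eq_sum)
  then show "conv series_one f w = f w"
    by (cases w) (simp_all add: series_one_def)
qed

lemma conv_one_right [simp]: "conv f series_one = f"
proof
  show "conv f series_one w = f w" for w
    by (induction w arbitrary: f) (simp_all add: series_one_def)
qed

function series_inv :: "(nat list \<Rightarrow> int) \<Rightarrow> nat list \<Rightarrow> int" where
  "series_inv f w = (if w = [] then 1
    else - (\<Sum>i<length w. series_inv f (take i w) * f (drop i w)))"
  by auto
termination by (relation "Wellfounded.measure (\<lambda>(f, w). length w)") auto

declare series_inv.simps [simp del]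

lemma conv_series_inv: "f [] = 1 \<Longrightarrow> conv (series_inv f) f w = series_one w"
  by (subst conv_eq_sum, cases "w = []")
    (simp_all add: series_inv.simps[of f w] series_inv.simps[of f "[]"] series_one_def
      lessThan_Suc_atMost[symmetric])

definition series_group :: "(nat list \<Rightarrow> int) monoid"
  where "series_group = \<lparr>carrier = {f. f [] = 1}, mult = conv, one = series_one\<rparr>"

lemma series_group_simps [simp]:
  "f \<in> carrier series_group \<longleftrightarrow> f [] = 1"
  "f \<otimes>\<^bsub>series_group\<^esub> g = conv f g"
  "\<one>\<^bsub>series_group\<^esub> = series_one"
  by (simp_all add: series_group_def)

lemma group_series_group: "group series_group"
proof (rule groupI)
  fix f assume "f \<in> carrier series_group"
  then show "\<exists>g\<in>carrier series_group. g \<otimes>\<^bsub>series_group\<^esub> f = \<one>\<^bsub>series_group\<^esub>"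
    by (intro bexI[of _ "series_inv f"] ext) (simp_all add: conv_series_inv series_inv.simps[of f "[]"] ext)
qed (auto simp: conv_assoc series_one_def intro!: ext)

interpretation S: group series_group
  by (rule group_series_group)

text \<open>The sum is the product of \<open>f - 1\<close> and \<open>g - 1\<close>.\<close>

lemma conv_middle:
  assumes "f [] = 1" "g [] = 1" "w \<noteq> []"
  shows "conv f g w = f w + g w + (\<Sum>i\<in>{1..<length w}. f (take i w) * g (drop i w))"
proof -
  have *: "{..length w} = insert 0 (insert (length w) {1..<length w})" using assms by auto
  show ?thesis
    unfolding conv_eq_sum * using assms by (subst sum.insert; simp)+
qed

subsection \<open>Congruences\<close>

text \<open>Divisibility of the coefficients at words of length \<open>l\<close> by \<open>N l\<close> defines a two-sided
  ideal when each \<open>N l\<close> is a multiple of the later values. Truncation by degree is the case of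
  values \<open>0\<close> and \<open>1\<close>.\<close>

definition dvd_chain :: "(nat \<Rightarrow> int) \<Rightarrow> bool"
  where "dvd_chain N \<longleftrightarrow> (\<forall>i j. i \<le> j \<longrightarrow> N j dvd N i)"

definition series_cong :: "(nat \<Rightarrow> int) \<Rightarrow> (nat list \<Rightarrow> int) \<Rightarrow> (nat list \<Rightarrow> int) \<Rightarrow> bool"
  where "series_cong N f g \<longleftrightarrow> (\<forall>w. N (length w) dvd f w - g w)"

lemma series_congD: "series_cong N f g \<Longrightarrow> N (length w) dvd f w - g w"
  by (simp add: series_cong_def)

lemma series_cong_refl [simp]: "series_cong N f f"
  by (simp add: series_cong_def)

lemma series_cong_sym: "series_cong N f g \<Longrightarrow> series_cong N g f"
  by (simp add: series_cong_def dvd_diff_commute)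

lemma series_cong_conv:
  assumes N: "dvd_chain N" and f: "series_cong N f f'" and g: "series_cong N g g'"
  shows "series_cong N (conv f g) (conv f' g')"
  unfolding series_cong_def
proof
  fix w :: "nat list"
  have "conv f g w - conv f' g' w =
      (\<Sum>i\<le>length w. (f (take i w) - f' (take i w)) * g (drop i w)
        + f' (take i w) * (g (drop i w) - g' (drop i w)))"
    by (simp add: conv_eq_sum sum_subtractf[symmetric] algebra_simps)
  moreover have "N (length w) dvd f (take i w) - f' (take i w)"
    "N (length w) dvd g (drop i w) - g' (drop i w)" for i
  proof -
    have "N (length w) dvd N (length (take i w))" "N (length w) dvd N (length (drop i w))"
      using N by (auto simp: dvd_chain_def)
    then show "N (length w) dvd f (take i w) - f' (take i w)"
      "N (length w) dvd g (drop i w) - g' (drop i w)"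
      using series_congD[OF f, of "take i w"] series_congD[OF g, of "drop i w"] dvd_trans by blast+
  qed
  ultimately show "N (length w) dvd conv f g w - conv f' g' w"
    by (simp add: dvd_sum)
qed

lemma series_cong_inv:
  assumes N: "dvd_chain N" and f: "series_cong N f g" and c: "f [] = 1" "g [] = 1"
  shows "series_cong N (inv\<^bsub>series_group\<^esub> f) (inv\<^bsub>series_group\<^esub> g)"
proof -
  let ?f = "inv\<^bsub>series_group\<^esub> f" and ?g = "inv\<^bsub>series_group\<^esub> g"
  have c': "f \<in> carrier series_group" "g \<in> carrier series_group" using c by simp_all
  have "series_cong N (conv ?f (conv g ?g)) (conv ?f (conv f ?g))"
    using N f by (intro series_cong_conv) (auto intro: series_cong_sym)
  moreover have "conv ?f (conv g ?g) = ?f" "conv ?f (conv f ?g) = ?g"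
    using S.r_inv[OF c'(2)] S.r_one[OF S.inv_closed[OF c'(1)]]
      S.inv_m_cancel(1)[OF c'(1) S.inv_closed[OF c'(2)]] by simp_all
  ultimately show ?thesis by simp
qed

text \<open>The order of \<open>f - 1\<close> is at least \<open>d\<close>.\<close>

definition low :: "nat \<Rightarrow> (nat list \<Rightarrow> int) \<Rightarrow> bool"
  where "low d f \<longleftrightarrow> f [] = 1 \<and> (\<forall>w. w \<noteq> [] \<and> length w < d \<longrightarrow> f w = 0)"

lemma low_zero: "low d f \<Longrightarrow> w \<noteq> [] \<Longrightarrow> length w < d \<Longrightarrow> f w = 0"
  by (simp add: low_def)

lemma low_cong: "low d f \<longleftrightarrow> f [] = 1 \<and> series_cong (\<lambda>l. if l < d then 0 else 1) f series_one"
  unfolding low_def series_cong_def series_one_def by auto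

lemma dvd_chain_low: "dvd_chain (\<lambda>l. if l < d then 0 else 1)"
  by (simp add: dvd_chain_def)

lemma low_conv: "low d f \<Longrightarrow> low d g \<Longrightarrow> low d (conv f g)"
  using series_cong_conv[OF dvd_chain_low, of d f series_one g series_one]
  by (simp add: low_cong)

lemma low_inv: "low d f \<Longrightarrow> low d (inv\<^bsub>series_group\<^esub> f)"
proof -
  assume f: "low d f"
  have "inv\<^bsub>series_group\<^esub> f \<in> carrier series_group"
    using f by (intro S.inv_closed) (simp add: low_def)
  moreover have "inv\<^bsub>series_group\<^esub> series_one = series_one"
    using S.inv_one by simp
  ultimately show ?thesis
    using series_cong_inv[OF dvd_chain_low, of d f series_one] f
    by (simp add: low_cong series_one_def[of "[]"])
qed

lemma conv_low_eq_add:
  assumes "low d f" "g [] = 1" "w \<noteq> []" "length w \<le> d"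
  shows "conv f g w = f w + g w"
proof -
  have "f (take i w) = 0" if "i \<in> {1..<length w}" for i
    using assms that by (intro low_zero[of d]) auto
  then have "(\<Sum>i\<in>{1..<length w}. f (take i w) * g (drop i w)) = 0"
    by (intro sum.neutral) auto
  then show ?thesis
    using assms by (subst conv_middle) (auto simp: low_def)
qed

lemma conv_low_diff:
  assumes a: "low d a" "low e b" and de: "d \<ge> 1" "e \<ge> 1" and w: "w \<noteq> []" "length w \<le> d + e"
  shows "conv a b w - conv b a w = (if length w = d + e
    then a (take d w) * b (drop d w) - b (take e w) * a (drop e w) else 0)"
proof -
  have s: "(\<Sum>i\<in>{1..<length w}. f (take i w) * g (drop i w)) =
      (if length w = i + j then f (take i w) * g (drop i w) else 0)"
    if fg: "low i f" "low j g" and ij: "i \<ge> 1" "j \<ge> 1" "length w \<le> i + j" for f g i j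
  proof -
    have z: "f (take l w) * g (drop l w) = 0" if "l \<in> {1..<length w}" "\<not> (l = i \<and> length w = i + j)" for l
    proof (cases "l < i")
      case True
      then have "f (take l w) = 0" using that by (intro low_zero[OF fg(1)]) auto
      then show ?thesis by simp
    next
      case False
      then have "g (drop l w) = 0" using that ij by (intro low_zero[OF fg(2)]) auto
      then show ?thesis by simp
    qed
    show ?thesis
    proof (cases "length w = i + j")
      case True
      have "(\<Sum>l\<in>{1..<length w}. f (take l w) * g (drop l w)) =
          (\<Sum>l\<in>{i}. f (take l w) * g (drop l w))"
        using z True ij by (intro sum.mono_neutral_right) auto
      then show ?thesis using True by simp
    next
      case False
      then show ?thesis using z by (auto intro!: sum.neutral)
    qed
  qed
  have "a [] = 1" "b [] = 1" using a by (simp_all add: low_def)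
  then have "conv a b w - conv b a w = (\<Sum>i\<in>{1..<length w}. a (take i w) * b (drop i w))
      - (\<Sum>i\<in>{1..<length w}. b (take i w) * a (drop i w))"
    using w by (simp add: conv_middle)
  then show ?thesis
    unfolding s[OF a de w(2)] using s[OF a(2,1) de(2,1)] w(2) by (simp add: add.commute)
qed

lemma
  assumes a: "low d a" and b: "low e b" and de: "d \<ge> 1" "e \<ge> 1"
  shows low_comm: "low (d + e) (S.comm a b)"
    and comm_coeff: "length w = d + e \<Longrightarrow>
      S.comm a b w = a (take d w) * b (drop d w) - b (take e w) * a (drop e w)"
proof -
  have c: "a \<in> carrier series_group" "b \<in> carrier series_group" using a b by (simp_all add: low_def)
  have eq: "S.comm a b = conv (conv a b) (inv\<^bsub>series_group\<^esub> (conv b a))"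
    using c S.inv_mult_group[OF c(2,1)] S.m_assoc[of "conv a b" "inv\<^bsub>series_group\<^esub> a" "inv\<^bsub>series_group\<^esub> b"]
      S.inv_closed[OF c(1)] S.inv_closed[OF c(2)]
    by (simp add: S.comm_def)
  let ?N = "\<lambda>l. if l < d + e then 0 else 1 :: int"
  have ba: "conv b a [] = 1" "conv a b [] = 1" using c by simp_all
  have "series_cong ?N (conv a b) (conv b a)"
    unfolding series_cong_def
  proof
    fix w :: "nat list"
    show "?N (length w) dvd conv a b w - conv b a w"
      using conv_low_diff[OF a b de, of w] ba by (cases "w = []") auto
  qed
  from series_cong_conv[OF dvd_chain_low this series_cong_refl]
  have "series_cong ?N (S.comm a b) (conv (conv b a) (inv\<^bsub>series_group\<^esub> (conv b a)))"
    unfolding eq .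
  moreover have "conv (conv b a) (inv\<^bsub>series_group\<^esub> (conv b a)) = series_one"
    using S.r_inv[of "conv b a"] ba by simp
  moreover have "S.comm a b [] = 1" using S.comm_closed[OF c] by simp
  ultimately show low: "low (d + e) (S.comm a b)" by (simp add: low_cong)
  have "conv (S.comm a b) (conv b a) = conv a b"
  proof -
    have "S.comm a b \<otimes>\<^bsub>series_group\<^esub> (b \<otimes>\<^bsub>series_group\<^esub> a) = a \<otimes>\<^bsub>series_group\<^esub> b"
      unfolding S.comm_def using c by (simp only: S.word_simps S.inv_closed S.m_closed S.l_inv S.r_one)
    then show ?thesis by simp
  qed
  moreover assume w: "length w = d + e"
  moreover have "conv (S.comm a b) (conv b a) w = S.comm a b w + conv b a w"
  proof -
    have "(\<Sum>i\<in>{1..<length w}. S.comm a b (take i w) * conv b a (drop i w)) = 0"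
      using w de by (intro sum.neutral ballI mult_eq_0_iff[THEN iffD2] disjI1 low_zero[OF low]) auto
    then show ?thesis
      using w de ba low by (subst conv_middle) (auto simp: low_def)
  qed
  moreover have "w \<noteq> []" using w de by auto
  ultimately show "S.comm a b w = a (take d w) * b (drop d w) - b (take e w) * a (drop e w)"
    using conv_low_diff[OF a b de, of w] by auto
qed

definition series_gen :: "nat \<Rightarrow> nat list \<Rightarrow> int"
  where "series_gen i w = (if w = [] \<or> w = [i] then 1 else 0)"

lemma conv_gen_left: "conv (series_gen i) u (a # v) = u (a # v) + (if a = i then u v else 0)"
proof -
  have "conv (\<lambda>v. series_gen i (a # v)) u v = (if a = i then conv series_one u v else 0)"
    by (auto simp: series_gen_def series_one_def conv_eq_sum simp del: conv_one_left)
  then show ?thesis by (simp add: series_gen_def)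
qed

lemma conv_gen_right: "conv u (series_gen i) (v @ [a]) = u (v @ [a]) + (if a = i then u v else 0)"
proof -
  have "{..length (v @ [a])} = insert (length v) (insert (Suc (length v)) {..<length v})" by auto
  moreover have "(\<Sum>j<length v. u (take j (v @ [a])) * series_gen i (drop j (v @ [a]))) = 0"
    by (intro sum.neutral) (auto simp: series_gen_def append_eq_Cons_conv)
  ultimately show ?thesis
    unfolding conv_eq_sum by (simp add: series_gen_def)
qed

section \<open>Comparing words\<close>

text \<open>Words as numbers in base \<open>B\<close>, ordered at a fixed length in the same way as lexicographically.\<close>

primrec word_val :: "nat \<Rightarrow> nat list \<Rightarrow> nat" where
  "word_val B [] = 0"
| "word_val B (a # w) = a * B ^ length w + word_val B w"

lemma word_val_append: "word_val B (u @ v) = word_val B u * B ^ length v + word_val B v"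
  by (induction u) (simp_all add: algebra_simps power_add)

lemma word_val_less: "set w \<subseteq> {..<B} \<Longrightarrow> word_val B w < B ^ length w"
proof (induction w)
  case (Cons a w)
  then have "Suc a * B ^ length w \<le> B * B ^ length w" by (intro mult_right_mono) auto
  then show ?case using Cons by simp
qed simp

lemma word_val_inj:
  "\<lbrakk>set u \<subseteq> {..<B}; set v \<subseteq> {..<B}; length u = length v; word_val B u = word_val B v\<rbrakk> \<Longrightarrow> u = v"
proof (induction u arbitrary: v)
  case (Cons a u)
  obtain b v' where v: "v = b # v'" using Cons.prems(3) by (cases v) auto
  have l: "length u = length v'" using Cons.prems v by simp
  have lt: "word_val B u < B ^ length u" "word_val B v' < B ^ length u"
    using Cons.prems v word_val_less[of u B] word_val_less[of v' B] by auto
  have eq: "a * B ^ length u + word_val B u = b * B ^ length u + word_val B v'"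
    using Cons.prems v by simp
  have "B ^ length u \<noteq> 0" using lt(1) by linarith
  then have "(a * B ^ length u + word_val B u) div B ^ length u = a"
    "(b * B ^ length u + word_val B v') div B ^ length u = b"
    using lt by (intro conjI div_nat_eqI; simp add: algebra_simps)+
  then have ab: "a = b" unfolding eq by (rule trans[OF sym])
  then have "word_val B u = word_val B v'" using eq by simp
  then have "u = v'" using Cons.prems v l by (intro Cons.IH) auto
  then show ?case using v ab by simp
qed simp

text \<open>The number with the periodic base \<open>B\<close> expansion \<open>0.www\<dots>\<close>. Hence \<open>uv\<close> is larger than \<open>vu\<close>
  exactly if \<open>u\<close> has the larger ratio.\<close>

definition word_ratio :: "nat \<Rightarrow> nat list \<Rightarrow> real"
  where "word_ratio B w = word_val B w / (B ^ length w - 1)"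

context
  fixes B :: nat
  assumes B: "B \<ge> 2"
begin

lemma word_denom_pos: "w \<noteq> [] \<Longrightarrow> real B ^ length w - 1 > 0"
  using B by (simp add: one_less_power)

lemma word_val_ratio: "w \<noteq> [] \<Longrightarrow> real (word_val B w) = word_ratio B w * (real B ^ length w - 1)"
  using word_denom_pos[of w] by (simp add: word_ratio_def)

lemma word_ratio_append:
  assumes "u \<noteq> []" "v \<noteq> []"
  obtains s t where "s > 0" "t > 0" "s + t = 1"
    "word_ratio B (u @ v) = s * word_ratio B u + t * word_ratio B v"
proof -
  define a b where "a = real B ^ length u - 1" and "b = real B ^ length v - 1"
  have ab: "a > 0" "b > 0" using assms word_denom_pos by (simp_all add: a_def b_def)
  define c where "c = a * (b + 1) + b"
  have c: "c > 0" using ab by (simp add: c_def add_pos_pos)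
  have "real (word_val B (u @ v)) = word_ratio B u * (a * (b + 1)) + word_ratio B v * b"
    using assms by (simp add: word_val_append word_val_ratio a_def b_def)
  moreover have "real B ^ length (u @ v) - 1 = c"
    by (simp add: a_def b_def c_def power_add algebra_simps)
  ultimately have "word_ratio B (u @ v) =
      (a * (b + 1) / c) * word_ratio B u + (b / c) * word_ratio B v"
    using c by (simp add: word_ratio_def[of B "u @ v"] field_simps)
  moreover have "a * (b + 1) / c > 0" "b / c > 0" "a * (b + 1) / c + b / c = 1"
    using ab c by (simp_all add: c_def add_divide_distrib[symmetric])
  ultimately show thesis using that by blast
qed

lemma word_ratio_append_less:
  assumes "u \<noteq> []" "v \<noteq> []" "word_ratio B u \<le> r" "word_ratio B v < r"
  shows "word_ratio B (u @ v) < r"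
proof -
  obtain s t where st: "s > 0" "t > 0" "s + t = 1"
    "word_ratio B (u @ v) = s * word_ratio B u + t * word_ratio B v"
    using word_ratio_append[OF assms(1,2)] .
  have "s * word_ratio B u + t * word_ratio B v < s * r + t * r"
    using st assms by (intro add_le_less_mono mult_left_mono mult_strict_left_mono) auto
  also have "\<dots> = (s + t) * r" by (simp only: distrib_right)
  finally show ?thesis using st by simp
qed

lemma word_ratio_swap:
  assumes "u \<noteq> []" "v \<noteq> []"
  shows "word_val B (v @ u) < word_val B (u @ v) \<longleftrightarrow> word_ratio B v < word_ratio B u"
    and "word_val B (v @ u) = word_val B (u @ v) \<longleftrightarrow> word_ratio B v = word_ratio B u"
proof -
  define a b where "a = real B ^ length u - 1" and "b = real B ^ length v - 1"
  define c where "c = a * b"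
  have c: "c > 0" unfolding c_def a_def b_def using assms by (intro mult_pos_pos word_denom_pos)
  have eq: "real (word_val B (u @ v)) - real (word_val B (v @ u)) =
      c * (word_ratio B u - word_ratio B v)"
    using assms by (simp add: word_val_append word_val_ratio a_def b_def c_def algebra_simps)
  have "word_val B (v @ u) < word_val B (u @ v) \<longleftrightarrow>
      0 < real (word_val B (u @ v)) - real (word_val B (v @ u))" by simp
  also have "\<dots> \<longleftrightarrow> word_ratio B v < word_ratio B u"
    unfolding eq using c by (simp add: zero_less_mult_iff)
  finally show "word_val B (v @ u) < word_val B (u @ v) \<longleftrightarrow> word_ratio B v < word_ratio B u" .
  have "word_val B (v @ u) = word_val B (u @ v) \<longleftrightarrow>
      real (word_val B (u @ v)) - real (word_val B (v @ u)) = 0" by auto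
  also have "\<dots> \<longleftrightarrow> word_ratio B v = word_ratio B u"
    unfolding eq using c by auto
  finally show "word_val B (v @ u) = word_val B (u @ v) \<longleftrightarrow> word_ratio B v = word_ratio B u" .
qed

lemma word_ratio_less_iff_val:
  assumes "length u = length v"
  shows "word_ratio B u < word_ratio B v \<longleftrightarrow> word_val B u < word_val B v"
proof (cases "u = []")
  case False
  then show ?thesis
    using assms word_denom_pos[of u] by (simp add: word_ratio_def divide_less_cancel)
qed (use assms in simp)

end

section \<open>Codes\<close>

definition code :: "'a list set \<Rightarrow> bool"
  where "code C \<longleftrightarrow> inj_on concat (lists C)"

lemma code_subset: "code C \<Longrightarrow> D \<subseteq> C \<Longrightarrow> code D"
  unfolding code_def by (erule inj_on_subset) (rule lists_mono)

lemma codeD: "\<lbrakk>code C; us \<in> lists C; vs \<in> lists C; concat us = concat vs\<rbrakk> \<Longrightarrow> us = vs"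
  unfolding code_def by (rule inj_onD)

lemma code_commute: "\<lbrakk>code C; u \<in> C; v \<in> C; u @ v = v @ u\<rbrakk> \<Longrightarrow> u = v"
proof -
  assume *: "code C" "u \<in> C" "v \<in> C" and eq: "u @ v = v @ u"
  have c: "concat [u, v] = concat [v, u]" by (simp only: concat.simps append_Nil2 eq)
  have "[u, v] = [v, u]" by (rule codeD[OF *(1) _ _ c]) (simp_all only: lists.intros *)
  then show "u = v" by blast
qed

lemma replicate_snoc_eq:
  "\<lbrakk>replicate i x @ y # s = replicate j x @ z # t; y \<noteq> x; z \<noteq> x\<rbrakk> \<Longrightarrow> i = j \<and> y = z \<and> s = t"
proof (induction i arbitrary: j)
  case 0
  then show ?case by (cases j) auto
next
  case (Suc i)
  then obtain j' where "j = Suc j'" by (cases j) auto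
  then show ?case using Suc.IH[of j'] Suc.prems by simp
qed

lemma code_replicate_eq:
  assumes "code C" "x \<in> C" "y \<in> C" "z \<in> C" "y \<noteq> x" "z \<noteq> x"
    and "concat (replicate i x) @ y = concat (replicate j x) @ z"
  shows "i = j \<and> y = z"
proof -
  have "replicate i x @ [y] = replicate j x @ [z]"
    by (rule codeD[OF assms(1)]) (use assms in auto)
  from replicate_snoc_eq[OF this assms(5,6)] show ?thesis by blast
qed

text \<open>A word in the letters of \<open>C\<close> splits uniquely at the letters other than \<open>x\<close>.\<close>

lemma code_eliminate:
  assumes C: "code C" and x: "x \<in> C"
  shows "code {concat (replicate i x) @ y | i y. y \<in> C - {x}}" (is "code ?D")
proof -
  define split where "split u = (SOME z. snd z \<in> C - {x} \<and> u = concat (replicate (fst z) x) @ snd z)" for u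
  define i y where "i u = fst (split u)" and "y u = snd (split u)" for u
  have iy: "y u \<in> C - {x} \<and> u = concat (replicate (i u) x) @ y u" if "u \<in> ?D" for u
  proof -
    have "\<exists>z. snd z \<in> C - {x} \<and> u = concat (replicate (fst z) x) @ snd z"
      using that by auto
    from someI_ex[OF this] show ?thesis
      unfolding i_def y_def split_def .
  qed
  define e where "e us = concat (map (\<lambda>u. replicate (i u) x @ [y u]) us)" for us
  have e: "e us \<in> lists C \<and> concat (e us) = concat us" if "us \<in> lists ?D" for us
    using that
  proof (induction us)
    case (Cons u us)
    have "e (u # us) = replicate (i u) x @ y u # e us" by (simp add: e_def)
    moreover have "concat (replicate (i u) x) @ y u = u" "y u \<in> C"
      using iy[OF Cons.hyps(1)] by auto
    ultimately show ?case using Cons.IH x by (auto simp flip: append_assoc)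
  qed (simp add: e_def)
  have inj: "us = vs" if "us \<in> lists ?D" "vs \<in> lists ?D" "e us = e vs" for us vs
    using that
  proof (induction us arbitrary: vs)
    case Nil
    then show ?case by (cases vs) (auto simp: e_def)
  next
    case (Cons u us)
    obtain v vs' where vs: "vs = v # vs'" using Cons.prems(2) by (cases vs) (auto simp: e_def)
    have uv: "u \<in> ?D" "v \<in> ?D" "us \<in> lists ?D" "vs' \<in> lists ?D" using Cons.prems Cons.hyps vs by auto
    have "replicate (i u) x @ y u # e us = replicate (i v) x @ y v # e vs'"
      using Cons.prems by (simp add: e_def vs)
    then have "i u = i v \<and> y u = y v \<and> e us = e vs'"
      using iy[OF uv(1)] iy[OF uv(2)] by (intro replicate_snoc_eq) auto
    then show ?case using iy[OF uv(1)] iy[OF uv(2)] Cons.IH[OF uv(4)] vs by auto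
  qed
  show ?thesis
    unfolding code_def
  proof (rule inj_onI)
    fix us vs assume uv: "us \<in> lists ?D" "vs \<in> lists ?D" "concat us = concat vs"
    have "e us = e vs"
      using e[OF uv(1)] e[OF uv(2)] uv(3) by (intro codeD[OF C]) auto
    then show "us = vs" using inj uv by blast
  qed
qed

lemma code_singletons: "code ((\<lambda>i. [i]) ` A)"
  unfolding code_def
proof (rule inj_onI)
  fix us vs :: "'a list list"
  assume uv: "us \<in> lists ((\<lambda>i. [i]) ` A)" "vs \<in> lists ((\<lambda>i. [i]) ` A)" "concat us = concat vs"
  have "map (\<lambda>a. [a]) (concat us) = us" if "us \<in> lists ((\<lambda>i. [i]) ` A)" for us :: "'a list list"
    using that by (induction us) auto
  then show "us = vs" using uv by metis
qed

section \<open>The Magnus homomorphism\<close>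

definition word_supported :: "nat \<Rightarrow> (nat list \<Rightarrow> int) \<Rightarrow> bool"
  where "word_supported n f \<longleftrightarrow> (\<forall>w. f w \<noteq> 0 \<longrightarrow> set w \<subseteq> {..<n})"

lemma word_supported_conv:
  assumes "word_supported n f" "word_supported n g"
  shows "word_supported n (conv f g)"
  unfolding word_supported_def
proof (intro allI impI)
  fix w assume "conv f g w \<noteq> 0"
  then obtain i where "f (take i w) * g (drop i w) \<noteq> 0"
    unfolding conv_eq_sum by (rule sum.not_neutral_contains_not_neutral)
  then have "set (take i w) \<subseteq> {..<n}" "set (drop i w) \<subseteq> {..<n}"
    using assms unfolding word_supported_def by auto
  then have "set (take i w @ drop i w) \<subseteq> {..<n}" by (simp only: set_append Un_least)
  then show "set w \<subseteq> {..<n}" by simp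
qed

lemma word_supported_inv:
  assumes f: "word_supported n f" "f [] = 1"
  shows "word_supported n (inv\<^bsub>series_group\<^esub> f)"
proof -
  have "inv\<^bsub>series_group\<^esub> f = series_inv f"
    using f by (intro S.inv_equality) (auto simp: conv_series_inv series_inv.simps[of f "[]"])
  moreover have "series_inv f w \<noteq> 0 \<Longrightarrow> set w \<subseteq> {..<n}" for w
  proof (induction "length w" arbitrary: w rule: less_induct)
    case less
    show ?case
    proof (cases "w = []")
      case False
      then have "(\<Sum>i<length w. series_inv f (take i w) * f (drop i w)) \<noteq> 0"
        using less.prems series_inv.simps[of f w] by simp
      then obtain i where "i \<in> {..<length w}" and i: "series_inv f (take i w) * f (drop i w) \<noteq> 0"
        by (rule sum.not_neutral_contains_not_neutral)
      then have "set (take i w) \<subseteq> {..<n}" using less.hyps[of "take i w"] \<open>i \<in> _\<close> by simp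
      moreover have "set (drop i w) \<subseteq> {..<n}" using i f(1) unfolding word_supported_def by auto
      ultimately have "set (take i w @ drop i w) \<subseteq> {..<n}" by (simp only: set_append Un_least)
      then show ?thesis by simp
    qed simp
  qed
  ultimately show ?thesis by (simp add: word_supported_def)
qed

lemma (in group) subgroup_nat_pow_closed:
  "subgroup H G \<Longrightarrow> a \<in> H \<Longrightarrow> a [^] (m::nat) \<in> H"
  by (induction m) (simp_all add: subgroup.one_closed subgroup.m_closed)

lemma (in group) rcos_eq_iff:
  assumes "M \<lhd> G" "a \<in> carrier G" "b \<in> carrier G"
  shows "M #> a = M #> b \<longleftrightarrow> a \<otimes> inv b \<in> M"
proof -
  interpret M: normal M G by fact
  have "M #> a = M #> b \<longleftrightarrow> a \<in> M #> b"
    using assms(2,3) repr_independence[of a M b] rcos_self[of a M] M.subgroup_axioms by auto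
  then show ?thesis using M.rcos_module[OF is_group assms(3,2)] by simp
qed

text \<open>The homomorphism \<open>\<mu>\<close> sends the generators to \<open>1 + X\<^sub>i\<close>. That it exists expresses that \<open>G\<close> is
  free on the generators.\<close>

locale magnus = group G for G (structure) +
  fixes n :: nat and X :: "nat \<Rightarrow> 'a" and \<mu> :: "'a \<Rightarrow> nat list \<Rightarrow> int"
  assumes X_closed: "i < n \<Longrightarrow> X i \<in> carrier G"
    and gen: "generate G (X ` {..<n}) = carrier G"
    and mu_hom: "\<mu> \<in> hom G series_group"
    and mu_X: "i < n \<Longrightarrow> \<mu> (X i) = series_gen i"
begin

sublocale mu: group_hom G series_group \<mu>
  by (simp add: group_hom_def group_hom_axioms_def group_series_group is_group mu_hom)

lemma generate_induct:
  assumes "subgroup H G" "\<And>i. i < n \<Longrightarrow> X i \<in> H"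
  shows "carrier G \<subseteq> H"
  using generate_subgroup_incl[of "X ` {..<n}" H] assms gen by auto

lemma mu_Nil [simp]: "g \<in> carrier G \<Longrightarrow> \<mu> g [] = 1"
  using mu.hom_closed by simp

lemma mu_mult: "a \<in> carrier G \<Longrightarrow> b \<in> carrier G \<Longrightarrow> \<mu> (a \<otimes> b) = conv (\<mu> a) (\<mu> b)"
  using mu.hom_mult by simp

lemma mu_inv: "a \<in> carrier G \<Longrightarrow> \<mu> (inv a) = inv\<^bsub>series_group\<^esub> (\<mu> a)"
  by (rule mu.hom_inv)

lemma mu_comm: "a \<in> carrier G \<Longrightarrow> b \<in> carrier G \<Longrightarrow> \<mu> (comm a b) = S.comm (\<mu> a) (\<mu> b)"
  unfolding comm_def S.comm_def by (simp only: mu.hom_mult mu.hom_inv m_closed inv_closed)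

lemma mu_supported: "g \<in> carrier G \<Longrightarrow> word_supported n (\<mu> g)"
proof -
  have "subgroup {g \<in> carrier G. word_supported n (\<mu> g)} G"
  proof (rule subgroupI)
    have "\<mu> \<one> = series_one" using mu.hom_one by simp
    then have "\<one> \<in> {g \<in> carrier G. word_supported n (\<mu> g)}"
      by (simp add: word_supported_def series_one_def)
    then show "{g \<in> carrier G. word_supported n (\<mu> g)} \<noteq> {}" by blast
  qed (auto simp: mu_mult mu_inv word_supported_conv word_supported_inv)
  then have "carrier G \<subseteq> {g \<in> carrier G. word_supported n (\<mu> g)}"
    by (rule generate_induct) (auto simp: X_closed mu_X word_supported_def series_gen_def)
  then show "g \<in> carrier G \<Longrightarrow> word_supported n (\<mu> g)" by blast
qed

lemma mu_letters: "g \<in> carrier G \<Longrightarrow> \<mu> g w \<noteq> 0 \<Longrightarrow> set w \<subseteq> {..<n}"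
  using mu_supported[of g] by (simp add: word_supported_def)

lemma low_subgroup: "subgroup {g \<in> carrier G. low d (\<mu> g)} G"
proof (rule subgroupI)
  have "\<mu> \<one> = series_one" using mu.hom_one by simp
  then have "\<one> \<in> {g \<in> carrier G. low d (\<mu> g)}"
    by (simp add: low_def series_one_def)
  then show "{g \<in> carrier G. low d (\<mu> g)} \<noteq> {}" by blast
qed (auto simp: mu_mult mu_inv low_conv low_inv)

lemma low_lower_central: "g \<in> lower_central G d \<Longrightarrow> low d (\<mu> g)"
proof (induction d arbitrary: g rule: induct_nat_012)
  case (ge2 d)
  have "lower_central G (Suc (Suc d)) \<subseteq> {g \<in> carrier G. low (Suc (Suc d)) (\<mu> g)}"
    unfolding lower_central.simps
  proof (rule commutator_subgroup_subset[OF _ _ low_subgroup])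
    fix a b assume a: "a \<in> carrier G" and b: "b \<in> lower_central G (Suc d)"
    have "low 1 (\<mu> a)" using a by (simp add: low_def)
    then have "low (1 + Suc d) (S.comm (\<mu> a) (\<mu> b))"
      using ge2.IH(2)[OF b] by (intro low_comm) auto
    then show "comm a b \<in> {g \<in> carrier G. low (Suc (Suc d)) (\<mu> g)}"
      using a b lower_central_carrier by (auto simp: mu_comm)
  qed (auto simp: lower_central_carrier)
  then show ?case using ge2.prems by blast
qed (auto simp: low_def)

lemma mu_zero: "g \<in> lower_central G d \<Longrightarrow> w \<noteq> [] \<Longrightarrow> length w < d \<Longrightarrow> \<mu> g w = 0"
  using low_zero[OF low_lower_central] .

lemma mu_add:
  "\<lbrakk>a \<in> lower_central G d; b \<in> carrier G; w \<noteq> []; length w \<le> d\<rbrakk> \<Longrightarrow>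
    \<mu> (a \<otimes> b) w = \<mu> a w + \<mu> b w"
  using conv_low_eq_add[of d "\<mu> a" "\<mu> b" w] low_lower_central[of a d]
  by (simp add: mu_mult lower_central_carrier)

lemma mu_minus:
  assumes "a \<in> lower_central G d" "w \<noteq> []" "length w \<le> d"
  shows "\<mu> (inv a) w = - \<mu> a w"
proof -
  have "\<mu> (a \<otimes> inv a) w = \<mu> a w + \<mu> (inv a) w"
    using assms lower_central_carrier by (intro mu_add) auto
  moreover have "\<mu> (a \<otimes> inv a) = series_one"
    using assms lower_central_carrier mu.hom_one by simp
  ultimately show ?thesis using assms by (simp add: series_one_def)
qed

lemma mu_nat_pow:
  assumes "a \<in> lower_central G d" "w \<noteq> []" "length w \<le> d"
  shows "\<mu> (a [^] (m::nat)) w = int m * \<mu> a w"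
proof (induction m)
  case 0
  have "\<mu> \<one> = series_one" using mu.hom_one by simp
  then show ?case using assms by (simp add: series_one_def)
next
  case (Suc m)
  have "a [^] m \<in> lower_central G d"
    by (rule subgroup_nat_pow_closed[OF lower_central_subgroup assms(1)])
  then have "\<mu> (a [^] Suc m) w = \<mu> (a [^] m) w + \<mu> a w"
    using mu_add[of "a [^] m" d a w] assms lower_central_carrier by simp
  then show ?case using Suc by (simp add: algebra_simps)
qed

lemma mu_int_pow:
  assumes "a \<in> lower_central G d" "w \<noteq> []" "length w \<le> d"
  shows "\<mu> (a [^] (m::int)) w = m * \<mu> a w"
proof (cases "m \<ge> 0")
  case True
  then show ?thesis
    using mu_nat_pow[OF assms, of "nat m"] by (simp flip: int_pow_int)
next
  case False
  then have "m < 0" by simp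
  have "a [^] nat (- m) \<in> lower_central G d"
    by (rule subgroup_nat_pow_closed[OF lower_central_subgroup assms(1)])
  from mu_minus[OF this assms(2,3)]
  have "\<mu> (inv (a [^] nat (- m))) w = - (int (nat (- m)) * \<mu> a w)"
    unfolding mu_nat_pow[OF assms] .
  moreover have "a [^] m = inv (a [^] nat (- m))"
    by (simp only: int_pow_def2 \<open>m < 0\<close> if_True)
  moreover have "- (int (nat (- m)) * \<mu> a w) = m * \<mu> a w"
    using False by simp
  ultimately show ?thesis by (simp only:)
qed

lemma mu_comm_coeff:
  assumes "a \<in> lower_central G d" "b \<in> lower_central G e" "d \<ge> 1" "e \<ge> 1" "length w = d + e"
  shows "\<mu> (comm a b) w = \<mu> a (take d w) * \<mu> b (drop d w) - \<mu> b (take e w) * \<mu> a (drop e w)"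
  using comm_coeff[OF low_lower_central[OF assms(1)] low_lower_central[OF assms(2)] assms(3-5)]
  using assms lower_central_carrier by (simp add: mu_comm)

lemma nat_pow_commuting_mod:
  assumes y: "y \<in> lower_central G k" and z: "z \<in> lower_central G k" and k: "k \<ge> 1"
  shows "(y \<otimes> z) [^] (m::nat) \<otimes> inv (y [^] m \<otimes> z [^] m) \<in> lower_central G (Suc k)"
proof -
  let ?M = "lower_central G (Suc k)"
  have M: "?M \<lhd> G" by (rule normal_lower_central)
  interpret M: normal ?M G by (rule M)
  interpret Q: group "G Mod ?M" by (rule M.factorgroup_is_group)
  interpret h: group_hom G "G Mod ?M" "\<lambda>a. ?M #> a"
    by unfold_locales (rule M.r_coset_hom_Mod)
  have c: "y \<in> carrier G" "z \<in> carrier G" using y z lower_central_carrier by blast+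
  have "comm y z \<in> lower_central G (k + k)" by (rule comm_lower_central[OF y z])
  then have "comm y z \<in> ?M" using lower_central_antimono[of "Suc k" "k + k"] k by auto
  moreover have "comm y z = (y \<otimes> z) \<otimes> inv (z \<otimes> y)" using c by (simp add: comm_def word_simps)
  ultimately have "?M #> (y \<otimes> z) = ?M #> (z \<otimes> y)"
    using c by (intro rcos_eq_iff[OF M, THEN iffD2]) simp_all
  then have *: "(?M #> y) \<otimes>\<^bsub>G Mod ?M\<^esub> (?M #> z) = (?M #> z) \<otimes>\<^bsub>G Mod ?M\<^esub> (?M #> y)"
    by (simp only: h.hom_mult[OF c, symmetric] h.hom_mult[OF c(2,1), symmetric])
  have "?M #> (y \<otimes> z) [^] m = ((?M #> y) \<otimes>\<^bsub>G Mod ?M\<^esub> (?M #> z)) [^]\<^bsub>G Mod ?M\<^esub> m"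
    using c by (simp only: h.hom_nat_pow h.hom_mult m_closed)
  also have "\<dots> = (?M #> y) [^]\<^bsub>G Mod ?M\<^esub> m \<otimes>\<^bsub>G Mod ?M\<^esub> (?M #> z) [^]\<^bsub>G Mod ?M\<^esub> m"
    using c h.hom_closed by (intro Q.pow_mult_distrib[OF *]) auto
  also have "\<dots> = ?M #> (y [^] m \<otimes> z [^] m)"
    using c by (simp only: h.hom_nat_pow h.hom_mult nat_pow_closed)
  finally show ?thesis
    using c by (intro rcos_eq_iff[OF M, THEN iffD1]) simp_all
qed

end

section \<open>Elimination of generators\<close>

context magnus
begin

text \<open>The smallest family of subgroups \<open>S\<^sub>d\<close> with \<open>\<gamma>\<^sub>d\<^sub>+\<^sub>1 \<subseteq> S\<^sub>d\<close> that is closed under commutators and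
  contains the elements of \<open>Z\<close>, which carry words whose lengths are their degrees. It stands for
  the Lie subring generated by \<open>Z\<close> in the graded Lie ring of the lower central series.\<close>

inductive lie :: "('a \<times> nat list) set \<Rightarrow> nat \<Rightarrow> 'a \<Rightarrow> bool" for Z where
  lie_gen: "(a, u) \<in> Z \<Longrightarrow> lie Z (length u) a"
| lie_comm: "lie Z d a \<Longrightarrow> lie Z e b \<Longrightarrow> lie Z (d + e) (comm a b)"
| lie_mult: "lie Z d a \<Longrightarrow> lie Z d b \<Longrightarrow> lie Z d (a \<otimes> b)"
| lie_inv: "lie Z d a \<Longrightarrow> lie Z d (inv a)"
| lie_higher: "d \<ge> 1 \<Longrightarrow> a \<in> lower_central G (Suc d) \<Longrightarrow> lie Z d a"

definition graded :: "('a \<times> nat list) set \<Rightarrow> bool"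
  where "graded Z \<longleftrightarrow> (\<forall>(a, u)\<in>Z. u \<noteq> [] \<and> a \<in> lower_central G (length u))"

lemma lie_lower_central:
  assumes "graded Z" "lie Z d a"
  shows "d \<ge> 1" "a \<in> lower_central G d"
proof -
  have "d \<ge> 1 \<and> a \<in> lower_central G d"
    using assms(2)
  proof induction
    case (lie_gen a u)
    then show ?case using assms(1) by (cases u) (auto simp: graded_def)
  next
    case (lie_comm d a e b)
    then show ?case using comm_lower_central by auto
  next
    case (lie_mult d a b)
    then show ?case using subgroup.m_closed[OF lower_central_subgroup] by auto
  next
    case (lie_inv d a)
    then show ?case using subgroup.m_inv_closed[OF lower_central_subgroup] by auto
  next
    case (lie_higher d a)
    then show ?case using lower_central_Suc_subset by auto
  qed
  then show "d \<ge> 1" "a \<in> lower_central G d" by auto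
qed

lemma lie_carrier: "graded Z \<Longrightarrow> lie Z d a \<Longrightarrow> a \<in> carrier G"
  using lie_lower_central lower_central_carrier by blast

lemma lie_conj:
  assumes "graded Z" "lie Z d a" "g \<in> carrier G"
  shows "lie Z d (g \<otimes> a \<otimes> inv g)"
proof -
  have "lie Z d (comm g a)"
    using assms lie_lower_central[OF assms(1,2)]
    by (intro lie_higher comm_lower_central_Suc) auto
  then show ?thesis
    using assms lie_carrier[OF assms(1,2)] by (simp add: conj_eq_comm lie_mult)
qed

lemma lie_normal:
  assumes "graded Z" "d \<ge> 1"
  shows "{a. lie Z d a} \<lhd> G"
proof (rule normal_invI)
  have "lie Z d \<one>"
    using assms subgroup.one_closed[OF lower_central_subgroup] by (intro lie_higher)
  then show "subgroup {a. lie Z d a} G"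
    using lie_carrier[OF assms(1)] by (intro subgroupI) (auto intro: lie_mult lie_inv)
qed (use lie_conj[OF assms(1)] in auto)

lemma lie_empty: "lie {} d a \<Longrightarrow> a \<in> lower_central G (Suc d)"
proof (induction rule: lie.induct)
  case (lie_comm d a e b)
  then have "comm a b \<in> lower_central G (Suc d + Suc e)" by (intro comm_lower_central)
  then show ?case using lower_central_Suc_subset[of "Suc (d + e)"] by auto
qed (auto intro: subgroup.m_closed[OF lower_central_subgroup]
    subgroup.m_inv_closed[OF lower_central_subgroup])

text \<open>By the Jacobi identity \<open>ad(x)\<close> is a derivation, so that it preserves a Lie subring once it
  preserves its generators. Degrees beyond \<open>k\<close> are ignored to keep the generators finite in number.\<close>

lemma lie_derivation:
  assumes Z: "graded Z" and x: "x \<in> lower_central G r" and r: "r \<ge> 1"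
    and gens: "\<And>a u. (a, u) \<in> Z \<Longrightarrow> r + length u \<le> k \<Longrightarrow> lie Z (r + length u) (comm x a)"
  shows "lie Z d s \<Longrightarrow> r + d \<le> k \<Longrightarrow> lie Z (r + d) (comm x s)"
proof (induction rule: lie.induct)
  case (lie_gen a u)
  then show ?case by (intro gens)
next
  case (lie_mult d a b)
  have c: "x \<in> carrier G" "a \<in> carrier G" "b \<in> carrier G"
    using lie_carrier[OF Z] lower_central_carrier[OF x] lie_mult.hyps by blast+
  show ?case
    unfolding comm_mult_right[OF c]
    by (intro lie.lie_mult lie_conj Z c lie_mult.IH lie_mult.prems)
next
  case (lie_inv d a)
  have c: "x \<in> carrier G" "a \<in> carrier G"
    using lie_carrier[OF Z] lower_central_carrier[OF x] lie_inv.hyps by blast+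
  have "lie Z (r + d) (inv a \<otimes> inv (comm x a) \<otimes> inv (inv a))"
    by (intro lie.lie_inv lie_conj Z inv_closed c lie_inv.IH lie_inv.prems)
  then show ?case using c by (simp add: comm_inv_right)
next
  case (lie_higher d a)
  have "comm x a \<in> lower_central G (r + Suc d)" by (rule comm_lower_central[OF x lie_higher.hyps(2)])
  then show ?case using r by (intro lie.lie_higher) auto
next
  case (lie_comm d a e b)
  have c: "x \<in> carrier G" "a \<in> carrier G" "b \<in> carrier G"
    using lie_carrier[OF Z] lower_central_carrier[OF x] lie_comm.hyps by blast+
  define z where "z = inv b \<otimes> x \<otimes> b"
  define t where "t = comm (inv b) x"
  have t: "t \<in> lower_central G (Suc r)" unfolding t_def by (rule comm_lower_central_Suc[OF _ x]) (use c in simp)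
  have tc: "t \<in> carrier G" using c by (simp add: t_def)
  have z: "z = t \<otimes> x" using c by (simp add: z_def t_def comm_def word_simps)
  have zc: "z \<in> carrier G" using c by (simp add: z_def)
  have comm_z: "lie Z (r + d') (comm z y)" if "lie Z d' y" "lie Z (r + d') (comm x y)" for d' y
  proof -
    have y: "y \<in> carrier G" "y \<in> lower_central G d'"
      using lie_carrier[OF Z] lie_lower_central[OF Z] that by auto
    have "comm t y \<in> lower_central G (Suc r + d')" by (rule comm_lower_central[OF t y(2)])
    then have "lie Z (r + d') (comm t y)" using r by (intro lie.lie_higher) auto
    then show ?thesis
      unfolding z comm_mult_left[OF tc c(1) y(1)] by (intro lie.lie_mult lie_conj Z that tc)
  qed
  have "lie Z (r + e) (comm z b)" "lie Z (r + d) (comm z a)"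
    using lie_comm by (auto intro!: comm_z)
  then have "lie Z (r + e) (comm b z)" "lie Z (r + d) (comm z a)"
    using lie.lie_inv[of Z "r + e" "comm z b"] c zc by (simp_all add: inv_commutator)
  then have "lie Z ((r + e) + d) (comm (comm b z) (z \<otimes> a \<otimes> inv z))"
    "lie Z ((r + d) + e) (comm (comm z a) (a \<otimes> b \<otimes> inv a))"
    using lie_comm.hyps c zc by (auto intro!: lie.lie_comm lie_conj Z)
  then show ?case
    unfolding Hall_Witt[OF c(2,3,1), folded z_def]
    by (intro lie.lie_mult) (simp_all add: add_ac)
qed

text \<open>Lazard elimination: a Lie ring generated by \<open>x\<close> and \<open>Y\<close> is the sum of the multiples of \<open>x\<close> and
  the subring generated by the elements \<open>ad(x)\<^sup>i(y)\<close>, as this subring is an ideal.\<close>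

lemma lie_eliminate:
  assumes Y: "graded Y" "graded Z" and x: "x \<in> lower_central G (length v)" and v: "v \<noteq> []"
    and sub: "\<And>a u. (a, u) \<in> Y \<Longrightarrow> length u \<le> k \<Longrightarrow> (a, u) \<in> Z"
    and ad: "\<And>a u. (a, u) \<in> Z \<Longrightarrow> length v + length u \<le> k \<Longrightarrow> lie Z (length v + length u) (comm x a)"
  shows "lie (insert (x, v) Y) d a \<Longrightarrow> d \<le> k \<Longrightarrow>
    \<exists>(m::int) s. a = x [^] m \<otimes> s \<and> lie Z d s \<and> (m \<noteq> 0 \<longrightarrow> d = length v)"
proof (induction rule: lie.induct)
  note lc = lie_carrier[OF Y(2)]
  have xc: "x \<in> carrier G" using x lower_central_carrier by blast
  have one: "lie Z d \<one>" if "d \<ge> 1" for d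
    using that subgroup.one_closed[OF lower_central_subgroup] by (intro lie_higher)
  have r: "length v \<ge> 1" using v by (cases v) auto
  {
    case (lie_gen a u)
    then show ?case
    proof (cases "(a, u) = (x, v)")
      case True
      then show ?thesis using xc one[OF r] by (intro exI[of _ 1] exI[of _ \<one>]) simp
    next
      case False
      then have "lie Z (length u) a" using lie_gen by (intro lie.lie_gen sub) auto
      then show ?thesis using lc by (intro exI[of _ 0] exI[of _ a]) simp
    qed
  next
    case (lie_mult d a b)
    then obtain m s m' s' where *: "a = x [^] (m::int) \<otimes> s" "lie Z d s" "m \<noteq> 0 \<longrightarrow> d = length v"
      "b = x [^] (m'::int) \<otimes> s'" "lie Z d s'" "m' \<noteq> 0 \<longrightarrow> d = length v" by blast
    have c: "s \<in> carrier G" "s' \<in> carrier G" using * lc by blast+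
    define t where "t = inv (x [^] m') \<otimes> s \<otimes> inv (inv (x [^] m'))"
    have t: "lie Z d t" unfolding t_def using * xc by (intro lie_conj Y) auto
    have "a \<otimes> b = x [^] m \<otimes> x [^] m' \<otimes> (t \<otimes> s')"
      using c xc by (simp add: * t_def word_simps)
    also have "x [^] m \<otimes> x [^] m' = x [^] (m + m')" using xc by (simp add: int_pow_mult)
    finally show ?case
      using * t by (intro exI[of _ "m + m'"] exI[of _ "t \<otimes> s'"]) (auto intro: lie.lie_mult)
  next
    case (lie_inv d a)
    then obtain m s where *: "a = x [^] (m::int) \<otimes> s" "lie Z d s" "m \<noteq> 0 \<longrightarrow> d = length v" by blast
    have c: "s \<in> carrier G" using * lc by blast
    define t where "t = x [^] m \<otimes> inv s \<otimes> inv (x [^] m)"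
    have t: "lie Z d t" unfolding t_def using * xc by (intro lie_conj Y lie.lie_inv) auto
    have "inv a = inv (x [^] m) \<otimes> t"
      using c xc by (simp add: * t_def word_simps)
    also have "inv (x [^] m) = x [^] (- m)" using xc by (simp add: int_pow_neg)
    finally show ?case
      using * t by (intro exI[of _ "- m"] exI[of _ t]) auto
  next
    case (lie_higher d a)
    then have "lie Z d a" by (intro lie.lie_higher)
    then show ?case using lc by (intro exI[of _ 0] exI[of _ a]) simp
  next
    case (lie_comm d a e b)
    have "graded (insert (x, v) Y)" using Y x v by (simp add: graded_def)
    then have de: "d \<ge> 1" "e \<ge> 1" using lie_lower_central(1) lie_comm.hyps by blast+
    have "d \<le> k" "e \<le> k" using lie_comm.prems by auto
    from lie_comm.IH(1)[OF this(1)] lie_comm.IH(2)[OF this(2)]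
    obtain m s m' s' where *: "a = x [^] (m::int) \<otimes> s" "lie Z d s" "m \<noteq> 0 \<longrightarrow> d = length v"
      "b = x [^] (m'::int) \<otimes> s'" "lie Z e s'" "m' \<noteq> 0 \<longrightarrow> e = length v"
      by blast
    have c: "s \<in> carrier G" "s' \<in> carrier G" using * lc by blast+
    have pw: "lie Z (i + j) (comm (x [^] l) t)"
      if t: "lie Z j t" and l: "l \<noteq> 0 \<longrightarrow> i = length v" and ij: "i + j \<le> k" "i \<ge> 1" for l :: int and i j t
    proof (cases "l = 0")
      case True
      then show ?thesis using lc[OF t] one[of "i + j"] ij by (simp add: comm_eq_one)
    next
      case False
      then have i: "i = length v" using l by simp
      have "lie Z (i + j) (comm x t)"
        unfolding i by (rule lie_derivation[OF Y(2) x r ad t]) (use ij i in auto)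
      moreover have "subgroup {y \<in> carrier G. \<forall>b\<in>{t}. comm y b \<in> {a. lie Z (i + j) a}} G"
        by (intro comm_normal_subgroup lie_normal Y) (use ij lc[OF t] in auto)
      ultimately have "x [^] l \<in> {y \<in> carrier G. \<forall>b\<in>{t}. comm y b \<in> {a. lie Z (i + j) a}}"
        using xc by (intro subgroup_int_pow_closed) auto
      then show ?thesis by simp
    qed
    have "lie Z (e + d) (comm (x [^] m') s)" by (rule pw) (use * de lie_comm.prems in auto)
    from lie.lie_inv[OF this] have 1: "lie Z (d + e) (comm s (x [^] m'))"
      using c xc by (simp add: inv_commutator add.commute)
    have xp: "x [^] m \<in> carrier G" "x [^] m' \<in> carrier G" using xc by simp_all
    have bc: "b \<in> carrier G" using * c xp by simp
    have 2: "lie Z (d + e) (comm s b)"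
      unfolding *(4) comm_mult_right[OF c(1) xp(2) c(2)]
      by (rule lie.lie_mult[OF 1 lie_conj[OF Y(2) lie.lie_comm[OF *(2,5)] xp(2)]])
    have ss: "lie Z (d + e) (comm (x [^] m) s')" by (rule pw) (use * de lie_comm.prems in auto)
    have "comm (x [^] m) (x [^] m') = \<one>"
      using xc by (intro comm_eq_one) (simp_all flip: int_pow_mult add: add.commute)
    then have "comm (x [^] m) b = x [^] m' \<otimes> comm (x [^] m) s' \<otimes> inv (x [^] m')"
      unfolding *(4) comm_mult_right[OF xp c(2)] using xp c by simp
    then have 3: "lie Z (d + e) (comm (x [^] m) b)"
      using lie_conj[OF Y(2) ss xp(2)] by simp
    have "lie Z (d + e) (comm a b)"
      unfolding *(1) comm_mult_left[OF xp(1) c(1) bc]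
      by (rule lie.lie_mult[OF lie_conj[OF Y(2) 2 xp(1)] 3])
    then show ?case using lc by (intro exI[of _ 0] exI[of _ "comm a b"]) simp
  }
qed

end

section \<open>Divisibility in the graded pieces of the lower central series\<close>

context magnus
begin

text \<open>The base only has to exceed the letters and to be at least \<open>2\<close>.\<close>

abbreviation "wval \<equiv> word_val (n + 2)"
abbreviation "ratio \<equiv> word_ratio (n + 2)"

text \<open>The part of \<open>\<mu> a\<close> of degree \<open>length u\<close> has the leading word \<open>u\<close>, with coefficient \<open>1\<close>.\<close>

definition leads :: "'a \<Rightarrow> nat list \<Rightarrow> bool"
  where "leads a u \<longleftrightarrow> u \<noteq> [] \<and> set u \<subseteq> {..<n} \<and> a \<in> lower_central G (length u) \<and> \<mu> a u = 1 \<and>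
    (\<forall>w. length w = length u \<and> \<mu> a w \<noteq> 0 \<longrightarrow> w = u \<or> wval w < wval u)"

lemma leads_le: "leads a u \<Longrightarrow> length w = length u \<Longrightarrow> \<mu> a w \<noteq> 0 \<Longrightarrow> wval w \<le> wval u"
  unfolding leads_def by (metis le_less)

text \<open>The leading terms of \<open>ab\<close> and \<open>ba\<close> are \<open>uv\<close> and \<open>vu\<close>, so the larger one survives in the Lie
  bracket.\<close>

lemma leads_comm:
  assumes a: "leads a u" and b: "leads b v" and less: "wval (v @ u) < wval (u @ v)"
  shows "leads (comm a b) (u @ v)"
proof -
  have uv: "u \<noteq> []" "v \<noteq> []" "length u \<ge> 1" "length v \<ge> 1"
    and lc: "a \<in> lower_central G (length u)" "b \<in> lower_central G (length v)"
    using a b by (auto simp: leads_def Suc_le_eq)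
  have coeff: "\<mu> (comm a b) w = \<mu> a (take (length u) w) * \<mu> b (drop (length u) w)
      - \<mu> b (take (length v) w) * \<mu> a (drop (length v) w)" if "length w = length u + length v" for w
    by (rule mu_comm_coeff[OF lc uv(3,4) that])
  \<comment> \<open>The two summands of \<open>coeff\<close>: the words of the second stay below \<open>u @ v\<close>.\<close>
  have snd: "wval w \<le> wval (v @ u)"
    if w: "length w = length u + length v" "\<mu> b (take (length v) w) * \<mu> a (drop (length v) w) \<noteq> 0" for w
  proof -
    have 1: "wval (take (length v) w) \<le> wval v" by (rule leads_le[OF b]) (use w in auto)
    have 2: "wval (drop (length v) w) \<le> wval u" by (rule leads_le[OF a]) (use w in auto)
    have "wval (take (length v) w @ drop (length v) w) \<le> wval (v @ u)"
      unfolding word_val_append using w(1) 1 2 by (intro add_mono mult_mono) auto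
    then show ?thesis by simp
  qed
  have fst: "w = u @ v \<or> wval w < wval (u @ v)"
    if w: "length w = length u + length v" "\<mu> a (take (length u) w) * \<mu> b (drop (length u) w) \<noteq> 0" for w
  proof -
    define w1 w2 where "w1 = take (length u) w" and "w2 = drop (length u) w"
    have ww: "w = w1 @ w2" "length w1 = length u" "length w2 = length v"
      using w by (auto simp: w1_def w2_def)
    have nz: "\<mu> a w1 \<noteq> 0" "\<mu> b w2 \<noteq> 0" using w by (auto simp: w1_def w2_def)
    have le: "wval w1 \<le> wval u" "wval w2 \<le> wval v"
      using leads_le[OF a ww(2) nz(1)] leads_le[OF b ww(3) nz(2)] by auto
    consider "w1 = u" "w2 = v" | "wval w1 < wval u" | "wval w2 < wval v"
      using a b nz ww unfolding leads_def by blast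
    then show ?thesis
    proof cases
      case 2
      then have "wval w1 * (n + 2) ^ length w2 < wval u * (n + 2) ^ length v"
        using ww by simp
      then show ?thesis unfolding ww(1) word_val_append using le by linarith
    next
      case 3
      have "wval w1 * (n + 2) ^ length w2 \<le> wval u * (n + 2) ^ length v"
        using ww le by simp
      then show ?thesis unfolding ww(1) word_val_append using 3 by linarith
    qed (use ww in simp)
  qed
  have "\<mu> b (take (length v) (u @ v)) * \<mu> a (drop (length v) (u @ v)) = 0"
    using snd[of "u @ v"] less by (cases "\<mu> b (take (length v) (u @ v)) * \<mu> a (drop (length v) (u @ v)) = 0") auto
  then have "\<mu> (comm a b) (u @ v) = 1"
    using coeff[of "u @ v"] a b by (simp add: leads_def)
  moreover have "w = u @ v \<or> wval w < wval (u @ v)"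
    if "length w = length (u @ v)" "\<mu> (comm a b) w \<noteq> 0" for w
  proof -
    have w: "length w = length u + length v" using that by simp
    have "\<mu> a (take (length u) w) * \<mu> b (drop (length u) w) \<noteq> 0 \<or>
        \<mu> b (take (length v) w) * \<mu> a (drop (length v) w) \<noteq> 0"
      using that coeff[OF w] by auto
    then show ?thesis
    proof
      assume "\<mu> b (take (length v) w) * \<mu> a (drop (length v) w) \<noteq> 0"
      from snd[OF w this] show ?thesis using less by simp
    qed (rule fst[OF w])
  qed
  ultimately show ?thesis
    using a b comm_lower_central[OF lc] by (simp add: leads_def)
qed

definition ad :: "'a \<Rightarrow> nat \<Rightarrow> 'a \<Rightarrow> 'a"
  where "ad x i a = (comm x ^^ i) a"

lemma leads_ad:
  assumes x: "leads x v" and a: "leads a u" and less: "ratio u < ratio v"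
  shows "leads (ad x i a) (concat (replicate i v) @ u) \<and> ratio (concat (replicate i v) @ u) < ratio v"
proof (induction i)
  case (Suc i)
  define w where "w = concat (replicate i v) @ u"
  have w: "leads (ad x i a) w" "ratio w < ratio v" using Suc by (simp_all add: w_def)
  have ne: "v \<noteq> []" "w \<noteq> []" using x w by (auto simp: leads_def)
  have "wval (w @ v) < wval (v @ w)"
    by (rule word_ratio_swap(1)[THEN iffD2]) (use w ne in auto)
  then have "leads (comm x (ad x i a)) (v @ w)"
    by (rule leads_comm[OF x w(1)])
  moreover have "ratio (v @ w) < ratio v"
    by (rule word_ratio_append_less) (use w ne in auto)
  ultimately show ?case by (simp add: ad_def w_def)
qed (use a less in \<open>simp add: ad_def\<close>)

text \<open>A bound on the ratios of the leading words bounds the ratios of all words that occur in the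
  generated Lie ring, since the ratio of a concatenation lies between those of its parts.\<close>

lemma lie_ratio:
  assumes Z: "\<And>a u. (a, u) \<in> Z \<Longrightarrow> leads a u \<and> ratio u < r"
  shows "lie Z d a \<Longrightarrow> length w = d \<Longrightarrow> \<mu> a w \<noteq> 0 \<Longrightarrow> ratio w < r"
proof (induction arbitrary: w rule: lie.induct)
  have gr: "graded Z" using Z by (auto simp: graded_def leads_def)
  {
    case (lie_gen a u)
    have "wval w \<le> wval u" by (rule leads_le) (use Z lie_gen in auto)
    then have "ratio w \<le> ratio u"
      using word_ratio_less_iff_val[of "n + 2" u w] lie_gen.prems(1) by linarith
    then show ?case using Z lie_gen by force
  next
    case (lie_comm d a e b)
    have lc: "a \<in> lower_central G d" "b \<in> lower_central G e" "d \<ge> 1" "e \<ge> 1"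
      using lie_lower_central[OF gr] lie_comm.hyps by blast+
    have "\<mu> a (take d w) * \<mu> b (drop d w) \<noteq> 0 \<or> \<mu> b (take e w) * \<mu> a (drop e w) \<noteq> 0"
      using lie_comm.prems mu_comm_coeff[OF lc lie_comm.prems(1)] by auto
    then show ?case
    proof
      assume *: "\<mu> a (take d w) * \<mu> b (drop d w) \<noteq> 0"
      have "ratio (take d w) < r" "ratio (drop d w) < r"
        by (rule lie_comm.IH; use lie_comm.prems * in simp)+
      then have "ratio (take d w @ drop d w) < r"
        using lie_comm.prems lc by (intro word_ratio_append_less) auto
      then show ?thesis by simp
    next
      assume *: "\<mu> b (take e w) * \<mu> a (drop e w) \<noteq> 0"
      have "ratio (take e w) < r" "ratio (drop e w) < r"
        by (rule lie_comm.IH; use lie_comm.prems * in simp)+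
      then have "ratio (take e w @ drop e w) < r"
        using lie_comm.prems lc by (intro word_ratio_append_less) auto
      then show ?thesis by simp
    qed
  next
    case (lie_mult d a b)
    have lc: "a \<in> lower_central G d" "b \<in> lower_central G d" "d \<ge> 1"
      using lie_lower_central[OF gr] lie_mult.hyps by blast+
    have "w \<noteq> []" using lc(3) lie_mult.prems by auto
    then have "\<mu> a w \<noteq> 0 \<or> \<mu> b w \<noteq> 0"
      using mu_add[OF lc(1) lower_central_carrier[OF lc(2)], of w] lie_mult.prems by auto
    then show ?case using lie_mult by blast
  next
    case (lie_inv d a)
    have lc: "a \<in> lower_central G d" "d \<ge> 1"
      using lie_lower_central[OF gr] lie_inv.hyps by blast+
    have "w \<noteq> []" using lc(2) lie_inv.prems by auto
    then have "\<mu> a w \<noteq> 0"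
      using mu_minus[OF lc(1), of w] lie_inv.prems by auto
    then show ?case using lie_inv by blast
  next
    case (lie_higher d a)
    then have "w \<noteq> []" by auto
    then show ?case using mu_zero[of a "Suc d" w] lie_higher by auto
  }
qed

text \<open>The generating set is eliminated one element at a time, always one whose word has the
  largest ratio. In the degree of interest its leading word then occurs in nothing that is left,
  so that its multiplicity can be read off from a coefficient.\<close>

lemma lie_divisible:
  fixes m :: nat
  assumes "k \<ge> 1" "finite Z" "\<And>a u. (a, u) \<in> Z \<Longrightarrow> leads a u \<and> length u \<le> k"
    and "inj_on snd Z" "code (snd ` Z)"
    and "lie Z k g" "\<And>w. length w = k \<Longrightarrow> int m dvd \<mu> g w"
  shows "\<exists>y\<in>lower_central G k. g \<otimes> inv (y [^] m) \<in> lower_central G (Suc k)"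
  using assms(2-)
proof (induction "card {w. set w \<subseteq> {..<n} \<and> length w \<le> k \<and> (\<exists>z\<in>Z. ratio w \<le> ratio (snd z))}"
    arbitrary: Z g rule: less_induct)
  case less
  note Z = less.prems(1-4) and g = less.prems(5,6)
  show ?case
  proof (cases "Z = {}")
    case True
    then have "g \<in> lower_central G (Suc k)" using g lie_empty by simp
    moreover have "\<one> \<in> lower_central G k" by (rule subgroup.one_closed[OF lower_central_subgroup])
    ultimately show ?thesis using lower_central_carrier by (intro bexI[of _ \<one>]) auto
  next
    case False
    define M where "M = Max ((\<lambda>z. ratio (snd z)) ` Z)"
    have "M \<in> (\<lambda>z. ratio (snd z)) ` Z" unfolding M_def using Z False by (intro Max_in) auto
    then obtain x v where xv: "(x, v) \<in> Z" "M = ratio v" by auto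
    have max: "ratio u \<le> ratio v" if "(a, u) \<in> Z" for a u
      unfolding xv(2)[symmetric] M_def using that Z by (intro Max_ge) force+
    have x: "leads x v" "length v \<le> k" using Z(2)[OF xv(1)] by auto
    then have v: "v \<noteq> []" "length v \<ge> 1" "x \<in> lower_central G (length v)" "set v \<subseteq> {..<n}"
      by (auto simp: leads_def Suc_le_eq)
    have vneq: "u \<noteq> v" if "(a, u) \<in> Z - {(x, v)}" for a u
      using that xv(1) inj_onD[OF Z(3), of "(a, u)" "(x, v)"] by auto
    \<comment> \<open>Words of equal ratio commute, and distinct code words do not.\<close>
    have strict: "ratio u < ratio v" if au: "(a, u) \<in> Z - {(x, v)}" for a u
    proof (rule ccontr)
      have u: "leads a u" using au Z(2) by blast
      assume "\<not> ratio u < ratio v"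
      then have "ratio u = ratio v" using max[of a u] au by simp
      then have "wval (u @ v) = wval (v @ u)"
        using u x by (subst word_ratio_swap(2)) (auto simp: leads_def)
      then have "u @ v = v @ u"
        using u x by (intro word_val_inj[of _ "n + 2"]) (auto simp: leads_def)
      moreover have "u \<in> snd ` Z" "v \<in> snd ` Z" using au xv(1) by force+
      ultimately show False using code_commute[OF Z(4)] vneq[OF au] by blast
    qed
    define Z' where "Z' = {(ad x i a, concat (replicate i v) @ u) | i a u.
      (a, u) \<in> Z - {(x, v)} \<and> length (concat (replicate i v) @ u) \<le> k}"
    have Z'D: "\<exists>i a u. b = ad x i a \<and> w = concat (replicate i v) @ u \<and> (a, u) \<in> Z - {(x, v)} \<and>
        length (concat (replicate i v) @ u) \<le> k" if "(b, w) \<in> Z'" for b w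
      using that unfolding Z'_def by blast
    have len: "length (concat (replicate i v)) = i * length v" for i
      by (induction i) auto
    have lead': "leads b w \<and> length w \<le> k \<and> ratio w < ratio v" if "(b, w) \<in> Z'" for b w
      using Z'D[OF that] leads_ad[OF x(1)] strict Z(2) by blast
    have "finite Z'"
    proof (rule finite_subset)
      show "Z' \<subseteq> (\<lambda>(i, a, u). (ad x i a, concat (replicate i v) @ u)) ` ({..k} \<times> Z)"
      proof
        fix z assume "z \<in> Z'"
        then obtain i a u where *: "z = (ad x i a, concat (replicate i v) @ u)" "(a, u) \<in> Z"
          "length (concat (replicate i v) @ u) \<le> k" unfolding Z'_def by blast
        have "i * 1 \<le> i * length v" using v(2) by (rule mult_le_mono2)
        moreover have "i * length v \<le> k" using *(3) len[of i] by simp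
        ultimately have "i \<le> k" by linarith
        then show "z \<in> (\<lambda>(i, a, u). (ad x i a, concat (replicate i v) @ u)) ` ({..k} \<times> Z)"
          using * by force
      qed
    qed (use Z in auto)
    moreover have "inj_on snd Z'"
    proof (rule inj_onI)
      fix y z assume yz: "y \<in> Z'" "z \<in> Z'" "snd y = snd z"
      obtain i a u where y: "y = (ad x i a, concat (replicate i v) @ u)" "(a, u) \<in> Z - {(x, v)}"
        using yz(1) unfolding Z'_def by blast
      obtain j b w where z: "z = (ad x j b, concat (replicate j v) @ w)" "(b, w) \<in> Z - {(x, v)}"
        using yz(2) unfolding Z'_def by blast
      have "i = j \<and> u = w"
        by (rule code_replicate_eq[OF Z(4), of v])
          (use xv(1) y z yz(3) vneq in force)+
      moreover from this have "a = b" using inj_onD[OF Z(3), of "(a, u)" "(b, w)"] y z by auto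
      ultimately show "y = z" using y z by simp
    qed
    moreover have "code (snd ` Z')"
    proof (rule code_subset[OF code_eliminate[OF Z(4), of v]])
      show "v \<in> snd ` Z" using xv(1) by force
      show "snd ` Z' \<subseteq> {concat (replicate i v) @ y |i y. y \<in> snd ` Z - {v}}"
      proof
        fix w assume "w \<in> snd ` Z'"
        then obtain b where "(b, w) \<in> Z'" by force
        then obtain i a u where *: "w = concat (replicate i v) @ u" "(a, u) \<in> Z - {(x, v)}"
          using Z'D by blast
        then have "u \<in> snd ` Z - {v}" using vneq by force
        then show "w \<in> {concat (replicate i v) @ y |i y. y \<in> snd ` Z - {v}}" using * by blast
      qed
    qed
    moreover have "card {w. set w \<subseteq> {..<n} \<and> length w \<le> k \<and> (\<exists>z\<in>Z'. ratio w \<le> ratio (snd z))}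
      < card {w. set w \<subseteq> {..<n} \<and> length w \<le> k \<and> (\<exists>z\<in>Z. ratio w \<le> ratio (snd z))}"
      (is "card ?A < card ?B")
    proof (rule psubset_card_mono)
      show "finite ?B"
        using finite_lists_length_le[of "{..<n}" k] by (rule finite_subset[rotated]) auto
      have "ratio w < ratio v" if "w \<in> ?A" for w
      proof -
        obtain z where "z \<in> Z'" "ratio w \<le> ratio (snd z)" using \<open>w \<in> ?A\<close> by blast
        then show ?thesis using lead'[of "fst z" "snd z"] by simp
      qed
      then have A: "?A \<subseteq> {w. set w \<subseteq> {..<n} \<and> length w \<le> k \<and> ratio w < ratio v}" by blast
      have "v \<in> ?B" using v x xv(1) by force
      moreover have "v \<notin> ?A" using A by blast
      moreover have "?A \<subseteq> ?B"
      proof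
        fix w assume "w \<in> ?A"
        then have "set w \<subseteq> {..<n}" "length w \<le> k" "ratio w < ratio v" using A by auto
        then show "w \<in> ?B" using xv(1) by force
      qed
      ultimately show "?A \<subset> ?B" by blast
    qed
    ultimately have IH: "\<exists>y\<in>lower_central G k. s \<otimes> inv (y [^] m) \<in> lower_central G (Suc k)"
      if "lie Z' k s" "\<And>w. length w = k \<Longrightarrow> int m dvd \<mu> s w" for s
      using lead' that by (intro less.hyps[of Z' s]) blast+
    have gr: "graded Z'" using lead' by (auto simp: graded_def leads_def)
    have Zx: "insert (x, v) (Z - {(x, v)}) = Z" using xv(1) by blast
    have "\<exists>(a::int) s. g = x [^] a \<otimes> s \<and> lie Z' k s \<and> (a \<noteq> 0 \<longrightarrow> k = length v)"
    proof (rule lie_eliminate[of "Z - {(x, v)}"])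
      show "graded (Z - {(x, v)})" using Z(2) by (auto simp: graded_def leads_def)
      show "lie (insert (x, v) (Z - {(x, v)})) k g" unfolding Zx by (rule g(1))
    next
      fix a u assume "(a, u) \<in> Z - {(x, v)}" "length u \<le> k"
      then have "(ad x 0 a, concat (replicate 0 v) @ u) \<in> Z'"
        unfolding Z'_def by (intro CollectI exI[of _ 0] exI[of _ a] exI[of _ u]) simp
      then show "(a, u) \<in> Z'" by (simp add: ad_def)
    next
      fix b w assume bw: "(b, w) \<in> Z'" "length v + length w \<le> k"
      obtain i a u where *: "b = ad x i a" "w = concat (replicate i v) @ u" "(a, u) \<in> Z - {(x, v)}"
        using Z'D[OF bw(1)] by blast
      have "(ad x (Suc i) a, concat (replicate (Suc i) v) @ u) \<in> Z'"
        unfolding Z'_def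
        by (intro CollectI exI[of _ "Suc i"] exI[of _ a] exI[of _ u]) (use * bw in simp)
      then have "(comm x b, v @ w) \<in> Z'" using * by (simp add: ad_def)
      then show "lie Z' (length v + length w) (comm x b)" using lie_gen by fastforce
    qed (use gr v in auto)
    then obtain a s where gs: "g = x [^] (a::int) \<otimes> s" "lie Z' k s" "a \<noteq> 0 \<longrightarrow> k = length v"
      by blast
    have s: "s \<in> lower_central G k" "s \<in> carrier G"
      using lie_lower_central[OF gr gs(2)] lie_carrier[OF gr gs(2)] by auto
    show ?thesis
    proof (cases "a = 0")
      case True
      then have "g = s" using gs s by simp
      then show ?thesis using IH[OF gs(2)] g by simp
    next
      case False
      then have k: "k = length v" using gs by simp
      have xc: "x \<in> lower_central G k" "x \<in> carrier G"
        using v(3) k lower_central_carrier by auto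
      have xp: "x [^] l \<in> lower_central G k" for l :: int
        by (rule subgroup_int_pow_closed[OF lower_central_subgroup xc(1)])
      have coeff: "\<mu> g w = a * \<mu> x w + \<mu> s w" if "length w = k" for w
        unfolding gs(1) using that \<open>k \<ge> 1\<close> mu_add[OF xp s(2), of w] mu_int_pow[OF xc(1), of w] by force
      \<comment> \<open>All words that remain have a ratio below that of \<open>v\<close>, so \<open>v\<close> only counts copies of \<open>x\<close>.\<close>
      have "\<mu> s v = 0"
        using lie_ratio[OF _ gs(2), of "ratio v" v] lead' k by auto
      then have "\<mu> g v = a" using coeff[of v] k x by (simp add: leads_def)
      then have "int m dvd a" using g(2)[of v] k by simp
      then obtain b where b: "a = int m * b" by (elim dvdE)
      have "int m dvd \<mu> s w" if "length w = k" for w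
        using g(2)[OF that] coeff[OF that] b by (simp add: dvd_add_right_iff)
      from IH[OF gs(2) this] obtain y where y: "y \<in> lower_central G k"
        "s \<otimes> inv (y [^] m) \<in> lower_central G (Suc k)" by blast
      have yc: "y \<in> carrier G" using y lower_central_carrier by blast
      define c where "c = (x [^] b) [^] m"
      have c: "c = x [^] a" "c \<in> carrier G"
        unfolding c_def b using xc int_pow_pow[of x b "int m"] by (simp_all add: mult.commute int_pow_int)
      interpret L: subgroup "lower_central G (Suc k)" G by (rule lower_central_subgroup)
      have "(x [^] b \<otimes> y) [^] m \<otimes> inv (c \<otimes> y [^] m) \<in> lower_central G (Suc k)"
        unfolding c_def by (rule nat_pow_commuting_mod[OF xp y(1) \<open>k \<ge> 1\<close>])
      then have "inv ((x [^] b \<otimes> y) [^] m \<otimes> inv (c \<otimes> y [^] m)) \<in> lower_central G (Suc k)"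
        by (rule L.m_inv_closed)
      moreover have "c \<otimes> (s \<otimes> inv (y [^] m)) \<otimes> inv c \<in> lower_central G (Suc k)"
        by (rule lower_central_conj(1)[OF y(2) c(2)])
      ultimately have "(c \<otimes> (s \<otimes> inv (y [^] m)) \<otimes> inv c) \<otimes>
          inv ((x [^] b \<otimes> y) [^] m \<otimes> inv (c \<otimes> y [^] m)) \<in> lower_central G (Suc k)"
        by (rule L.m_closed[rotated])
      moreover have "(c \<otimes> (s \<otimes> inv (y [^] m)) \<otimes> inv c) \<otimes>
          inv ((x [^] b \<otimes> y) [^] m \<otimes> inv (c \<otimes> y [^] m)) = c \<otimes> s \<otimes> inv ((x [^] b \<otimes> y) [^] m)"
        using c(2) s yc xc by (simp add: word_simps)
      ultimately have "g \<otimes> inv ((x [^] b \<otimes> y) [^] m) \<in> lower_central G (Suc k)"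
        unfolding gs(1) c(1) by simp
      moreover have "x [^] b \<otimes> y \<in> lower_central G k"
        by (rule subgroup.m_closed[OF lower_central_subgroup xp y(1)])
      ultimately show ?thesis by blast
    qed
  qed
qed

lemma lie_generators: "g \<in> lower_central G (Suc k) \<Longrightarrow> lie ((\<lambda>i. (X i, [i])) ` {..<n}) (Suc k) g"
proof (induction k arbitrary: g)
  let ?Z = "(\<lambda>i. (X i, [i])) ` {..<n}"
  have gr: "graded ?Z" by (auto simp: graded_def X_closed)
  have sub: "subgroup {a. lie ?Z (Suc d) a} G" for d
    by (intro normal_imp_subgroup lie_normal gr) simp
  {
    case 0
    have "lie ?Z (Suc 0) (X i)" if "i < n" for i
      using lie_gen[of "X i" "[i]" ?Z] that by auto
    then have "carrier G \<subseteq> {a. lie ?Z (Suc 0) a}"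
      by (intro generate_induct sub) auto
    then show ?case using 0 by auto
  next
    case (Suc k)
    have one: "lie ?Z (Suc 0) a" if "a \<in> carrier G" for a
    proof -
      have "lie ?Z (Suc 0) (X i)" if "i < n" for i
        using lie_gen[of "X i" "[i]" ?Z] that by auto
      then have "carrier G \<subseteq> {a. lie ?Z (Suc 0) a}"
        by (intro generate_induct sub) auto
      then show ?thesis using that by auto
    qed
    have "lower_central G (Suc (Suc k)) \<subseteq> {a. lie ?Z (Suc (Suc k)) a}"
      unfolding lower_central.simps
    proof (rule commutator_subgroup_subset[OF _ _ sub])
      fix a b assume "a \<in> carrier G" "b \<in> lower_central G (Suc k)"
      then have "lie ?Z (Suc 0 + Suc k) (comm a b)"
        by (intro lie_comm one Suc.IH)
      then show "comm a b \<in> {a. lie ?Z (Suc (Suc k)) a}" by simp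
    qed (auto simp: lower_central_carrier)
    then show ?case using Suc.prems by blast
  }
qed

text \<open>The graded piece \<open>\<gamma>\<^sub>k / \<gamma>\<^sub>k\<^sub>+\<^sub>1\<close> embeds as a pure subgroup in the homogeneous polynomials of
  degree \<open>k\<close>. For \<open>m = 0\<close> this is injectivity.\<close>

theorem lower_central_divisible:
  fixes m :: nat
  assumes k: "k \<ge> 1" and g: "g \<in> lower_central G k" and m: "\<And>w. length w = k \<Longrightarrow> int m dvd \<mu> g w"
  shows "\<exists>y\<in>lower_central G k. g \<otimes> inv (y [^] m) \<in> lower_central G (Suc k)"
proof (rule lie_divisible[of k "(\<lambda>i. (X i, [i])) ` {..<n}"])
  obtain k' where k': "k = Suc k'" using k by (cases k) auto
  show "lie ((\<lambda>i. (X i, [i])) ` {..<n}) k g"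
    using g unfolding k' by (rule lie_generators)
  show "code (snd ` (\<lambda>i. (X i, [i])) ` {..<n})"
    using code_singletons[of "{..<n}"] by (simp add: image_image)
  show "leads a u \<and> length u \<le> k" if "(a, u) \<in> (\<lambda>i. (X i, [i])) ` {..<n}" for a u
    using that k by (auto simp: leads_def X_closed mu_X series_gen_def split: if_splits)
qed (use k m in \<open>auto intro: inj_onI\<close>)

lemma lower_central_SucI:
  assumes k: "k \<ge> 1" and g: "g \<in> lower_central G k" and m: "\<And>w. length w = k \<Longrightarrow> \<mu> g w = 0"
  shows "g \<in> lower_central G (Suc k)"
  using lower_central_divisible[OF k g, of 0] m lower_central_carrier[OF g] by simp

end

section \<open>Subgroups of lattices and p-groups\<close>

text \<open>A vector in the \<open>p\<close>-adic closure of a subgroup of a lattice has a multiple in the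
  subgroup. Eliminating one coordinate with a vector of the subgroup that does not vanish there
  costs only a common factor.\<close>

lemma padic_closure_multiple:
  fixes M :: "('i \<Rightarrow> int) set" and p :: int
  assumes "finite I" and p: "p \<ge> 2" and "M \<noteq> {}"
    and "\<And>f g a b. f \<in> M \<Longrightarrow> g \<in> M \<Longrightarrow> (\<lambda>i. a * f i + b * g i) \<in> M"
    and "\<And>j::nat. \<exists>f\<in>M. \<forall>i\<in>I. p ^ j dvd v i - f i"
  shows "\<exists>m f. m \<noteq> 0 \<and> f \<in> M \<and> (\<forall>i\<in>I. m * v i = f i)"
  using assms(1,3-)
proof (induction I arbitrary: M v rule: finite_induct)
  case empty
  then show ?case by (intro exI[of _ 1]) auto
next
  case (insert i0 I)
  note comb = insert.prems(2) and cl = insert.prems(3)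
  show ?case
  proof (cases "\<forall>f\<in>M. f i0 = 0")
    case True
    have "v i0 = 0"
    proof (rule ccontr)
      assume nz: "v i0 \<noteq> 0"
      define j where "j = nat \<bar>v i0\<bar>"
      obtain f where f: "f \<in> M" "p ^ j dvd v i0 - f i0" using cl[of j] by blast
      have "f i0 = 0" using True f(1) by blast
      with f(2) have "p ^ j dvd v i0" by (simp only: diff_0_right)
      then have "\<bar>p ^ j\<bar> \<le> \<bar>v i0\<bar>" using nz by (rule dvd_imp_le_int[rotated])
      moreover have "int j < 2 ^ j" by (rule of_nat_less_two_power)
      moreover have "(2::int) ^ j \<le> p ^ j" using p by (intro power_mono) auto
      ultimately show False by (simp add: j_def)
    qed
    moreover have "\<exists>m f. m \<noteq> 0 \<and> f \<in> M \<and> (\<forall>i\<in>I. m * v i = f i)"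
      by (rule insert.IH[OF insert.prems(1) comb]) (use cl in blast)+
    then obtain m f where "m \<noteq> 0" "f \<in> M" "\<forall>i\<in>I. m * v i = f i" by blast
    ultimately show ?thesis using True by (intro exI[of _ m] exI[of _ f]) simp
  next
    case False
    then obtain e where e: "e \<in> M" "e i0 \<noteq> 0" by blast
    define M' where "M' = {f \<in> M. f i0 = 0}"
    define v' where "v' i = e i0 * v i - v i0 * e i" for i
    have "\<exists>m f. m \<noteq> 0 \<and> f \<in> M' \<and> (\<forall>i\<in>I. m * v' i = f i)"
    proof (rule insert.IH)
      have "(\<lambda>i. 0 * e i + 0 * e i) \<in> M" by (rule comb[OF e(1) e(1)])
      then show "M' \<noteq> {}" by (auto simp: M'_def)
      show "(\<lambda>i. a * f i + b * g i) \<in> M'" if "f \<in> M'" "g \<in> M'" for f g a b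
        using that comb by (simp add: M'_def)
      fix j :: nat
      obtain f where f: "f \<in> M" "\<And>i. i \<in> insert i0 I \<Longrightarrow> p ^ j dvd v i - f i" using cl[of j] by blast
      define z where "z i = e i0 * f i + (- f i0) * e i" for i
      have "z \<in> M" unfolding z_def by (rule comb[OF f(1) e(1)])
      then have "z \<in> M'" by (simp add: M'_def z_def)
      moreover have "p ^ j dvd v' i - z i" if "i \<in> I" for i
      proof -
        have "v' i - z i = e i0 * (v i - f i) - (v i0 - f i0) * e i"
          by (simp add: v'_def z_def algebra_simps)
        then show ?thesis using f(2)[of i] f(2)[of i0] that by simp
      qed
      ultimately show "\<exists>f\<in>M'. \<forall>i\<in>I. p ^ j dvd v' i - f i" by blast
    qed
    then obtain m f where mf: "m \<noteq> 0" "f \<in> M" "f i0 = 0" "\<And>i. i \<in> I \<Longrightarrow> m * v' i = f i"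
      by (auto simp: M'_def)
    define h where "h i = 1 * f i + (m * v i0) * e i" for i
    have "h \<in> M" unfolding h_def by (rule comb[OF mf(2) e(1)])
    moreover have "m * e i0 * v i = h i" if "i \<in> insert i0 I" for i
    proof (cases "i = i0")
      case False
      then have "m * v' i = f i" using that mf by simp
      then show ?thesis by (simp add: h_def v'_def algebra_simps)
    qed (simp add: h_def mf)
    ultimately show ?thesis using mf e by (intro exI[of _ "m * e i0"] exI[of _ h]) simp
  qed
qed

text \<open>A finite group of \<open>p\<close>-power exponent has \<open>p\<close>-power order, as a Sylow subgroup for another
  prime would contain an element of an order prime to \<open>p\<close>.\<close>

lemma (in group) order_prime_power:
  assumes fin: "finite (carrier G)" and p: "prime (p::nat)"
    and exponent: "\<And>x. x \<in> carrier G \<Longrightarrow> x [^] (p ^ r) = \<one>"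
  shows "\<exists>k. order G = p ^ k"
proof -
  have "order G \<noteq> 0" using fin by (simp add: order_gt_0_iff_finite[THEN iffD2])
  then obtain m where m: "order G = p ^ multiplicity p (order G) * m" "\<not> p dvd m"
    by (rule multiplicity_decompose'[of "order G" p]) (use prime_gt_1_nat[OF p] in auto)
  have "m = 1"
  proof (rule ccontr)
    assume "m \<noteq> 1"
    then obtain q where q: "prime q" "q dvd m" using prime_factor_nat by blast
    then have "q \<noteq> p" using m by auto
    have "q dvd order G" using q m(1) by (metis dvd_mult)
    then obtain l where "order G = q ^ 1 * l" by auto
    then obtain H where H: "subgroup H G" "card H = q ^ 1"
      using sylow_thm[OF q(1) is_group _ fin] by blast
    interpret H: group "G\<lparr>carrier := H\<rparr>" by (rule subgroup_imp_group[OF H(1)])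
    have "H \<noteq> {\<one>}" using H(2) prime_gt_1_nat[OF q(1)] by auto
    then obtain h where h: "h \<in> H" "h \<noteq> \<one>" using subgroup.one_closed[OF H(1)] by blast
    have hc: "h \<in> carrier G" by (rule subgroup.mem_carrier[OF H(1) h(1)])
    have "h [^]\<^bsub>G\<lparr>carrier := H\<rparr>\<^esub> order (G\<lparr>carrier := H\<rparr>) = \<one>\<^bsub>G\<lparr>carrier := H\<rparr>\<^esub>"
      using h by (intro H.pow_order_eq_1) simp
    then have "h [^] q = \<one>" using H(2) by (simp add: order_def nat_pow_consistent[symmetric])
    then have "ord h dvd q" by (rule pow_eq_id[OF hc, THEN iffD1])
    moreover have "ord h dvd p ^ r" by (rule pow_eq_id[OF hc, THEN iffD1, OF exponent[OF hc]])
    moreover have "coprime q (p ^ r)"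
      using q(1) p \<open>q \<noteq> p\<close> by (simp add: primes_coprime)
    ultimately have "ord h = 1" using coprime_common_divisor_nat by blast
    then show False using h hc ord_eq_1 by simp
  qed
  then show ?thesis using m by auto
qed

section \<open>Congruence subgroups of \<open>p\<close>-power index\<close>

text \<open>The exponent \<open>r - length w\<close> is that of the \<open>r\<close>-th power of the ideal generated by \<open>p\<close> and the
  variables. Products of two elements of this power vanish modulo the next one, so that
  multiplication becomes addition there.\<close>

lemma jet_mult:
  fixes p :: int
  assumes r: "r \<ge> 1" and f: "f [] = 1" "\<And>w. w \<noteq> [] \<Longrightarrow> p ^ (r - length w) dvd f w"
    and g: "g [] = 1" "\<And>w. w \<noteq> [] \<Longrightarrow> p ^ (r - length w) dvd g w" and w: "w \<noteq> []"
  shows "p ^ (Suc r - length w) dvd conv f g w - (f w + g w)"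
proof -
  have "p ^ (Suc r - length w) dvd f (take i w) * g (drop i w)" if "i \<in> {1..<length w}" for i
  proof -
    have "p ^ (r - length (take i w)) * p ^ (r - length (drop i w)) dvd f (take i w) * g (drop i w)"
      by (rule mult_dvd_mono[OF f(2) g(2)]) (use that w in auto)
    moreover have "p ^ (Suc r - length w) dvd p ^ (r - length (take i w)) * p ^ (r - length (drop i w))"
      unfolding power_add[symmetric] using that r by (intro le_imp_power_dvd) auto
    ultimately show ?thesis by (rule dvd_trans[rotated])
  qed
  then have "p ^ (Suc r - length w) dvd (\<Sum>i\<in>{1..<length w}. f (take i w) * g (drop i w))"
    by (intro dvd_sum)
  then show ?thesis using conv_middle[of f g w] f(1) g(1) w by simp
qed

context magnus
begin

text \<open>Each \<open>p\<close>-th power moves one step down the filtration by the powers of that ideal.\<close>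

lemma jet_power:
  fixes p :: nat
  assumes g: "g \<in> carrier G" and w: "w \<noteq> []"
  shows "int p ^ (Suc s - length w) dvd \<mu> (g [^] (p ^ s)) w"
  using w
proof (induction s arbitrary: w)
  case 0
  then show ?case by (cases w) auto
next
  case (Suc s)
  define y where "y = g [^] (p ^ s)"
  have y: "y \<in> carrier G" using g by (simp add: y_def)
  have IH: "int p ^ (Suc s - length w) dvd \<mu> y w" if "w \<noteq> []" for w
    using Suc.IH[OF that] by (simp add: y_def)
  have *: "int p ^ (Suc (Suc s) - length w) dvd \<mu> (y [^] m) w - int m * \<mu> y w"
    if "w \<noteq> []" for m :: nat and w
    using that
  proof (induction m arbitrary: w)
    case 0
    then show ?case using mu.hom_one by (simp add: series_one_def)
  next
    case (Suc m)
    have "int p ^ (Suc s - length v) dvd \<mu> (y [^] m) v" if "v \<noteq> []" for v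
    proof -
      have "int p ^ (Suc s - length v) dvd int p ^ (Suc (Suc s) - length v)"
        by (intro le_imp_power_dvd) auto
      then have "int p ^ (Suc s - length v) dvd \<mu> (y [^] m) v - int m * \<mu> y v"
        using Suc.IH[OF that] by (rule dvd_trans)
      moreover have "int p ^ (Suc s - length v) dvd int m * \<mu> y v" using IH[OF that] by simp
      ultimately show ?thesis by (simp only: dvd_diff_left_iff)
    qed
    then have "int p ^ (Suc (Suc s) - length w) dvd
        conv (\<mu> (y [^] m)) (\<mu> y) w - (\<mu> (y [^] m) w + \<mu> y w)"
      using y IH Suc.prems by (intro jet_mult) auto
    from dvd_add[OF this Suc.IH[OF Suc.prems]]
    show ?case using y by (simp add: mu_mult algebra_simps)
  qed
  have "int p ^ (Suc (Suc s) - length w) dvd int p ^ Suc (Suc s - length w)"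
    by (intro le_imp_power_dvd) auto
  also have "\<dots> dvd int p * \<mu> y w"
    using mult_dvd_mono[OF dvd_refl IH[OF Suc.prems], of "int p"] by simp
  finally have "int p ^ (Suc (Suc s) - length w) dvd int p * \<mu> y w" .
  with *[OF Suc.prems, of p] have "int p ^ (Suc (Suc s) - length w) dvd \<mu> (y [^] p) w"
    by (simp only: dvd_diff_left_iff)
  then show ?case using g by (simp add: y_def nat_pow_pow mult.commute)
qed

text \<open>The ideal generated by \<open>p\<close> and the variables, raised to the power \<open>r\<close>, together with all
  monomials of degree above \<open>c\<close>. The quotient is finite of characteristic a power of \<open>p\<close>, and this
  provides enough subgroups of \<open>p\<close>-power index that contain \<open>\<gamma>\<^sub>c\<^sub>+\<^sub>1\<close>.\<close>

definition jet_bound :: "nat \<Rightarrow> nat \<Rightarrow> nat \<Rightarrow> nat \<Rightarrow> int"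
  where "jet_bound p c r l = (if l \<le> c then int p ^ (r - l) else 1)"

lemma dvd_chain_jet: "dvd_chain (jet_bound p c r)"
  unfolding dvd_chain_def
proof (intro allI impI)
  fix i j :: nat assume "i \<le> j"
  then have "int p ^ (r - j) dvd int p ^ (r - i)" by (intro le_imp_power_dvd) simp
  with \<open>i \<le> j\<close> show "jet_bound p c r j dvd jet_bound p c r i" by (simp add: jet_bound_def)
qed

definition jet_kernel :: "nat \<Rightarrow> nat \<Rightarrow> nat \<Rightarrow> 'a set"
  where "jet_kernel p c r = {g \<in> carrier G. series_cong (jet_bound p c r) (\<mu> g) series_one}"

lemma jet_kernel_iff:
  "g \<in> jet_kernel p c r \<longleftrightarrow>
    g \<in> carrier G \<and> (\<forall>w. w \<noteq> [] \<and> length w \<le> c \<longrightarrow> int p ^ (r - length w) dvd \<mu> g w)"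
proof (cases "g \<in> carrier G")
  case True
  have "jet_bound p c r (length w) dvd \<mu> g w - series_one w \<longleftrightarrow>
      (w \<noteq> [] \<and> length w \<le> c \<longrightarrow> int p ^ (r - length w) dvd \<mu> g w)" for w
    using True by (cases "w = []") (simp_all add: jet_bound_def series_one_def)
  then show ?thesis using True by (simp add: jet_kernel_def series_cong_def)
qed (simp add: jet_kernel_def)

lemma series_cong_quotient:
  assumes N: "dvd_chain N" and g: "g \<in> carrier G" "h \<in> carrier G"
  shows "series_cong N (\<mu> (g \<otimes> inv h)) series_one \<longleftrightarrow> series_cong N (\<mu> g) (\<mu> h)"
proof
  assume "series_cong N (\<mu> (g \<otimes> inv h)) series_one"
  from series_cong_conv[OF N this series_cong_refl[of N "\<mu> h"]]
  have "series_cong N (\<mu> ((g \<otimes> inv h) \<otimes> h)) (\<mu> h)"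
    using g by (subst mu_mult) simp_all
  then show "series_cong N (\<mu> g) (\<mu> h)" using g by (simp add: m_assoc)
next
  assume "series_cong N (\<mu> g) (\<mu> h)"
  from series_cong_conv[OF N this series_cong_refl[of N "\<mu> (inv h)"]]
  have "series_cong N (\<mu> (g \<otimes> inv h)) (\<mu> (h \<otimes> inv h))"
    using g mu_mult inv_closed by metis
  then show "series_cong N (\<mu> (g \<otimes> inv h)) series_one"
    using g mu.hom_one by simp
qed

lemma jet_kernel_normal: "jet_kernel p c r \<lhd> G"
proof (rule normal_invI)
  let ?N = "jet_bound p c r"
  have one: "\<mu> \<one> = series_one" using mu.hom_one by simp
  have q: "g \<otimes> inv h \<in> jet_kernel p c r" if "g \<in> carrier G" "h \<in> carrier G" "series_cong ?N (\<mu> g) (\<mu> h)" for g h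
    unfolding jet_kernel_def
    using series_cong_quotient[OF dvd_chain_jet that(1,2), THEN iffD2, OF that(3)] that(1,2)
    by (intro CollectI conjI m_closed inv_closed)
  show sub: "subgroup (jet_kernel p c r) G"
  proof (rule subgroupI)
    show "jet_kernel p c r \<noteq> {}" using one by (force simp: jet_kernel_def)
  next
    fix g assume g: "g \<in> jet_kernel p c r"
    then have "\<one> \<otimes> inv g \<in> jet_kernel p c r"
      by (intro q) (auto simp: jet_kernel_def one intro: series_cong_sym)
    then show "inv g \<in> jet_kernel p c r" using g by (simp add: jet_kernel_def)
  next
    fix g h assume gh: "g \<in> jet_kernel p c r" "h \<in> jet_kernel p c r"
    then have "series_cong ?N (conv (\<mu> g) (\<mu> h)) (conv series_one series_one)"
      by (intro series_cong_conv dvd_chain_jet) (auto simp: jet_kernel_def)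
    then show "g \<otimes> h \<in> jet_kernel p c r" using gh by (simp add: jet_kernel_def mu_mult)
  qed (auto simp: jet_kernel_def)
  fix h g assume h: "h \<in> jet_kernel p c r" and g: "g \<in> carrier G"
  then have "series_cong ?N (conv (\<mu> g) (\<mu> h)) (conv (\<mu> g) series_one)"
    by (intro series_cong_conv dvd_chain_jet) (auto simp: jet_kernel_def)
  then have "series_cong ?N (\<mu> (g \<otimes> h)) (\<mu> g)"
    using g h by (simp add: mu_mult jet_kernel_def)
  then show "g \<otimes> h \<otimes> inv g \<in> jet_kernel p c r"
    using g h by (intro q) (auto simp: jet_kernel_def)
qed

lemma lower_central_jet_kernel: "lower_central G (Suc c) \<subseteq> jet_kernel p c r"
proof
  fix g assume g: "g \<in> lower_central G (Suc c)"
  have "\<mu> g w = 0" if "w \<noteq> []" "length w \<le> c" for w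
    using mu_zero[OF g that(1)] that(2) by simp
  then show "g \<in> jet_kernel p c r"
    using lower_central_carrier[OF g] by (simp add: jet_kernel_iff)
qed

lemma jet_kernel_p_power_normal:
  assumes p: "prime p"
  shows "jet_kernel p c r \<in> p_power_normal p G"
proof -
  let ?K = "jet_kernel p c r"
  interpret K: normal ?K G by (rule jet_kernel_normal)
  interpret Q: group "G Mod ?K" by (rule K.factorgroup_is_group)
  interpret h: group_hom G "G Mod ?K" "\<lambda>a. ?K #> a"
    by unfold_locales (rule K.r_coset_hom_Mod)
  define W where "W = {w. set w \<subseteq> {..<n} \<and> length w \<le> c}"
  have "finite W" unfolding W_def by (rule finite_lists_length_le) simp
  \<comment> \<open>The coset of \<open>g\<close> is determined by finitely many coefficients modulo \<open>p ^ r\<close>.\<close>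
  define F where "F g = (\<lambda>w\<in>W. \<mu> g w mod int p ^ r)" for g
  have pr: "int p ^ r > 0" using prime_gt_0_nat[OF p] by simp
  have "F ` carrier G \<subseteq> (\<Pi>\<^sub>E w\<in>W. {0..<int p ^ r})"
    using pr by (auto simp: F_def)
  then have finF: "finite (F ` carrier G)"
    using finite_PiE[OF \<open>finite W\<close>] by (rule finite_subset) simp
  have F: "?K #> g = ?K #> h" if "g \<in> carrier G" "h \<in> carrier G" "F g = F h" for g h
  proof -
    have "jet_bound p c r (length w) dvd \<mu> g w - \<mu> h w" for w
    proof (cases "w \<in> W")
      case True
      then have "\<mu> g w mod int p ^ r = \<mu> h w mod int p ^ r"
        using fun_cong[OF that(3), of w] by (simp add: F_def)
      then have "int p ^ r dvd \<mu> g w - \<mu> h w" by (rule mod_eq_dvd_iff[THEN iffD1])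
      moreover have "jet_bound p c r (length w) dvd int p ^ r"
        using le_imp_power_dvd[of "r - length w" r "int p"] by (simp add: jet_bound_def)
      ultimately show ?thesis by (rule dvd_trans[rotated])
    next
      case False
      then have "\<mu> g w = 0 \<and> \<mu> h w = 0" if "length w \<le> c"
        using mu_letters[OF \<open>g \<in> _\<close>, of w] mu_letters[OF \<open>h \<in> _\<close>, of w] that
        unfolding W_def by blast
      then show ?thesis
        by (cases "length w \<le> c") (simp_all add: jet_bound_def)
    qed
    then have "series_cong (jet_bound p c r) (\<mu> g) (\<mu> h)" by (simp add: series_cong_def)
    then have "series_cong (jet_bound p c r) (\<mu> (g \<otimes> inv h)) series_one"
      by (rule series_cong_quotient[OF dvd_chain_jet \<open>g \<in> _\<close> \<open>h \<in> _\<close>, THEN iffD2])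
    then have "g \<otimes> inv h \<in> ?K"
      unfolding jet_kernel_def by (intro CollectI conjI m_closed inv_closed \<open>g \<in> _\<close> \<open>h \<in> _\<close>)
    then show ?thesis by (rule rcos_eq_iff[OF jet_kernel_normal that(1,2), THEN iffD2])
  qed
  have "rcosets ?K \<subseteq> (\<lambda>y. ?K #> inv_into (carrier G) F y) ` F ` carrier G"
  proof
    fix A assume "A \<in> rcosets ?K"
    then obtain g where g: "g \<in> carrier G" "A = ?K #> g" by (auto simp: RCOSETS_def)
    then have "A = ?K #> inv_into (carrier G) F (F g)"
      by (intro trans[OF g(2) F]) (auto intro: inv_into_into f_inv_into_f[symmetric])
    then show "A \<in> (\<lambda>y. ?K #> inv_into (carrier G) F y) ` F ` carrier G" using g(1) by blast
  qed
  then have fin: "finite (carrier (G Mod ?K))"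
    using finF by (auto simp: FactGroup_def intro: finite_subset)
  have "x [^]\<^bsub>G Mod ?K\<^esub> (p ^ r) = \<one>\<^bsub>G Mod ?K\<^esub>" if x: "x \<in> carrier (G Mod ?K)" for x
  proof -
    obtain g where g: "g \<in> carrier G" "x = ?K #> g" using x by (auto simp: carrier_FactGroup)
    have "g [^] (p ^ r) \<in> ?K"
      unfolding jet_kernel_iff
    proof (intro conjI allI impI)
      fix w :: "nat list" assume w: "w \<noteq> [] \<and> length w \<le> c"
      have "int p ^ (r - length w) dvd int p ^ (Suc r - length w)"
        by (intro le_imp_power_dvd) auto
      then show "int p ^ (r - length w) dvd \<mu> (g [^] (p ^ r)) w"
        using jet_power[OF g(1), of w p r] w dvd_trans by blast
    qed (use g in simp)
    then have "?K #> g [^] (p ^ r) = ?K" by (rule K.rcos_const[OF is_group])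
    then show ?thesis using g h.hom_nat_pow[of g "p ^ r"] by simp
  qed
  from Q.order_prime_power[OF fin p this] obtain k where "order (G Mod ?K) = p ^ k" by blast
  then show ?thesis
    using jet_kernel_normal by (auto simp: p_power_normal_def order_def FactGroup_def)
qed

end

section \<open>Conjugating the generators\<close>

text \<open>The ring commutator \<open>X\<^sub>i f - f X\<^sub>i\<close>.\<close>

definition bracket :: "nat \<Rightarrow> (nat list \<Rightarrow> int) \<Rightarrow> nat list \<Rightarrow> int"
  where "bracket i f w =
    (if hd w = i then f (tl w) else 0) - (if last w = i then f (butlast w) else 0)"

lemma bracket_conv:
  assumes "w \<noteq> []"
  shows "bracket i f w = conv (series_gen i) f w - conv f (series_gen i) w"
proof -
  have "conv (series_gen i) f w = f w + (if hd w = i then f (tl w) else 0)"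
    using assms by (cases w) (simp_all add: conv_gen_left del: conv.simps)
  moreover have "conv f (series_gen i) w = f w + (if last w = i then f (butlast w) else 0)"
    using assms by (cases w rule: rev_cases) (simp_all add: conv_gen_right)
  ultimately show ?thesis by (simp add: bracket_def)
qed

text \<open>With two variables available, a polynomial without constant term can be recovered from its
  commutators with the variables, and divisibility is inherited: the centre of the free associative
  algebra consists of the constants.\<close>

lemma bracket_detects:
  assumes "n \<ge> 2" "v \<noteq> []"
  obtains i where "i < n" "bracket i f (i # v) = f v"
proof -
  define i :: nat where "i = (if last v = 0 then 1 else 0)"
  have "i < n" "i \<noteq> last v" using assms by (auto simp: i_def)
  then show thesis using assms by (intro that[of i]) (auto simp: bracket_def)
qed

context magnus
begin

lemma mu_comm_X:
  assumes i: "i < n" and h: "h \<in> lower_central G d" "d \<ge> 1" and w: "length w = Suc d"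
  shows "\<mu> (comm (X i) h) w = bracket i (\<mu> h) w"
proof -
  have "X i \<in> lower_central G 1" using X_closed[OF i] by simp
  from mu_comm_coeff[OF this h(1) _ h(2), of w]
  have "\<mu> (comm (X i) h) w = \<mu> (X i) (take 1 w) * \<mu> h (drop 1 w) - \<mu> h (take d w) * \<mu> (X i) (drop d w)"
    using w by simp
  moreover have "take 1 w = [hd w]" "drop 1 w = tl w"
    using w by (cases w; simp)+
  moreover have "take d w = butlast w" "drop d w = [last w]"
    using w by (cases w rule: rev_cases; simp)+
  moreover have "w \<noteq> []" using w by auto
  ultimately show ?thesis
    using mu_X[OF i] by (simp add: bracket_def series_gen_def)
qed

text \<open>An element whose coefficients in positive degrees below \<open>d\<close> are divisible by a high power
  of \<open>p\<close> is close to an element of \<open>\<gamma>\<^sub>d\<close>. The correction in degree \<open>e\<close> is a power \<open>y\<^bsup>p^t\<^esup>\<close>,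
  which is not trivial in the degrees above \<open>e\<close>, but whose coefficients there are divisible by a
  power of \<open>p\<close> that is smaller by a bounded amount.\<close>

lemma lower_central_approximation:
  fixes p :: nat
  assumes d: "d \<ge> 1"
  shows "\<exists>S. \<forall>g\<in>carrier G. (\<forall>v. v \<noteq> [] \<and> length v < d \<longrightarrow> int p ^ S dvd \<mu> g v) \<longrightarrow>
    (\<exists>h\<in>lower_central G d. \<forall>v. length v \<le> d \<longrightarrow> int p ^ s dvd \<mu> h v - \<mu> g v)"
proof -
  have "Suc e \<le> d \<Longrightarrow> \<exists>S. \<forall>g\<in>carrier G. (\<forall>v. v \<noteq> [] \<and> length v < d \<longrightarrow> int p ^ S dvd \<mu> g v) \<longrightarrow>
    (\<exists>h\<in>lower_central G (Suc e). \<forall>v. length v \<le> d \<longrightarrow> int p ^ s dvd \<mu> h v - \<mu> g v)" for e s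
  proof (induction e arbitrary: s)
    case 0
    show ?case by (intro exI[of _ 0] ballI impI) (rule bexI, auto)
  next
    case (Suc e)
    \<comment> \<open>The coefficients of a \<open>p ^ t\<close>-th power in degrees up to \<open>d\<close> are divisible by \<open>p ^ (t + 1 - d)\<close>.\<close>
    define t where "t = s + d"
    have "Suc e \<le> d" using Suc.prems by simp
    from Suc.IH[OF this, of t] obtain S where S: "\<And>g. g \<in> carrier G \<Longrightarrow>
      (\<forall>v. v \<noteq> [] \<and> length v < d \<longrightarrow> int p ^ S dvd \<mu> g v) \<Longrightarrow>
      \<exists>h\<in>lower_central G (Suc e). \<forall>v. length v \<le> d \<longrightarrow> int p ^ t dvd \<mu> h v - \<mu> g v"
      by blast
    show ?case
    proof (intro exI[of _ "S + t"] ballI impI)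
      fix g assume g: "g \<in> carrier G"
        and div: "\<forall>v. v \<noteq> [] \<and> length v < d \<longrightarrow> int p ^ (S + t) dvd \<mu> g v"
      have div': "int p ^ S dvd \<mu> g v" "int p ^ t dvd \<mu> g v" if "v \<noteq> []" "length v < d" for v
      proof -
        have "int p ^ S * int p ^ t dvd \<mu> g v"
          unfolding power_add[symmetric] using div that by blast
        then show "int p ^ S dvd \<mu> g v" "int p ^ t dvd \<mu> g v"
          by (rule dvd_mult_left, rule dvd_mult_right)
      qed
      then have "\<forall>v. v \<noteq> [] \<and> length v < d \<longrightarrow> int p ^ S dvd \<mu> g v" by blast
      from S[OF g this] obtain h where h: "h \<in> lower_central G (Suc e)"
        "\<And>v. length v \<le> d \<Longrightarrow> int p ^ t dvd \<mu> h v - \<mu> g v" by blast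
      have "int (p ^ t) dvd \<mu> h w" if w: "length w = Suc e" for w
      proof -
        have "w \<noteq> []" "length w < d" "length w \<le> d" using w Suc.prems by auto
        then have "int p ^ t dvd \<mu> g w" by (intro div'(2))
        then show ?thesis
          using h(2)[OF \<open>length w \<le> d\<close>] by (simp add: dvd_diff_left_iff)
      qed
      from lower_central_divisible[OF _ h(1) this] obtain y where y: "y \<in> lower_central G (Suc e)"
        "h \<otimes> inv (y [^] (p ^ t)) \<in> lower_central G (Suc (Suc e))" by auto
      have c: "h \<in> carrier G" "y \<in> carrier G" using h(1) y(1) lower_central_carrier by auto
      define z where "z = y [^] (p ^ t)"
      have z: "z \<in> carrier G" using c by (simp add: z_def)
      let ?N = "\<lambda>l. if l \<le> d then int p ^ s else 1"
      have N: "dvd_chain ?N" by (simp add: dvd_chain_def)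
      have zN: "series_cong ?N (\<mu> z) series_one"
        unfolding series_cong_def
      proof
        fix w
        show "?N (length w) dvd \<mu> z w - series_one w"
        proof (cases "w \<noteq> [] \<and> length w \<le> d")
          case True
          have "int p ^ s dvd int p ^ (Suc t - length w)"
            using True by (intro le_imp_power_dvd) (auto simp: t_def)
          moreover have "int p ^ (Suc t - length w) dvd \<mu> z w"
            unfolding z_def using True by (intro jet_power c) simp
          ultimately have "int p ^ s dvd \<mu> z w" by (rule dvd_trans)
          then show ?thesis using True by (simp add: series_one_def)
        next
          case False
          then show ?thesis using z by (cases "w = []") (simp_all add: series_one_def)
        qed
      qed
      have hz: "series_cong ?N (\<mu> (h \<otimes> inv z)) (\<mu> h)"
      proof -
        have "conv (\<mu> (h \<otimes> inv z)) (\<mu> z) = \<mu> ((h \<otimes> inv z) \<otimes> z)"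
          by (rule mu_mult[symmetric]) (use c z in auto)
        also have "(h \<otimes> inv z) \<otimes> z = h" using c z by (simp add: m_assoc)
        finally have "conv (\<mu> (h \<otimes> inv z)) (\<mu> z) = \<mu> h" .
        with series_cong_conv[OF N series_cong_refl[of ?N "\<mu> (h \<otimes> inv z)"] series_cong_sym[OF zN]]
        show ?thesis by (simp only: conv_one_right)
      qed
      have "int p ^ s dvd \<mu> (h \<otimes> inv z) v - \<mu> g v" if "length v \<le> d" for v
      proof -
        have "int p ^ s dvd \<mu> (h \<otimes> inv z) v - \<mu> h v"
          using series_congD[OF hz, of v] that by (simp only: if_True)
        moreover have "int p ^ s dvd \<mu> h v - \<mu> g v"
          using h(2)[OF that] unfolding t_def power_add by (rule dvd_mult_left)
        ultimately have "int p ^ s dvd (\<mu> (h \<otimes> inv z) v - \<mu> h v) + (\<mu> h v - \<mu> g v)"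
          by (rule dvd_add)
        then show ?thesis by (simp only: diff_add_cancel add_diff_eq)
      qed
      then show "\<exists>h\<in>lower_central G (Suc (Suc e)).
          \<forall>v. length v \<le> d \<longrightarrow> int p ^ s dvd \<mu> h v - \<mu> g v"
        using y(2) unfolding z_def by (intro bexI[of _ "h \<otimes> inv (y [^] (p ^ t))"]) blast+
    qed
  qed
  from this[of "d - 1" s] show ?thesis using d by simp
qed

text \<open>If the elements \<open>d\<^sub>i X\<^sub>i\<close> with \<open>d\<^sub>i \<in> \<gamma>\<^sub>k\<close> are conjugate to the \<open>X\<^sub>i\<close> by \<open>g\<close> up to a high
  power of \<open>p\<close>, then the leading terms of the \<open>d\<^sub>i\<close> are the commutators of \<open>g\<close> with the variables.\<close>

lemma conjugate_bracket:
  assumes p: "prime p" and k: "k \<ge> 1" "k \<le> c" and i: "i < n"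
    and d: "d \<in> lower_central G k" and g: "g \<in> carrier G"
    and conj: "d \<otimes> X i \<otimes> inv (g \<otimes> X i \<otimes> inv g) \<in> jet_kernel p c (s + k)"
    and w: "w \<noteq> []" "length w \<le> k"
  shows "int p ^ s dvd \<mu> d w + bracket i (\<mu> g) w"
proof -
  note X = X_closed[OF i]
  have dc: "d \<in> carrier G" using d lower_central_carrier by blast
  define t where "t = d \<otimes> X i \<otimes> inv (g \<otimes> X i \<otimes> inv g)"
  have t: "t \<in> carrier G" using X dc g by (simp add: t_def)
  have tN: "series_cong (jet_bound p c (s + k)) (\<mu> t) series_one"
    using conj by (simp add: jet_kernel_def t_def)
  have "t \<otimes> (g \<otimes> X i) = d \<otimes> (X i \<otimes> g)"
    using X dc g by (simp add: t_def word_simps)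
  then have eq: "conv (\<mu> t) (\<mu> (g \<otimes> X i)) = \<mu> (d \<otimes> (X i \<otimes> g))"
    using mu_mult[OF t, of "g \<otimes> X i"] g X by (simp only: m_closed)
  have "series_cong (jet_bound p c (s + k)) (\<mu> (d \<otimes> (X i \<otimes> g))) (\<mu> (g \<otimes> X i))"
    using series_cong_conv[OF dvd_chain_jet tN series_cong_refl[of _ "\<mu> (g \<otimes> X i)"]]
    unfolding eq by (simp only: conv_one_left)
  from series_congD[OF this, of w]
  have "int p ^ (s + k - length w) dvd \<mu> (d \<otimes> (X i \<otimes> g)) w - \<mu> (g \<otimes> X i) w"
    using w k by (simp add: jet_bound_def del: mu.hom_mult)
  moreover have "int p ^ s dvd int p ^ (s + k - length w)"
    using w by (intro le_imp_power_dvd) simp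
  ultimately have "int p ^ s dvd \<mu> (d \<otimes> (X i \<otimes> g)) w - \<mu> (g \<otimes> X i) w"
    by (rule dvd_trans[rotated])
  moreover have "\<mu> (d \<otimes> (X i \<otimes> g)) w = \<mu> d w + \<mu> (X i \<otimes> g) w"
    by (rule mu_add[OF d _ w]) (use X g in simp)
  moreover have "\<mu> (X i \<otimes> g) w - \<mu> (g \<otimes> X i) w = bracket i (\<mu> g) w"
    using X g by (simp add: bracket_conv[OF w(1)] mu_mult mu_X[OF i])
  ultimately show ?thesis by (simp add: algebra_simps del: mu.hom_mult)
qed

text \<open>The inductive step. The approximate solutions \<open>g\<close> give an element of the \<open>p\<close>-adic closure of
  the lattice of all families \<open>([X\<^sub>i, h])\<^sub>i\<close> with \<open>h \<in> \<gamma>\<^sub>k\<close>. This lattice is pure,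
  and therefore closed.\<close>

lemma conjugate_step:
  assumes p: "prime p" and n: "n \<ge> 2" and k: "k \<ge> 1" "Suc k \<le> c"
    and d: "\<And>i. i < n \<Longrightarrow> d i \<in> lower_central G (Suc k)"
    and conj: "\<And>r. \<exists>g\<in>carrier G. \<forall>i<n. d i \<otimes> X i \<otimes> inv (g \<otimes> X i \<otimes> inv g) \<in> jet_kernel p c r"
  shows "\<exists>h\<in>carrier G. \<forall>i<n. d i \<otimes> X i \<otimes> inv (h \<otimes> X i \<otimes> inv h) \<in> lower_central G (Suc (Suc k))"
proof -
  have approx: "\<exists>h\<in>lower_central G k. \<forall>i<n. \<forall>w. length w = Suc k \<longrightarrow>
      int p ^ s dvd \<mu> (d i) w + bracket i (\<mu> h) w" for s
  proof -
    obtain S where S: "\<And>g. g \<in> carrier G \<Longrightarrow>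
      (\<forall>v. v \<noteq> [] \<and> length v < k \<longrightarrow> int p ^ S dvd \<mu> g v) \<Longrightarrow>
      \<exists>h\<in>lower_central G k. \<forall>v. length v \<le> k \<longrightarrow> int p ^ s dvd \<mu> h v - \<mu> g v"
      using lower_central_approximation[OF k(1), of p s] by blast
    obtain g where g: "g \<in> carrier G"
      "\<And>i. i < n \<Longrightarrow> d i \<otimes> X i \<otimes> inv (g \<otimes> X i \<otimes> inv g) \<in> jet_kernel p c ((S + s) + Suc k)"
      using conj by blast
    have br: "int p ^ (S + s) dvd \<mu> (d i) w + bracket i (\<mu> g) w"
      if "i < n" "w \<noteq> []" "length w \<le> Suc k" for i w
      by (rule conjugate_bracket[OF p _ k(2) that(1) d[OF that(1)] g(1) g(2)[OF that(1)] that(2,3)]) simp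
    have "int p ^ S dvd \<mu> g v" if v: "v \<noteq> []" "length v < k" for v
    proof -
      obtain i where i: "i < n" "bracket i (\<mu> g) (i # v) = \<mu> g v"
        using bracket_detects[OF n v(1)] .
      have "\<mu> (d i) (i # v) = 0" using v by (intro mu_zero[OF d[OF i(1)]]) auto
      then have "int p ^ (S + s) dvd \<mu> g v" using br[OF i(1), of "i # v"] v i(2) by simp
      then show ?thesis unfolding power_add by (rule dvd_mult_left)
    qed
    with S[OF g(1)] obtain h where h: "h \<in> lower_central G k"
      "\<And>v. length v \<le> k \<Longrightarrow> int p ^ s dvd \<mu> h v - \<mu> g v" by blast
    have "int p ^ s dvd \<mu> (d i) w + bracket i (\<mu> h) w" if "i < n" "length w = Suc k" for i w
    proof -
      have diff: "int p ^ s dvd (if P then \<mu> h v else 0) - (if P then \<mu> g v else 0)" if "length v \<le> k" for P v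
        using h(2)[OF that] by simp
      have "int p ^ s dvd ((if hd w = i then \<mu> h (tl w) else 0) - (if hd w = i then \<mu> g (tl w) else 0))
          - ((if last w = i then \<mu> h (butlast w) else 0) - (if last w = i then \<mu> g (butlast w) else 0))"
        by (rule dvd_diff[OF diff diff]) (use \<open>length w = Suc k\<close> in simp_all)
      then have 1: "int p ^ s dvd bracket i (\<mu> h) w - bracket i (\<mu> g) w"
        unfolding bracket_def by (simp only: algebra_simps)
      have "w \<noteq> []" using that by auto
      then have "int p ^ (S + s) dvd \<mu> (d i) w + bracket i (\<mu> g) w" using that by (intro br) auto
      then have "int p ^ s dvd \<mu> (d i) w + bracket i (\<mu> g) w"
        unfolding power_add by (rule dvd_mult_right)
      from dvd_add[OF this 1] show ?thesis by simp
    qed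
    then show ?thesis using h(1) by blast
  qed
  define W where "W = {w. set w \<subseteq> {..<n} \<and> length w = Suc k}"
  have "finite W" unfolding W_def by (rule finite_lists_length_eq) simp
  define B where "B h = (\<lambda>(i, w). if length w = Suc k then bracket i (\<mu> h) w else 0)" for h
  have comb: "bracket i (\<mu> (h [^] (a::int) \<otimes> h' [^] (b::int))) w = a * bracket i (\<mu> h) w + b * bracket i (\<mu> h') w"
    if h: "h \<in> lower_central G k" "h' \<in> lower_central G k" and w: "length w = Suc k" for h h' a b i w
  proof -
    have pw: "h [^] a \<in> lower_central G k" "h' [^] b \<in> carrier G"
      using subgroup_int_pow_closed[OF lower_central_subgroup h(1)]
        int_pow_closed[OF lower_central_carrier[OF h(2)]] by auto
    have "\<mu> (h [^] a \<otimes> h' [^] b) v = a * \<mu> h v + b * \<mu> h' v" if "length v = k" for v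
    proof -
      have v: "v \<noteq> []" "length v \<le> k" using that k by auto
      show ?thesis
        unfolding mu_add[OF pw v] mu_int_pow[OF h(1) v] mu_int_pow[OF h(2) v] ..
    qed
    then show ?thesis using w by (simp add: bracket_def algebra_simps)
  qed
  have "\<exists>m f. m \<noteq> 0 \<and> f \<in> B ` lower_central G k \<and>
      (\<forall>z\<in>{..<n} \<times> W. m * (case z of (i, w) \<Rightarrow> - \<mu> (d i) w) = f z)"
  proof (rule padic_closure_multiple[where p = "int p"])
    show "finite ({..<n} \<times> W)" using \<open>finite W\<close> by simp
    show "int p \<ge> 2" using prime_ge_2_nat[OF p] by simp
    show "B ` lower_central G k \<noteq> {}"
      using subgroup.one_closed[OF lower_central_subgroup] by blast
  next
    fix f g a b assume "f \<in> B ` lower_central G k" "g \<in> B ` lower_central G k"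
    then obtain h h' where h: "h \<in> lower_central G k" "h' \<in> lower_central G k" "f = B h" "g = B h'" by blast
    have "(\<lambda>z. a * f z + b * g z) = B (h [^] a \<otimes> h' [^] b)"
      using comb[OF h(1,2)] h(3,4) by (intro ext) (auto simp: B_def)
    moreover have "h [^] a \<otimes> h' [^] b \<in> lower_central G k"
      using subgroup_int_pow_closed[OF lower_central_subgroup] h(1,2)
      by (intro subgroup.m_closed[OF lower_central_subgroup]) auto
    ultimately show "(\<lambda>z. a * f z + b * g z) \<in> B ` lower_central G k" by blast
  next
    fix j
    obtain h where h: "h \<in> lower_central G k" "\<forall>i<n. \<forall>w. length w = Suc k \<longrightarrow>
      int p ^ j dvd \<mu> (d i) w + bracket i (\<mu> h) w" using approx[of j] by blast
    have "int p ^ j dvd (case z of (i, w) \<Rightarrow> - \<mu> (d i) w) - B h z" if "z \<in> {..<n} \<times> W" for z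
    proof -
      obtain i w where z: "z = (i, w)" "i < n" "length w = Suc k"
        using \<open>z \<in> _\<close> by (auto simp: W_def)
      then have "int p ^ j dvd - (\<mu> (d i) w + bracket i (\<mu> h) w)" using h(2) by (simp only: dvd_minus_iff)
      then show ?thesis using z by (simp add: B_def)
    qed
    then show "\<exists>f\<in>B ` lower_central G k. \<forall>z\<in>{..<n} \<times> W.
        int p ^ j dvd (case z of (i, w) \<Rightarrow> - \<mu> (d i) w) - f z" using h(1) by blast
  qed
  then obtain m h0 where m: "m \<noteq> 0" and h0: "h0 \<in> lower_central G k"
    and mh: "\<And>i w. i < n \<Longrightarrow> w \<in> W \<Longrightarrow> m * (- \<mu> (d i) w) = bracket i (\<mu> h0) w"
    by (fastforce simp: B_def W_def)
  have h0c: "h0 \<in> carrier G" using h0 lower_central_carrier by blast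
  have "int (nat \<bar>m\<bar>) dvd \<mu> h0 v" if v: "length v = k" for v
  proof (cases "set v \<subseteq> {..<n}")
    case True
    have "v \<noteq> []" using v k by auto
    then obtain i where i: "i < n" "bracket i (\<mu> h0) (i # v) = \<mu> h0 v"
      using bracket_detects[OF n] by metis
    have "i # v \<in> W" using True v i by (simp add: W_def)
    then have "m dvd \<mu> h0 v" using mh[OF i(1), of "i # v"] i(2) by (metis dvd_triv_left)
    then show ?thesis by simp
  next
    case False
    then have "\<mu> h0 v = 0" using mu_letters[OF h0c, of v] by blast
    then show ?thesis by simp
  qed
  from lower_central_divisible[OF k(1) h0 this] obtain y where y: "y \<in> lower_central G k"
    "h0 \<otimes> inv (y [^] nat \<bar>m\<bar>) \<in> lower_central G (Suc k)" by blast
  have yc: "y \<in> carrier G" using y(1) lower_central_carrier by blast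
  \<comment> \<open>Up to higher commutators \<open>h0\<close> is an \<open>m\<close>-th power, and the factor \<open>m\<close> cancels.\<close>
  define h where "h = y [^] sgn m"
  have h: "h \<in> lower_central G k" "h \<in> carrier G"
    using subgroup_int_pow_closed[OF lower_central_subgroup y(1)] yc by (auto simp: h_def)
  have solution: "\<mu> (d i) w + bracket i (\<mu> h) w = 0" if i: "i < n" and w: "w \<in> W" for i w
  proof -
    have "\<mu> h0 v = m * \<mu> h v" if v: "length v = k" for v
    proof -
      have v': "v \<noteq> []" "length v \<le> k" "length v < Suc k" using v k by auto
      have "h0 = (h0 \<otimes> inv (y [^] nat \<bar>m\<bar>)) \<otimes> y [^] nat \<bar>m\<bar>"
        using h0c yc by (simp add: m_assoc)
      also have "\<mu> \<dots> v = \<mu> (h0 \<otimes> inv (y [^] nat \<bar>m\<bar>)) v + \<mu> (y [^] nat \<bar>m\<bar>) v"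
        using v' yc by (intro mu_add[OF y(2)]) auto
      also have "\<mu> (h0 \<otimes> inv (y [^] nat \<bar>m\<bar>)) v = 0"
        by (rule mu_zero[OF y(2) v'(1,3)])
      also have "\<mu> (y [^] nat \<bar>m\<bar>) v = \<bar>m\<bar> * \<mu> y v"
        unfolding mu_nat_pow[OF y(1) v'(1,2)] by simp
      also have "0 + \<bar>m\<bar> * \<mu> y v = m * (sgn m * \<mu> y v)"
        by (simp add: abs_sgn)
      also have "sgn m * \<mu> y v = \<mu> h v"
        unfolding h_def mu_int_pow[OF y(1) v'(1,2)] ..
      finally show ?thesis .
    qed
    then have "bracket i (\<mu> h0) w = m * bracket i (\<mu> h) w"
      using w by (simp add: bracket_def W_def algebra_simps)
    then have "m * (\<mu> (d i) w + bracket i (\<mu> h) w) = 0"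
      using mh[OF i w] by (simp add: algebra_simps)
    then show ?thesis using m by simp
  qed
  have "d i \<otimes> X i \<otimes> inv (h \<otimes> X i \<otimes> inv h) \<in> lower_central G (Suc (Suc k))" if i: "i < n" for i
  proof -
    have dc: "d i \<in> carrier G" using d[OF i] lower_central_carrier by blast
    have eq: "d i \<otimes> X i \<otimes> inv (h \<otimes> X i \<otimes> inv h) = d i \<otimes> comm (X i) h"
      using dc X_closed[OF i] h by (simp add: comm_def word_simps)
    have comm: "comm (X i) h \<in> lower_central G (Suc k)"
      by (rule comm_lower_central_Suc(1)[OF X_closed[OF i] h(1)])
    have mem: "d i \<otimes> comm (X i) h \<in> lower_central G (Suc k)"
      by (rule subgroup.m_closed[OF lower_central_subgroup d[OF i] comm])
    have "\<mu> (d i \<otimes> comm (X i) h) w = 0" if w: "length w = Suc k" for w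
    proof (cases "set w \<subseteq> {..<n}")
      case True
      have "\<mu> (d i \<otimes> comm (X i) h) w = \<mu> (d i) w + \<mu> (comm (X i) h) w"
        using w by (intro mu_add[OF d[OF i] lower_central_carrier[OF comm]]) auto
      also have "\<dots> = \<mu> (d i) w + bracket i (\<mu> h) w"
        unfolding mu_comm_X[OF i h(1) k(1) w] ..
      finally show ?thesis using solution[OF i, of w] True w by (simp add: W_def)
    next
      case False
      then show ?thesis using mu_letters[OF lower_central_carrier[OF mem], of w] by blast
    qed
    then show ?thesis unfolding eq by (intro lower_central_SucI[OF _ mem]) auto
  qed
  then show ?thesis using h(2) by blast
qed

text \<open>In degree \<open>1\<close> conjugation has no effect, so the leading term of \<open>f X\<^sub>i\<inverse>\<close> is divisible by every
  power of \<open>p\<close>.\<close>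

lemma abelianized_step:
  assumes p: "prime p" and c: "c \<ge> 1" and i: "i < n" and f: "f \<in> carrier G"
    and conj: "\<And>r. \<exists>g\<in>carrier G. f \<otimes> inv (g \<otimes> X i \<otimes> inv g) \<in> jet_kernel p c r"
  shows "f \<otimes> inv (X i) \<in> lower_central G 2"
proof -
  note X = X_closed[OF i]
  define d where "d = f \<otimes> inv (X i)"
  have d: "d \<in> lower_central G 1" using f X by (simp add: d_def)
  have "\<mu> d w = 0" if w: "length w = 1" for w
  proof (rule ccontr)
    assume nz: "\<mu> d w \<noteq> 0"
    define s where "s = nat \<bar>\<mu> d w\<bar>"
    obtain g where g: "g \<in> carrier G" "f \<otimes> inv (g \<otimes> X i \<otimes> inv g) \<in> jet_kernel p c (s + 1)"
      using conj by blast
    have "f = d \<otimes> X i" using f X by (simp add: d_def m_assoc)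
    then have "int p ^ s dvd \<mu> d w + bracket i (\<mu> g) w"
      using g w by (intro conjugate_bracket[OF p _ c i d g(1)]) auto
    moreover have "bracket i (\<mu> g) w = 0"
      using w g(1) by (cases w) (auto simp: bracket_def)
    ultimately have "int p ^ s dvd \<mu> d w" by simp
    then have "\<bar>int p ^ s\<bar> \<le> \<bar>\<mu> d w\<bar>" using nz by (rule dvd_imp_le_int[rotated])
    moreover have "int s < 2 ^ s" by (rule of_nat_less_two_power)
    moreover have "(2::int) ^ s \<le> int p ^ s" using prime_ge_2_nat[OF p] by (intro power_mono) auto
    ultimately show False by (simp add: s_def)
  qed
  then have "d \<in> lower_central G (Suc 1)" by (intro lower_central_SucI d) auto
  then show ?thesis by (simp add: d_def numeral_2_eq_2)
qed

text \<open>With at most one generator the group is abelian and the inductive step is void.\<close>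

lemma lower_central_cyclic:
  assumes n: "n \<le> 1"
  shows "lower_central G (Suc (Suc k)) = {\<one>}"
proof -
  have centralizer: "comm x b = \<one>"
    if "x \<in> carrier G" "b \<in> carrier G" "\<And>i. i < n \<Longrightarrow> comm (X i) b = \<one>" for x b
  proof -
    have "subgroup {x \<in> carrier G. \<forall>b\<in>{b}. comm x b \<in> {\<one>}} G"
      by (rule comm_normal_subgroup[OF one_is_normal]) (use that(2) in simp)
    then have "carrier G \<subseteq> {x \<in> carrier G. \<forall>b\<in>{b}. comm x b \<in> {\<one>}}"
      by (rule generate_induct) (use that(3) X_closed in simp)
    then show ?thesis using that(1) by blast
  qed
  have gens: "comm (X i) (X j) = \<one>" if "i < n" "j < n" for i j
  proof -
    have "i = j" using that n by simp
    then show ?thesis using X_closed[OF that(1)] by (simp add: comm_eq_one)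
  qed
  have ab: "comm x y = \<one>" if "x \<in> carrier G" "y \<in> carrier G" for x y
  proof (rule centralizer[OF that])
    fix i assume i: "i < n"
    have "comm y (X i) = \<one>" by (rule centralizer[OF that(2) X_closed[OF i] gens[OF _ i]])
    then have "inv (comm y (X i)) = \<one>" by simp
    then show "comm (X i) y = \<one>" using inv_commutator[OF that(2) X_closed[OF i]] by simp
  qed
  have "lower_central G 2 \<subseteq> {\<one>}"
    unfolding numeral_2_eq_2 lower_central.simps
    by (rule commutator_subgroup_subset) (use ab normal_imp_subgroup[OF one_is_normal] in auto)
  moreover have "lower_central G (Suc (Suc k)) \<subseteq> lower_central G 2"
    by (rule lower_central_antimono) simp
  moreover have "\<one> \<in> lower_central G (Suc (Suc k))"
    by (rule subgroup.one_closed[OF lower_central_subgroup])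
  ultimately show ?thesis by blast
qed

text \<open>Conjugacy modulo all the subgroups of \<open>p\<close>-power index is conjugacy modulo \<open>\<gamma>\<^sub>c\<^sub>+\<^sub>1\<close>. The conjugating
  elements may depend on the subgroup; a single one is built up along the lower central series.\<close>

theorem conjugate_lower_central:
  assumes p: "prime p" and f: "\<And>i. i < n \<Longrightarrow> f i \<in> carrier G" and c: "c \<ge> 1"
    and conj: "\<And>r. \<exists>g\<in>carrier G. \<forall>i<n. f i \<otimes> inv (g \<otimes> X i \<otimes> inv g) \<in> jet_kernel p c r"
  shows "\<exists>g\<in>carrier G. \<forall>i<n. f i \<otimes> inv (g \<otimes> X i \<otimes> inv g) \<in> lower_central G (Suc c)"
proof -
  have "Suc k \<le> c \<Longrightarrow>
    \<exists>g\<in>carrier G. \<forall>i<n. f i \<otimes> inv (g \<otimes> X i \<otimes> inv g) \<in> lower_central G (Suc (Suc k))" for k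
  proof (induction k)
    case 0
    have "f i \<otimes> inv (\<one> \<otimes> X i \<otimes> inv \<one>) \<in> lower_central G 2" if i: "i < n" for i
    proof -
      have "f i \<otimes> inv (X i) \<in> lower_central G 2"
        by (rule abelianized_step[OF p c i f[OF i]]) (use conj i in blast)
      then show ?thesis using X_closed[OF i] by simp
    qed
    then show ?case by (intro bexI[of _ \<one>]) (simp_all add: numeral_2_eq_2)
  next
    case (Suc k)
    then obtain a where a: "a \<in> carrier G"
      "\<And>i. i < n \<Longrightarrow> f i \<otimes> inv (a \<otimes> X i \<otimes> inv a) \<in> lower_central G (Suc (Suc k))" by auto
    show ?case
    proof (cases "n \<le> 1")
      case True
      then show ?thesis
        using a lower_central_cyclic[OF True, of k] lower_central_cyclic[OF True, of "Suc k"] by auto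
    next
      case False
      define d where "d i = inv a \<otimes> (f i \<otimes> inv (a \<otimes> X i \<otimes> inv a)) \<otimes> a" for i
      have d: "d i \<in> lower_central G (Suc (Suc k))" if "i < n" for i
        unfolding d_def by (rule lower_central_conj(2)[OF a(2)[OF that] a(1)])
      have shift: "d i \<otimes> X i \<otimes> inv (h \<otimes> X i \<otimes> inv h) =
          inv a \<otimes> (f i \<otimes> inv ((a \<otimes> h) \<otimes> X i \<otimes> inv (a \<otimes> h))) \<otimes> a"
        if "i < n" "h \<in> carrier G" for i h
        using that X_closed f a(1) by (simp add: d_def word_simps)
      have "\<exists>h\<in>carrier G. \<forall>i<n. d i \<otimes> X i \<otimes> inv (h \<otimes> X i \<otimes> inv h) \<in> lower_central G (Suc (Suc (Suc k)))"
      proof (rule conjugate_step[OF p _ _ Suc.prems d])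
        fix r
        obtain g where g: "g \<in> carrier G"
          "\<And>i. i < n \<Longrightarrow> f i \<otimes> inv (g \<otimes> X i \<otimes> inv g) \<in> jet_kernel p c r"
          using conj by blast
        \<comment> \<open>Conjugation by \<open>a\<close> is divided out of the approximate solution.\<close>
        have "a \<otimes> (inv a \<otimes> g) = g" using a(1) g(1) by (rule inv_m_cancel(2))
        then have "d i \<otimes> X i \<otimes> inv ((inv a \<otimes> g) \<otimes> X i \<otimes> inv (inv a \<otimes> g)) \<in> jet_kernel p c r"
          if "i < n" for i
          using shift[OF that, of "inv a \<otimes> g"] a(1) g(1)
            normal.inv_op_closed1[OF jet_kernel_normal a(1) g(2)[OF that]] by (simp only: m_closed inv_closed)
        then show "\<exists>g\<in>carrier G. \<forall>i<n. d i \<otimes> X i \<otimes> inv (g \<otimes> X i \<otimes> inv g) \<in> jet_kernel p c r"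
          using a(1) g(1) by (intro bexI[of _ "inv a \<otimes> g"]) auto
      qed (use False in auto)
      then obtain h where h: "h \<in> carrier G"
        "\<And>i. i < n \<Longrightarrow> d i \<otimes> X i \<otimes> inv (h \<otimes> X i \<otimes> inv h) \<in> lower_central G (Suc (Suc (Suc k)))" by blast
      have "f i \<otimes> inv ((a \<otimes> h) \<otimes> X i \<otimes> inv (a \<otimes> h)) \<in> lower_central G (Suc (Suc (Suc k)))"
        if i: "i < n" for i
      proof -
        define u where "u = f i \<otimes> inv ((a \<otimes> h) \<otimes> X i \<otimes> inv (a \<otimes> h))"
        have u: "u \<in> carrier G" using f[OF i] X_closed[OF i] a(1) h(1) by (simp add: u_def)
        have "inv a \<otimes> u \<otimes> a \<in> lower_central G (Suc (Suc (Suc k)))"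
          using h(2)[OF i] unfolding shift[OF i h(1)] u_def .
        from lower_central_conj(1)[OF this a(1)]
        have "u \<in> lower_central G (Suc (Suc (Suc k)))"
          using u a(1) by (simp only: word_simps r_inv r_one m_closed inv_closed)
        then show ?thesis by (simp only: u_def)
      qed
      then show ?thesis using a(1) h(1) by (intro bexI[of _ "a \<otimes> h"]) auto
    qed
  qed
  from this[of "c - 1"] show ?thesis using c by simp
qed

end

section \<open>Injectivity of the completion map\<close>

lemma subgroup_equalizer:
  assumes "group G" "group H" "f \<in> hom G H" "g \<in> hom G H"
  shows "subgroup {x \<in> carrier G. f x = g x} G"
proof -
  interpret G: group G by fact
  interpret f: group_hom G H f using assms by (simp add: group_hom_def group_hom_axioms_def)
  interpret g: group_hom G H g using assms by (simp add: group_hom_def group_hom_axioms_def)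
  show ?thesis
  proof (rule G.subgroupI)
    show "{x \<in> carrier G. f x = g x} \<noteq> {}"
      using G.one_closed f.hom_one g.hom_one by force
  qed auto
qed

lemma generate_free_group:
  "generate (free_group n) ((\<lambda>i. [(True, i)]) ` {..<n}) = carrier (free_group n)"
  (is "generate ?F ?X = _")
proof
  interpret F: group ?F by (rule group_free_group)
  have X: "?X \<subseteq> carrier ?F" by (auto simp: free_group_def)
  show "generate ?F ?X \<subseteq> carrier ?F" by (rule F.generate_incl[OF X])
  have letter: "[(b, i)] \<in> generate ?F ?X" if i: "i < n" for b i
  proof (cases b)
    case True
    then show ?thesis using i by (auto intro: generate.incl)
  next
    case False
    have "[(False, i)] \<otimes>\<^bsub>?F\<^esub> [(True, i)] = \<one>\<^bsub>?F\<^esub>"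
      by (simp add: free_group_def cancel_cons_def inv_letter_def)
    moreover have "[(b, i)] \<in> carrier ?F" for b using i by (simp add: free_group_def)
    ultimately have "inv\<^bsub>?F\<^esub> [(True, i)] = [(False, i)]" by (intro F.inv_equality)
    moreover have "inv\<^bsub>?F\<^esub> [(True, i)] \<in> generate ?F ?X"
      using i by (intro generate.inv) auto
    ultimately show ?thesis using False by simp
  qed
  have "w \<in> carrier ?F \<Longrightarrow> w \<in> generate ?F ?X" for w
  proof (induction w)
    case Nil
    have "\<one>\<^bsub>?F\<^esub> \<in> generate ?F ?X" by (rule generate.one)
    then show ?case by (simp add: free_group_def)
  next
    case (Cons a w)
    then have w: "w \<in> carrier ?F" "snd a < n"
      by (auto simp: free_group_def dest: reduced_ConsD)
    have "a # w = [a] \<otimes>\<^bsub>?F\<^esub> w"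
      using Cons.prems by (simp add: free_group_def cancel_cons_reduced)
    moreover have "[a] \<otimes>\<^bsub>?F\<^esub> w \<in> generate ?F ?X"
      using letter[of "snd a" "fst a"] w Cons.IH by (intro generate.eng) auto
    ultimately show ?case by simp
  qed
  then show "carrier ?F \<subseteq> generate ?F ?X" by blast
qed

lemma magnus_free_group: "\<exists>\<mu>. magnus (free_group n) n (\<lambda>i. [(True, i)]) \<mu>"
proof -
  obtain \<mu> where "\<mu> \<in> hom (free_group n) series_group" "\<forall>i<n. \<mu> [(True, i)] = series_gen i"
    using free_group_universal[OF group_series_group, of n series_gen]
    by (auto simp: series_gen_def)
  moreover have "[(True, i)] \<in> carrier (free_group n)" if "i < n" for i
    using that by (simp add: free_group_def)
  ultimately have "magnus (free_group n) n (\<lambda>i. [(True, i)]) \<mu>"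
    unfolding magnus_def magnus_axioms_def
    using group_free_group[of n] generate_free_group[of n] by blast
  then show ?thesis by blast
qed

text \<open>Subgroups of \<open>p\<close>-power index in a quotient come from those above the kernel.\<close>

lemma image_p_power_normal:
  assumes h: "group_hom G H h" and surj: "h ` carrier G = carrier H"
    and K: "K \<in> p_power_normal p G" and ker: "kernel G H h \<subseteq> K"
  shows "h ` K \<in> p_power_normal p H"
    and "x \<in> carrier G \<Longrightarrow> h x \<in> h ` K \<Longrightarrow> x \<in> K"
proof -
  interpret h: group_hom G H h by fact
  interpret K: normal K G using K by (simp add: p_power_normal_def)
  show mem: "x \<in> K" if "x \<in> carrier G" "h x \<in> h ` K" for x
  proof -
    from that(2) obtain k where k: "h x = h k" "k \<in> K" by (rule imageE)
    have kc: "k \<in> carrier G" using k(2) by (rule K.mem_carrier)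
    have "x \<otimes>\<^bsub>G\<^esub> inv\<^bsub>G\<^esub> k \<in> kernel G H h" using that k kc by (simp add: kernel_def)
    then have "(x \<otimes>\<^bsub>G\<^esub> inv\<^bsub>G\<^esub> k) \<otimes>\<^bsub>G\<^esub> k \<in> K"
      using ker by (intro K.m_closed[OF _ k(2)]) blast
    then show ?thesis using that(1) kc by (simp add: h.G.m_assoc)
  qed
  have sub: "subgroup (h ` K) H" by (rule h.subgroup_img_is_subgroup[OF K.subgroup_axioms])
  have normal: "h ` K \<lhd> H"
  proof (rule h.H.normal_invI[OF sub])
    fix y z assume "y \<in> h ` K" "z \<in> carrier H"
    then have "y \<in> h ` K" "z \<in> h ` carrier G" by (simp_all only: surj)
    then obtain k x where kx: "k \<in> K" "y = h k" "x \<in> carrier G" "z = h x" by (elim imageE)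
    have "x \<otimes>\<^bsub>G\<^esub> k \<otimes>\<^bsub>G\<^esub> inv\<^bsub>G\<^esub> x \<in> K" by (rule K.inv_op_closed2[OF kx(3,1)])
    moreover have "h (x \<otimes>\<^bsub>G\<^esub> k \<otimes>\<^bsub>G\<^esub> inv\<^bsub>G\<^esub> x) = z \<otimes>\<^bsub>H\<^esub> y \<otimes>\<^bsub>H\<^esub> inv\<^bsub>H\<^esub> z"
      using kx K.mem_carrier[OF kx(1)] by simp
    ultimately show "z \<otimes>\<^bsub>H\<^esub> y \<otimes>\<^bsub>H\<^esub> inv\<^bsub>H\<^esub> z \<in> h ` K"
      by (metis imageI)
  qed
  have im: "h ` (K #>\<^bsub>G\<^esub> a) = h ` K #>\<^bsub>H\<^esub> h a" if "a \<in> carrier G" for a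
    using that K.mem_carrier by (force simp: r_coset_def)
  have "rcosets\<^bsub>H\<^esub> (h ` K) = (\<lambda>y. h ` K #>\<^bsub>H\<^esub> y) ` h ` carrier G"
    unfolding surj by (auto simp: RCOSETS_def)
  also have "\<dots> = (\<lambda>a. h ` (K #>\<^bsub>G\<^esub> a)) ` carrier G"
    unfolding image_image using im by (intro image_cong) auto
  also have "\<dots> = (\<lambda>A. h ` A) ` (rcosets\<^bsub>G\<^esub> K)" by (auto simp: RCOSETS_def)
  finally have rc: "rcosets\<^bsub>H\<^esub> (h ` K) = (\<lambda>A. h ` A) ` (rcosets\<^bsub>G\<^esub> K)" .
  have "inj_on (\<lambda>A. h ` A) (rcosets\<^bsub>G\<^esub> K)"
  proof (rule inj_onI)
    fix A B assume "A \<in> rcosets\<^bsub>G\<^esub> K" "B \<in> rcosets\<^bsub>G\<^esub> K" and eq: "h ` A = h ` B"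
    then obtain a b where ab: "a \<in> carrier G" "A = K #>\<^bsub>G\<^esub> a" "b \<in> carrier G" "B = K #>\<^bsub>G\<^esub> b"
      by (auto simp: RCOSETS_def)
    have "h ` K #>\<^bsub>H\<^esub> h a = h ` K #>\<^bsub>H\<^esub> h b" using eq ab im by simp
    then have "h a \<otimes>\<^bsub>H\<^esub> inv\<^bsub>H\<^esub> h b \<in> h ` K"
      using ab by (intro h.H.rcos_eq_iff[OF normal, THEN iffD1]) auto
    then have "a \<otimes>\<^bsub>G\<^esub> inv\<^bsub>G\<^esub> b \<in> K" using ab by (intro mem) auto
    then show "A = B"
      using ab by (simp add: h.G.rcos_eq_iff[OF K.normal_axioms])
  qed
  then have "card (rcosets\<^bsub>H\<^esub> (h ` K)) = card (rcosets\<^bsub>G\<^esub> K)" unfolding rc by (rule card_image)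
  then show "h ` K \<in> p_power_normal p H"
    using K normal by (simp add: p_power_normal_def)
qed

text \<open>If \<open>\<phi>\<close> becomes conjugation by \<open>f\<close> on the completion, then modulo \<open>K\<close> it is conjugation by
  any representative of the component \<open>f K\<close>.\<close>

lemma (in group) inner_completion_aut:
  assumes \<phi>: "\<phi> \<in> auto G" and inner: "completion_aut p G \<phi> \<in> inner_auts (pro_p_completion p G)"
    and K: "K \<in> p_power_normal p G"
  shows "\<exists>g\<in>carrier G. \<forall>x\<in>carrier G. \<phi> x \<otimes> inv (g \<otimes> x \<otimes> inv g) \<in> K"
proof -
  let ?N = "pro_p_completion p G" and ?t = "to_completion p G"
  interpret N: group ?N by (rule group_pro_p_completion)
  interpret K: normal K G by (rule p_power_normalD[OF K])
  obtain f where f: "f \<in> carrier ?N" "completion_aut p G \<phi> = conj_by ?N f"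
    using inner by (auto simp: inner_auts_def)
  obtain g where g: "g \<in> carrier G" "f K = K #> g"
    using pro_p_completionD(2)[OF f(1) K] by (auto simp: carrier_FactGroup)
  have t: "?t x \<in> carrier ?N" if "x \<in> carrier G" for x
    using to_completion_hom that by (auto simp: hom_def)
  have tK: "?t x K = K #> x" for x using K by (simp add: to_completion_def)
  have "\<phi> x \<otimes> inv (g \<otimes> x \<otimes> inv g) \<in> K" if x: "x \<in> carrier G" for x
  proof -
    have \<phi>x: "\<phi> x \<in> carrier G" using \<phi> x by (auto simp: auto_def hom_def)
    have "?t (\<phi> x) = f \<otimes>\<^bsub>?N\<^esub> ?t x \<otimes>\<^bsub>?N\<^esub> inv\<^bsub>?N\<^esub> f"
      using completion_aut_to_completion[OF \<phi> x, of p] t[OF x] unfolding f(2)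
      by (simp add: conj_by_def)
    then have "?t (\<phi> x) \<otimes>\<^bsub>?N\<^esub> f = f \<otimes>\<^bsub>?N\<^esub> ?t x"
      using f(1) t[OF x] by (simp only: N.m_assoc N.m_closed N.inv_closed N.l_inv N.r_one)
    from fun_cong[OF this, of K] have "(K #> \<phi> x) <#> (K #> g) = (K #> g) <#> (K #> x)"
      using K by (simp add: mult_pro_p_completion tK g(2))
    then have "K #> (\<phi> x \<otimes> g) = K #> (g \<otimes> x)" using \<phi>x g(1) x by (simp add: K.rcos_sum)
    then have "(\<phi> x \<otimes> g) \<otimes> inv (g \<otimes> x) \<in> K"
      using \<phi>x g(1) x by (intro rcos_eq_iff[OF K.normal_axioms, THEN iffD1]) auto
    moreover have "(\<phi> x \<otimes> g) \<otimes> inv (g \<otimes> x) = \<phi> x \<otimes> inv (g \<otimes> x \<otimes> inv g)"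
      using \<phi>x g(1) x by (simp add: word_simps)
    ultimately show ?thesis by simp
  qed
  then show ?thesis using g(1) by blast
qed

lemma inner_if_completion_inner:
  fixes N :: "('a, 'm) monoid_scheme"
  assumes N: "fg_free_nilpotent N" and p: "prime p" and \<phi>: "\<phi> \<in> auto N"
    and inner: "completion_aut p N \<phi> \<in> inner_auts (pro_p_completion p N)"
  shows "\<phi> \<in> inner_auts N"
proof -
  obtain n c where "group N" and c: "c \<ge> 1"
    and iso: "N \<cong> free_group n Mod lower_central (free_group n) (c + 1)"
    using N by (auto simp: fg_free_nilpotent_def)
  let ?F = "free_group n" and ?X = "\<lambda>i::nat. [(True, i)]"
  obtain \<mu> where "magnus ?F n ?X \<mu>" using magnus_free_group by blast
  then interpret F: magnus ?F n ?X \<mu> .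
  interpret N: group N by fact
  let ?L = "lower_central ?F (Suc c)"
  interpret L: normal ?L ?F by (rule F.normal_lower_central)
  interpret Q: group "?F Mod ?L" by (rule L.factorgroup_is_group)
  obtain k where k: "k \<in> iso (?F Mod ?L) N"
    using N.iso_sym[of "?F Mod ?L"] iso by (auto simp: is_iso_def)
  define \<pi> where "\<pi> a = k (?L #>\<^bsub>?F\<^esub> a)" for a
  have "k \<in> hom (?F Mod ?L) N" using k by (simp add: iso_def)
  moreover have "\<pi> = k \<circ> (\<lambda>a. ?L #>\<^bsub>?F\<^esub> a)" by (simp add: fun_eq_iff \<pi>_def)
  ultimately have "\<pi> \<in> hom ?F N"
    using hom_compose[OF L.r_coset_hom_Mod] by simp
  then interpret \<pi>: group_hom ?F N \<pi>
    by unfold_locales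
  have "\<pi> ` carrier ?F = k ` carrier (?F Mod ?L)"
    by (auto simp: \<pi>_def carrier_FactGroup)
  also have "\<dots> = carrier N" using k by (simp add: iso_def bij_betw_def)
  finally have surj: "\<pi> ` carrier ?F = carrier N" .
  have ker: "a \<in> ?L" if a: "a \<in> carrier ?F" "\<pi> a = \<one>\<^bsub>N\<^esub>" for a
  proof -
    have "k (?L #>\<^bsub>?F\<^esub> a) = k (?L #>\<^bsub>?F\<^esub> \<one>\<^bsub>?F\<^esub>)"
      using trans[OF a(2) \<pi>.hom_one[symmetric]] unfolding \<pi>_def .
    moreover have "inj_on k (carrier (?F Mod ?L))" using k by (simp add: iso_def bij_betw_def)
    ultimately have "?L #>\<^bsub>?F\<^esub> a = ?L #>\<^bsub>?F\<^esub> \<one>\<^bsub>?F\<^esub>"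
      using a(1) by (elim inj_onD) (auto simp: carrier_FactGroup)
    then have "a \<otimes>\<^bsub>?F\<^esub> inv\<^bsub>?F\<^esub> \<one>\<^bsub>?F\<^esub> \<in> ?L"
      using a(1) by (intro F.rcos_eq_iff[OF L.normal_axioms, THEN iffD1]) auto
    then show ?thesis using a(1) by simp
  qed
  have ker': "\<pi> a = \<one>\<^bsub>N\<^esub>" if "a \<in> ?L" for a
  proof -
    have "?L #>\<^bsub>?F\<^esub> a = ?L #>\<^bsub>?F\<^esub> \<one>\<^bsub>?F\<^esub>"
      using that F.lower_central_carrier[OF that]
      by (intro F.rcos_eq_iff[OF L.normal_axioms, THEN iffD2]) auto
    then have "\<pi> a = \<pi> \<one>\<^bsub>?F\<^esub>" unfolding \<pi>_def by simp
    then show ?thesis using \<pi>.hom_one by simp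
  qed
  have \<phi>c: "\<phi> y \<in> carrier N" if "y \<in> carrier N" for y using \<phi> that by (auto simp: auto_def hom_def)
  note X = F.X_closed
  have "\<exists>a. a \<in> carrier ?F \<and> \<pi> a = \<phi> (\<pi> (?X i))" if "i < n" for i
  proof -
    have "\<phi> (\<pi> (?X i)) \<in> \<pi> ` carrier ?F" unfolding surj by (intro \<phi>c \<pi>.hom_closed X that)
    then show ?thesis by (elim imageE) auto
  qed
  then have "\<forall>i\<in>{..<n}. \<exists>a. a \<in> carrier ?F \<and> \<pi> a = \<phi> (\<pi> (?X i))" by blast
  from bchoice[OF this] obtain f where f: "\<And>i. i < n \<Longrightarrow> f i \<in> carrier ?F"
    "\<And>i. i < n \<Longrightarrow> \<pi> (f i) = \<phi> (\<pi> (?X i))"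
    by blast
  have \<pi>conj: "\<pi> (f i \<otimes>\<^bsub>?F\<^esub> inv\<^bsub>?F\<^esub> (g \<otimes>\<^bsub>?F\<^esub> ?X i \<otimes>\<^bsub>?F\<^esub> inv\<^bsub>?F\<^esub> g)) =
      \<phi> (\<pi> (?X i)) \<otimes>\<^bsub>N\<^esub> inv\<^bsub>N\<^esub> (\<pi> g \<otimes>\<^bsub>N\<^esub> \<pi> (?X i) \<otimes>\<^bsub>N\<^esub> inv\<^bsub>N\<^esub> \<pi> g)"
    if "i < n" "g \<in> carrier ?F" for i g
    using that f X[of i] by (simp only: \<pi>.hom_mult \<pi>.hom_inv F.m_closed F.inv_closed)
  have "\<exists>g\<in>carrier ?F. \<forall>i<n.
      f i \<otimes>\<^bsub>?F\<^esub> inv\<^bsub>?F\<^esub> (g \<otimes>\<^bsub>?F\<^esub> ?X i \<otimes>\<^bsub>?F\<^esub> inv\<^bsub>?F\<^esub> g) \<in> ?L"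
  proof (rule F.conjugate_lower_central[OF p f(1) c])
    fix r
    let ?K = "F.jet_kernel p c r"
    have K: "?K \<in> p_power_normal p ?F" by (rule F.jet_kernel_p_power_normal[OF p])
    have "kernel ?F N \<pi> \<subseteq> ?K"
      using ker F.lower_central_jet_kernel[of c p r] by (auto simp: kernel_def)
    note im = image_p_power_normal[OF \<pi>.group_hom_axioms surj K this]
    obtain y where y: "y \<in> carrier N"
      "\<And>x. x \<in> carrier N \<Longrightarrow> \<phi> x \<otimes>\<^bsub>N\<^esub> inv\<^bsub>N\<^esub> (y \<otimes>\<^bsub>N\<^esub> x \<otimes>\<^bsub>N\<^esub> inv\<^bsub>N\<^esub> y) \<in> \<pi> ` ?K"
      using N.inner_completion_aut[OF \<phi> inner im(1)] by blast
    obtain g where g: "g \<in> carrier ?F" "y = \<pi> g"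
      using y(1) unfolding surj[symmetric] by (elim imageE)
    have "f i \<otimes>\<^bsub>?F\<^esub> inv\<^bsub>?F\<^esub> (g \<otimes>\<^bsub>?F\<^esub> ?X i \<otimes>\<^bsub>?F\<^esub> inv\<^bsub>?F\<^esub> g) \<in> ?K" if i: "i < n" for i
    proof (rule im(2))
      show "\<pi> (f i \<otimes>\<^bsub>?F\<^esub> inv\<^bsub>?F\<^esub> (g \<otimes>\<^bsub>?F\<^esub> ?X i \<otimes>\<^bsub>?F\<^esub> inv\<^bsub>?F\<^esub> g)) \<in> \<pi> ` ?K"
        unfolding \<pi>conj[OF i g(1)] using y(2)[of "\<pi> (?X i)"] X[OF i] g(2) by simp
    qed (intro F.m_closed F.inv_closed f i g X)
    then show "\<exists>g\<in>carrier ?F. \<forall>i<n.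
        f i \<otimes>\<^bsub>?F\<^esub> inv\<^bsub>?F\<^esub> (g \<otimes>\<^bsub>?F\<^esub> ?X i \<otimes>\<^bsub>?F\<^esub> inv\<^bsub>?F\<^esub> g) \<in> ?K" using g(1) by blast
  qed
  then obtain g where g: "g \<in> carrier ?F"
    "\<And>i. i < n \<Longrightarrow> f i \<otimes>\<^bsub>?F\<^esub> inv\<^bsub>?F\<^esub> (g \<otimes>\<^bsub>?F\<^esub> ?X i \<otimes>\<^bsub>?F\<^esub> inv\<^bsub>?F\<^esub> g) \<in> ?L" by blast
  have y: "\<pi> g \<in> carrier N" using g(1) by simp
  let ?c = "conj_by N (\<pi> g)"
  have hom: "\<phi> \<circ> \<pi> \<in> hom ?F N" "?c \<circ> \<pi> \<in> hom ?F N"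
    by (rule hom_compose[OF \<pi>.homh]; use \<phi> N.conj_by_auto[OF y] in \<open>simp add: auto_def\<close>)+
  have "carrier ?F \<subseteq> {x \<in> carrier ?F. (\<phi> \<circ> \<pi>) x = (?c \<circ> \<pi>) x}"
  proof (rule F.generate_induct[OF subgroup_equalizer[OF group_free_group \<open>group N\<close> hom]])
    fix i assume i: "i < n"
    have xc: "\<pi> (?X i) \<in> carrier N" using X[OF i] by simp
    have "\<phi> (\<pi> (?X i)) \<otimes>\<^bsub>N\<^esub> inv\<^bsub>N\<^esub> (\<pi> g \<otimes>\<^bsub>N\<^esub> \<pi> (?X i) \<otimes>\<^bsub>N\<^esub> inv\<^bsub>N\<^esub> \<pi> g) = \<one>\<^bsub>N\<^esub>"
      using ker'[OF g(2)[OF i]] unfolding \<pi>conj[OF i g(1)] .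
    then have "\<phi> (\<pi> (?X i)) = inv\<^bsub>N\<^esub> (inv\<^bsub>N\<^esub> (\<pi> g \<otimes>\<^bsub>N\<^esub> \<pi> (?X i) \<otimes>\<^bsub>N\<^esub> inv\<^bsub>N\<^esub> \<pi> g))"
      using \<phi>c[OF xc] xc y by (intro N.inv_equality[symmetric]) auto
    also have "\<dots> = \<pi> g \<otimes>\<^bsub>N\<^esub> \<pi> (?X i) \<otimes>\<^bsub>N\<^esub> inv\<^bsub>N\<^esub> \<pi> g"
      using xc y by (intro N.inv_inv N.m_closed N.inv_closed)
    finally have "\<phi> (\<pi> (?X i)) = \<pi> g \<otimes>\<^bsub>N\<^esub> \<pi> (?X i) \<otimes>\<^bsub>N\<^esub> inv\<^bsub>N\<^esub> \<pi> g" .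
    then show "?X i \<in> {x \<in> carrier ?F. (\<phi> \<circ> \<pi>) x = (?c \<circ> \<pi>) x}"
      using X[OF i] xc by (simp add: conj_by_def)
  qed
  then have eq: "\<phi> (\<pi> a) = ?c (\<pi> a)" if "a \<in> carrier ?F" for a using that by auto
  have "\<phi> x = ?c x" if "x \<in> carrier N" for x
  proof -
    have "x \<in> \<pi> ` carrier ?F" using that by (simp only: surj)
    then obtain a where "x = \<pi> a" "a \<in> carrier ?F" by (rule imageE)
    then show ?thesis using eq by simp
  qed
  then have "\<phi> = ?c"
    using \<phi> by (intro extensionalityI[of _ "carrier N"]) (auto simp: auto_def Bij_def conj_by_def)
  then show ?thesis using y by (simp add: inner_auts_def)
qed

theorem theoremA1:
  fixes N :: "('a, 'm) monoid_scheme" and p :: nat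
  assumes "fg_free_nilpotent N" and "prime p"
  shows "inj_on (out_completion_map p N) (carrier (Out N))"
proof -
  let ?C = "pro_p_completion p N" and ?T = "pro_p_topology p N"
  interpret N: group N using assms(1) by (simp add: fg_free_nilpotent_def)
  have p: "p > 0" using prime_gt_0_nat[OF assms(2)] .
  interpret I: normal "inner_auts N" "AutoGroup N" by (rule N.normal_inner_AutoGroup)
  interpret J: normal "inner_auts ?C" "ContAutoGroup ?C ?T" by (rule N.normal_inner_pro_p[OF p])
  interpret h: group_hom "Out N" "ContOut ?C ?T" "out_completion_map p N"
    by (simp add: group_hom_def group_hom_axioms_def N.group_Out N.group_ContOut_pro_p[OF p]
        N.out_completion_map_hom[OF p])
  have "A = \<one>\<^bsub>Out N\<^esub>" if A: "A \<in> carrier (Out N)" "out_completion_map p N A = \<one>\<^bsub>ContOut ?C ?T\<^esub>" for A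
  proof -
    obtain \<phi> where \<phi>: "\<phi> \<in> carrier (AutoGroup N)" "A = inner_auts N #>\<^bsub>AutoGroup N\<^esub> \<phi>"
      using A(1) by (auto simp: Out_def carrier_FactGroup)
    have \<phi>': "\<phi> \<in> auto N" using \<phi>(1) by (simp add: AutoGroup_def)
    have "inner_auts ?C #>\<^bsub>ContAutoGroup ?C ?T\<^esub> completion_aut p N \<phi> = inner_auts ?C"
      using A(2) unfolding \<phi>(2) N.out_completion_map_class[OF p \<phi>(1)] by (simp add: ContOut_def)
    then have "completion_aut p N \<phi> \<in> inner_auts ?C"
      using J.rcos_self[OF N.completion_aut_in_ContAutoGroup[OF \<phi>'] J.subgroup_axioms] by simp
    then have "\<phi> \<in> inner_auts N"
      by (rule inner_if_completion_inner[OF assms \<phi>'])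
    then show ?thesis
      unfolding \<phi>(2) by (simp add: Out_def I.rcos_const[OF I.is_group])
  qed
  then show ?thesis
    by (intro h.trivial_ker_imp_inj) (auto simp: kernel_def)
qed

end
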